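(* Let $I$ be a set of maps of a locally presentable category $\mathcal K$. Let $\mathcal A$ be a coreflective small cone-injectivity class of $\mathcal K$ such that each map of each cone is an element of $\mathrm{cof}_{\mathcal K}(I)$. Then there exists a set of maps $J$ of $\mathcal A$ such that $\mathrm{cof}_{\mathcal K}(I)\cap\mathrm{Mor}(\mathcal A)=\mathrm{cof}_{\mathcal A}(J)$.
   Context: For a category $\mathcal K$ and a class $\mathcal C$ of maps of $\mathcal K$, $\mathrm{inj}_{\mathcal K}(\mathcal C)$ is the class of maps of $\mathcal K$ with the right lifting property with respect to every map of $\mathcal C$, and $\mathrm{cof}_{\mathcal K}(\mathcal C)$ is the class of maps of $\mathcal K$ with the left lifting property with respect to every map of $\mathrm{inj}_{\mathcal K}(\mathcal C)$. $\mathrm{Mor}(\mathcal A)$ denotes the category (class) of maps of $\mathcal A$. Subcategories are isomorphism-closed; a coreflective subcategory is a full subcategory whose inclusion functor has a right adjoint. An object $K$ of $\mathcal K$ is injective with respect to a (set-indexed) cone of maps $(a_i:A\to A_i)_{i\in I_0}$ if every map $A\to K$ factors through $a_i$ for some $i\in I_0$. A small cone-injectivity class of $\mathcal K$ is the full subcategory of the objects injective with respect to every cone of a given set of cones. "Each map of each cone" refers to all the maps $a_i:A\to A_i$ in the given set of cones defining $\mathcal A$. *)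

theory Defs
  imports Main "HOL-Library.FuncSet"
begin

unbundle cardinal_syntax

text \<open>
  Size: the distinction between sets and classes is made relative to a strongly inaccessible
  cardinal \<open>\<kappa>\<close>, i.e. to a Grothendieck universe. A collection is a set if it has fewer than
  \<open>\<kappa>\<close> elements. As every such collection is in bijection with a subset of \<open>Field \<kappa>\<close>, index sets,
  index categories and smaller cardinals are taken over the type \<open>'v\<close> of \<open>\<kappa>\<close>.
\<close>

definition inaccessible :: "'v rel \<Rightarrow> bool" where
  "inaccessible \<kappa> \<longleftrightarrow> Card_order \<kappa> \<and> natLeq <o \<kappa> \<and> regularCard \<kappa> \<and>
     (\<forall>A :: 'v set. |A| <o \<kappa> \<longrightarrow> |Pow A| <o \<kappa>)"

definition small :: "'v rel \<Rightarrow> 'x set \<Rightarrow> bool" where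
  "small \<kappa> X \<longleftrightarrow> |X| <o \<kappa>"

definition small_regular_cardinal :: "'v rel \<Rightarrow> 'v rel \<Rightarrow> bool" where
  "small_regular_cardinal \<kappa> l \<longleftrightarrow> Card_order l \<and> cinfinite l \<and> regularCard l \<and> l <o \<kappa>"

record ('o, 'a) cat =
  Obj :: "'o set"
  Arr :: "'a set"
  Dom :: "'a \<Rightarrow> 'o"
  Cod :: "'a \<Rightarrow> 'o"
  Ident :: "'o \<Rightarrow> 'a"
  Comp :: "'a \<Rightarrow> 'a \<Rightarrow> 'a"  (infixr "\<cdot>\<index>" 70)

definition hom :: "('o, 'a) cat \<Rightarrow> 'o \<Rightarrow> 'o \<Rightarrow> 'a set" where
  "hom C X Y = {f \<in> Arr C. Dom C f = X \<and> Cod C f = Y}"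

definition category :: "('o, 'a) cat \<Rightarrow> bool" where
  "category C \<longleftrightarrow>
     (\<forall>f \<in> Arr C. Dom C f \<in> Obj C \<and> Cod C f \<in> Obj C) \<and>
     (\<forall>X \<in> Obj C. Ident C X \<in> hom C X X) \<and>
     (\<forall>f \<in> Arr C. \<forall>g \<in> Arr C. Dom C g = Cod C f \<longrightarrow>
        g \<cdot>\<^bsub>C\<^esub> f \<in> hom C (Dom C f) (Cod C g)) \<and>
     (\<forall>f \<in> Arr C. Ident C (Cod C f) \<cdot>\<^bsub>C\<^esub> f = f \<and> f \<cdot>\<^bsub>C\<^esub> Ident C (Dom C f) = f) \<and>
     (\<forall>f \<in> Arr C. \<forall>g \<in> Arr C. \<forall>h \<in> Arr C. Dom C g = Cod C f \<longrightarrow> Dom C h = Cod C g \<longrightarrow>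
        (h \<cdot>\<^bsub>C\<^esub> g) \<cdot>\<^bsub>C\<^esub> f = h \<cdot>\<^bsub>C\<^esub> (g \<cdot>\<^bsub>C\<^esub> f))"

definition isomorphic :: "('o, 'a) cat \<Rightarrow> 'o \<Rightarrow> 'o \<Rightarrow> bool" where
  "isomorphic C X Y \<longleftrightarrow> (\<exists>f \<in> hom C X Y. \<exists>g \<in> hom C Y X.
     g \<cdot>\<^bsub>C\<^esub> f = Ident C X \<and> f \<cdot>\<^bsub>C\<^esub> g = Ident C Y)"

definition locally_small :: "'v rel \<Rightarrow> ('o, 'a) cat \<Rightarrow> bool" where
  "locally_small \<kappa> C \<longleftrightarrow> (\<forall>X \<in> Obj C. \<forall>Y \<in> Obj C. small \<kappa> (hom C X Y))"

record ('o, 'a, 'p, 'b) cfunctor =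
  OMap :: "'o \<Rightarrow> 'p"
  AMap :: "'a \<Rightarrow> 'b"

definition is_functor ::
  "('o, 'a) cat \<Rightarrow> ('p, 'b) cat \<Rightarrow> ('o, 'a, 'p, 'b) cfunctor \<Rightarrow> bool" where
  "is_functor C D F \<longleftrightarrow>
     (\<forall>X \<in> Obj C. OMap F X \<in> Obj D) \<and>
     (\<forall>f \<in> Arr C. AMap F f \<in> hom D (OMap F (Dom C f)) (OMap F (Cod C f))) \<and>
     (\<forall>X \<in> Obj C. AMap F (Ident C X) = Ident D (OMap F X)) \<and>
     (\<forall>f \<in> Arr C. \<forall>g \<in> Arr C. Dom C g = Cod C f \<longrightarrow>
        AMap F (g \<cdot>\<^bsub>C\<^esub> f) = AMap F g \<cdot>\<^bsub>D\<^esub> AMap F f)"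

definition comp_functor ::
  "('p, 'b, 'q, 'c) cfunctor \<Rightarrow> ('o, 'a, 'p, 'b) cfunctor \<Rightarrow> ('o, 'a, 'q, 'c) cfunctor" where
  "comp_functor G F = \<lparr>OMap = OMap G \<circ> OMap F, AMap = AMap G \<circ> AMap F\<rparr>"

definition is_cocone ::
  "('j, 'u) cat \<Rightarrow> ('o, 'a) cat \<Rightarrow> ('j, 'u, 'o, 'a) cfunctor \<Rightarrow> 'o \<Rightarrow> ('j \<Rightarrow> 'a) \<Rightarrow> bool" where
  "is_cocone J C D L c \<longleftrightarrow> L \<in> Obj C \<and>
     (\<forall>j \<in> Obj J. c j \<in> hom C (OMap D j) L) \<and>
     (\<forall>u \<in> Arr J. c (Cod J u) \<cdot>\<^bsub>C\<^esub> AMap D u = c (Dom J u))"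

definition is_colimit ::
  "('j, 'u) cat \<Rightarrow> ('o, 'a) cat \<Rightarrow> ('j, 'u, 'o, 'a) cfunctor \<Rightarrow> 'o \<Rightarrow> ('j \<Rightarrow> 'a) \<Rightarrow> bool" where
  "is_colimit J C D L c \<longleftrightarrow> is_cocone J C D L c \<and>
     (\<forall>M d. is_cocone J C D M d \<longrightarrow>
        (\<exists>!h. h \<in> hom C L M \<and> (\<forall>j \<in> Obj J. h \<cdot>\<^bsub>C\<^esub> c j = d j)))"

definition cocomplete :: "'v rel \<Rightarrow> ('o, 'a) cat \<Rightarrow> bool" where
  "cocomplete \<kappa> C \<longleftrightarrow>
     (\<forall>(J :: ('v, 'v) cat) D. category J \<longrightarrow> small \<kappa> (Obj J) \<longrightarrow> small \<kappa> (Arr J) \<longrightarrow>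
        is_functor J C D \<longrightarrow> (\<exists>L c. is_colimit J C D L c))"

text \<open>An arrow of \<open>set_cat\<close> is a triple consisting of its domain, its codomain and an extensional
  function.\<close>

definition set_cat :: "'v rel \<Rightarrow> ('x set, 'x set \<times> 'x set \<times> ('x \<Rightarrow> 'x)) cat" where
  "set_cat \<kappa> = \<lparr>
     Obj = {A. small \<kappa> A},
     Arr = {(A, B, f). small \<kappa> A \<and> small \<kappa> B \<and> f \<in> A \<rightarrow>\<^sub>E B},
     Dom = (\<lambda>(A, B, f). A),
     Cod = (\<lambda>(A, B, f). B),
     Ident = (\<lambda>A. (A, A, restrict id A)),
     Comp = (\<lambda>(B', D, g) (A, B, f). (A, D, compose A g f))\<rparr>"

text \<open>The functor \<open>hom(X, -)\<close>. Its values are sets over \<open>'a + 'v\<close>, the injection \<open>Inl\<close> being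
  bookkeeping: the summand \<open>'v\<close> guarantees that \<open>set_cat \<kappa>\<close> over this type contains sets of every
  cardinality below \<open>\<kappa>\<close>, so that colimits in it are colimits in the category of all sets.\<close>

definition hom_functor ::
  "('o, 'a) cat \<Rightarrow> 'o \<Rightarrow>
   ('o, 'a, ('a + 'v) set, ('a + 'v) set \<times> ('a + 'v) set \<times> ('a + 'v \<Rightarrow> 'a + 'v)) cfunctor" where
  "hom_functor C X = \<lparr>
     OMap = (\<lambda>Y. Inl ` hom C X Y),
     AMap = (\<lambda>f. (Inl ` hom C X (Dom C f), Inl ` hom C X (Cod C f),
        (\<lambda>x \<in> Inl ` hom C X (Dom C f). Inl (f \<cdot>\<^bsub>C\<^esub> projl x))))\<rparr>"

definition directed_poset :: "'v rel \<Rightarrow> 'v rel \<Rightarrow> 'v set \<Rightarrow> 'v rel \<Rightarrow> bool" where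
  "directed_poset \<kappa> l P r \<longleftrightarrow> small \<kappa> P \<and> partial_order_on P r \<and>
     (\<forall>S \<subseteq> P. |S| <o l \<longrightarrow> (\<exists>u \<in> P. \<forall>s \<in> S. (s, u) \<in> r))"

definition poset_cat :: "'v set \<Rightarrow> 'v rel \<Rightarrow> ('v, 'v \<times> 'v) cat" where
  "poset_cat P r = \<lparr>Obj = P, Arr = r, Dom = fst, Cod = snd, Ident = (\<lambda>p. (p, p)),
     Comp = (\<lambda>g f. (fst f, snd g))\<rparr>"

definition presentable_object :: "'v rel \<Rightarrow> 'v rel \<Rightarrow> ('o, 'a) cat \<Rightarrow> 'o \<Rightarrow> bool" where
  "presentable_object \<kappa> l C X \<longleftrightarrow> X \<in> Obj C \<and>
     (\<forall>P r D L c. directed_poset \<kappa> l P r \<longrightarrow> is_functor (poset_cat P r) C D \<longrightarrow>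
        is_colimit (poset_cat P r) C D L c \<longrightarrow>
        (let H = (hom_functor C X :: ('o, 'a, ('a + 'v) set, _) cfunctor) in
         is_colimit (poset_cat P r) (set_cat \<kappa>) (comp_functor H D) (OMap H L) (AMap H \<circ> c)))"

definition locally_l_presentable :: "'v rel \<Rightarrow> 'v rel \<Rightarrow> ('o, 'a) cat \<Rightarrow> bool" where
  "locally_l_presentable \<kappa> l C \<longleftrightarrow> category C \<and> locally_small \<kappa> C \<and> cocomplete \<kappa> C \<and>
     (\<exists>G. small \<kappa> G \<and> (\<forall>X \<in> G. presentable_object \<kappa> l C X) \<and>
        (\<forall>Y \<in> Obj C. \<exists>P r D c. directed_poset \<kappa> l P r \<and> is_functor (poset_cat P r) C D \<and>
           (\<forall>p \<in> P. OMap D p \<in> G) \<and> is_colimit (poset_cat P r) C D Y c))"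

definition locally_presentable :: "'v rel \<Rightarrow> ('o, 'a) cat \<Rightarrow> bool" where
  "locally_presentable \<kappa> C \<longleftrightarrow>
     (\<exists>l. small_regular_cardinal \<kappa> l \<and> locally_l_presentable \<kappa> l C)"

definition lifts :: "('o, 'a) cat \<Rightarrow> 'a \<Rightarrow> 'a \<Rightarrow> bool" where
  "lifts C i p \<longleftrightarrow>
     (\<forall>u \<in> hom C (Dom C i) (Dom C p). \<forall>v \<in> hom C (Cod C i) (Cod C p).
        p \<cdot>\<^bsub>C\<^esub> u = v \<cdot>\<^bsub>C\<^esub> i \<longrightarrow>
        (\<exists>h \<in> hom C (Cod C i) (Dom C p). h \<cdot>\<^bsub>C\<^esub> i = u \<and> p \<cdot>\<^bsub>C\<^esub> h = v))"

definition inj_maps :: "('o, 'a) cat \<Rightarrow> 'a set \<Rightarrow> 'a set" where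
  "inj_maps C S = {p \<in> Arr C. \<forall>i \<in> S. lifts C i p}"

definition cof_maps :: "('o, 'a) cat \<Rightarrow> 'a set \<Rightarrow> 'a set" where
  "cof_maps C S = {i \<in> Arr C. \<forall>p \<in> inj_maps C S. lifts C i p}"

definition full_subcat :: "('o, 'a) cat \<Rightarrow> 'o set \<Rightarrow> ('o, 'a) cat" where
  "full_subcat C S =
     C\<lparr>Obj := S, Arr := {f \<in> Arr C. Dom C f \<in> S \<and> Cod C f \<in> S}\<rparr>"

definition inclusion_functor :: "('o, 'a, 'o, 'a) cfunctor" where
  "inclusion_functor = \<lparr>OMap = id, AMap = id\<rparr>"

definition right_adjoint ::
  "('o, 'a) cat \<Rightarrow> ('p, 'b) cat \<Rightarrow> ('o, 'a, 'p, 'b) cfunctor \<Rightarrow> ('p, 'b, 'o, 'a) cfunctor \<Rightarrow> bool"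
  where
  "right_adjoint C D F G \<longleftrightarrow> is_functor C D F \<and> is_functor D C G \<and>
     (\<exists>\<phi>.
        (\<forall>X \<in> Obj C. \<forall>Y \<in> Obj D. bij_betw (\<phi> X Y) (hom D (OMap F X) Y) (hom C X (OMap G Y))) \<and>
        (\<forall>f \<in> Arr C. \<forall>g \<in> Arr D. \<forall>h \<in> hom D (OMap F (Cod C f)) (Dom D g).
           \<phi> (Dom C f) (Cod D g) (g \<cdot>\<^bsub>D\<^esub> h \<cdot>\<^bsub>D\<^esub> AMap F f) =
           AMap G g \<cdot>\<^bsub>C\<^esub> \<phi> (Cod C f) (Dom D g) h \<cdot>\<^bsub>C\<^esub> f))"

definition coreflective :: "('o, 'a) cat \<Rightarrow> 'o set \<Rightarrow> bool" where
  "coreflective C S \<longleftrightarrow> S \<subseteq> Obj C \<and>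
     (\<forall>X \<in> S. \<forall>Y \<in> Obj C. isomorphic C X Y \<longrightarrow> Y \<in> S) \<and>
     (\<exists>R. right_adjoint (full_subcat C S) C inclusion_functor R)"

text \<open>A cone \<open>(A, I\<^sub>0, a)\<close> is a family of maps \<open>a i : A \<rightarrow> A\<^sub>i\<close> indexed by the possibly empty
  set \<open>I\<^sub>0\<close>; the values of \<open>a\<close> outside \<open>I\<^sub>0\<close> are irrelevant.\<close>

type_synonym ('o, 'a, 'v) cone = "'o \<times> 'v set \<times> ('v \<Rightarrow> 'a)"

definition is_cone :: "'v rel \<Rightarrow> ('o, 'a) cat \<Rightarrow> ('o, 'a, 'v) cone \<Rightarrow> bool" where
  "is_cone \<kappa> C = (\<lambda>(A, I0, a). A \<in> Obj C \<and> small \<kappa> I0 \<and>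
     (\<forall>i \<in> I0. a i \<in> Arr C \<and> Dom C (a i) = A))"

definition cone_injective :: "('o, 'a) cat \<Rightarrow> ('o, 'a, 'v) cone \<Rightarrow> 'o \<Rightarrow> bool" where
  "cone_injective C = (\<lambda>(A, I0, a) X. \<forall>f \<in> hom C A X.
     \<exists>i \<in> I0. \<exists>g \<in> hom C (Cod C (a i)) X. g \<cdot>\<^bsub>C\<^esub> a i = f)"

definition cone_injectivity_class :: "('o, 'a) cat \<Rightarrow> ('o, 'a, 'v) cone set \<Rightarrow> 'o set" where
  "cone_injectivity_class C Q = {X \<in> Obj C. \<forall>q \<in> Q. cone_injective C q X}"

end

(*
  If q : Z -> Y lies in inj(I) and Y lies in A, then so does Z: for b : B -> Z the map q b extends along
  some a_i : B -> A_i, and as a_i is in cof(I) this extension lifts through q. So the (cof(I), inj(I))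
  factorization given by the small object argument restricts to A, and by the retract argument it is
  enough to find a set J of maps in cof(I) between objects of A such that every map of A in inj(J) is
  in inj(I).

  A satisfies the solution-set condition: every map U -> X with X in A factors through one of a set of
  maps U -> X' with X' in A, obtained by attaching maps of the cones. Consider a square from i : U -> V
  in I to a map X -> Y of A. Factor U -> X through some s : U -> X', and the induced map to Y from the
  pushout P of i and s through some t : P -> Y'. Let X' -> Z -> Y' be the (cof(I), inj(I)) factorization
  of X' -> P -> Y'. Then Z is in A, and V -> Y' lifts to Z, so the square factors through X' -> Z.
  These maps X' -> Z form the set J.
*)

theory Submission
  imports Defs
begin

section \<open>Small sets and regular cardinals\<close>

text \<open>The obstacle is that the solution set for U must not depend on the target X, whereas the
  cells attached at a stage do: they are those along which the map to X extends. But X enters the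
  construction only through a yes-or-no decision for each possible cell. Given the earlier stages,
  only a subset of a small set is left to be chosen, so by inaccessibility of
  \<open>\<kappa>\<close> there are few sequences of a given small length. For this the colimit at
  each stage has to be a function of the earlier data alone.

  The same sequences give the small object argument, once cells carry as label a map to the target,
  by which the lift over the target is prescribed. In both cases the length \<open>\<mu>\<close> is
  a regular cardinal exceeding the sizes of the directed diagrams that present the domains of the
  attached maps as colimits of presentable objects.

  A single square needs two solution sets: the one for U makes X' an object of A, and the one for P
  makes Y' an object of A, without which nothing would put Z into A.\<close>

lemma ordLess_finite_infinite:
  assumes "natLeq <o r" "finite X"
  shows "|X| <o r"
  using assms finite_iff_ordLess_natLeq ordLess_transitive by blast

locale universe =
  fixes \<kappa> :: "'v rel"
  assumes inacc: "inaccessible \<kappa>"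
begin

lemma card_order: "Card_order \<kappa>" and natLeq_less: "natLeq <o \<kappa>" and regular: "regularCard \<kappa>"
  and strong_limit: "\<And>A :: 'v set. |A| <o \<kappa> \<Longrightarrow> |Pow A| <o \<kappa>"
  using inacc unfolding inaccessible_def by auto

lemma Cinfinite: "Cinfinite \<kappa>"
  using card_order natLeq_less natLeq_ordLeq_cinfinite cinfinite_mono natLeq_Cinfinite
  by (metis ordLess_imp_ordLeq)

lemma small_finite: "finite X \<Longrightarrow> small \<kappa> X"
  unfolding small_def using ordLess_finite_infinite natLeq_less by blast

lemma small_subset: "small \<kappa> Y \<Longrightarrow> X \<subseteq> Y \<Longrightarrow> small \<kappa> X"
  unfolding small_def using card_of_mono1 ordLeq_ordLess_trans by blast

lemma small_image: "small \<kappa> X \<Longrightarrow> small \<kappa> (f ` X)"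
  unfolding small_def using card_of_image ordLeq_ordLess_trans by blast

lemma small_inj_on: "small \<kappa> Y \<Longrightarrow> inj_on f X \<Longrightarrow> f ` X \<subseteq> Y \<Longrightarrow> small \<kappa> X"
  unfolding small_def using card_of_ordLeqI ordLeq_ordLess_trans
  by (metis image_subset_iff)

lemma small_UN: "small \<kappa> X \<Longrightarrow> (\<And>x. x \<in> X \<Longrightarrow> small \<kappa> (B x)) \<Longrightarrow> small \<kappa> (\<Union>x\<in>X. B x)"
  unfolding small_def
  using card_of_UNION_ordLess_infinite_Field_regularCard[OF regular Cinfinite] by blast

lemma small_Sigma: "small \<kappa> X \<Longrightarrow> (\<And>x. x \<in> X \<Longrightarrow> small \<kappa> (B x)) \<Longrightarrow> small \<kappa> (Sigma X B)"
  unfolding Sigma_def by (intro small_UN) (auto simp: small_finite)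

lemma small_Plus: "small \<kappa> X \<Longrightarrow> small \<kappa> Y \<Longrightarrow> small \<kappa> (X <+> Y)"
proof -
  assume "small \<kappa> X" "small \<kappa> Y"
  then have "small \<kappa> (\<Union>b\<in>{True, False}. if b then Inl ` X else Inr ` Y)"
    by (intro small_UN) (auto simp: small_finite small_image)
  then show ?thesis by (rule small_subset) auto
qed

lemma small_Un: "small \<kappa> X \<Longrightarrow> small \<kappa> Y \<Longrightarrow> small \<kappa> (X \<union> Y)"
proof -
  assume "small \<kappa> X" "small \<kappa> Y"
  then have "small \<kappa> (\<Union>b\<in>{True, False}. if b then X else Y)"
    by (intro small_UN) (auto simp: small_finite)
  then show ?thesis by (rule small_subset) auto
qed

lemma small_embed:
  assumes "small \<kappa> X"
  obtains g :: "_ \<Rightarrow> 'v" where "inj_on g X"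
proof -
  have "|X| \<le>o |Field \<kappa>|"
    using assms card_order unfolding small_def
    by (meson card_of_Field_ordIso ordIso_symmetric ordLess_imp_ordLeq ordLess_ordIso_trans)
  then show ?thesis using that card_of_ordLeq by metis
qed

text \<open>The strong limit property speaks only of sets over \<open>'v\<close>, so the set is
  moved there along an injection.\<close>

lemma small_Pow: 
  assumes "small \<kappa> X"
  shows "small \<kappa> (Pow X)"
proof -
  obtain g :: "_ \<Rightarrow> 'v" where g: "inj_on g X" using small_embed[OF assms] .
  have "small \<kappa> (Pow (g ` X))"
    using strong_limit small_image[OF assms, of g] unfolding small_def by blast
  then show ?thesis
    using small_inj_on[of "Pow (g ` X)" "image g" "Pow X"] g by (auto simp: inj_on_image_Pow)
qed

text \<open>Extensional functions are determined by their graphs, which are subsets of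
  \<open>Sigma X B\<close>.\<close>

lemma small_PiE:
  assumes X: "small \<kappa> X" and B: "\<And>x. x \<in> X \<Longrightarrow> small \<kappa> (B x)"
  shows "small \<kappa> (PiE X B)"
proof -
  have 1: "small \<kappa> (Pow (Sigma X B))" by (intro small_Pow small_Sigma X B)
  let ?gr = "\<lambda>f. (\<lambda>x. (x, f x)) ` X"
  have "inj_on ?gr (PiE X B)"
  proof (rule inj_onI)
    fix f g assume fg: "f \<in> PiE X B" "g \<in> PiE X B" "?gr f = ?gr g"
    show "f = g"
      by (rule PiE_ext[OF fg(1,2)]) (use fg(3) in auto)
  qed
  then show ?thesis by (rule small_inj_on[OF 1]) auto
qed

text \<open>The number of branches of a tree of small height in which every node has a small set of
  successors is small.\<close>

lemma small_paths:
  assumes F: "small \<kappa> F" and wf: "wf R" and R: "\<And>a b. (b, a) \<in> R \<Longrightarrow> b \<in> F"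
    and cong: "\<And>a f g. (\<And>b. (b, a) \<in> R \<Longrightarrow> f b = g b) \<Longrightarrow> Opt a f = Opt a g"
    and Opt: "\<And>a f. small \<kappa> (Opt a f)"
  shows "small \<kappa> {restrict f F | f. \<forall>a\<in>F. f a \<in> Opt a f}"
proof -
  let ?V = "{f. \<forall>a\<in>F. f a \<in> Opt a f}"
  \<comment> \<open>All values that branches take at \<open>a\<close>. They are small by induction
    on \<open>a\<close>: such a value lies in \<open>Opt a n\<close>, where \<open>n\<close> is the
    restriction of a branch to the predecessors of \<open>a\<close> and hence ranges over a small
    product of earlier value sets.\<close>
  let ?Val = "\<lambda>a. (\<lambda>f. f a) ` ?V"
  have Val: "a \<in> F \<longrightarrow> small \<kappa> (?Val a)" for a
    using wf
  proof (induction a rule: wf_induct_rule)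
    case (less a)
    let ?pre = "{b. (b, a) \<in> R}"
    show ?case
    proof
      assume a: "a \<in> F"
      have 1: "small \<kappa> (PiE ?pre ?Val)"
        using less.IH R by (intro small_PiE small_subset[OF F]) auto
      have "?Val a \<subseteq> (\<Union>n\<in>PiE ?pre ?Val. Opt a n)"
      proof
        fix y assume "y \<in> ?Val a"
        then obtain f where f: "f \<in> ?V" "y = f a" by blast
        have "restrict f ?pre \<in> PiE ?pre ?Val" using f by auto
        moreover have "y \<in> Opt a (restrict f ?pre)"
          using f a cong[of a "restrict f ?pre" f] by auto
        ultimately show "y \<in> (\<Union>n\<in>PiE ?pre ?Val. Opt a n)" by blast
      qed
      then show "small \<kappa> (?Val a)" by (rule small_subset[OF small_UN[OF 1 Opt]])
    qed
  qed
  have "small \<kappa> (PiE F ?Val)" using Val F by (intro small_PiE) auto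
  then show ?thesis by (rule small_subset) auto
qed

end

section \<open>Infinite regular cardinals\<close>

definition regular_cardinal :: "'v rel \<Rightarrow> bool" where
  "regular_cardinal \<mu> \<longleftrightarrow> Card_order \<mu> \<and> cinfinite \<mu> \<and> regularCard \<mu>"

lemma regular_cardinalD:
  assumes "regular_cardinal \<mu>"
  shows "Card_order \<mu>" "Well_order \<mu>" "\<not> finite (Field \<mu>)" "regularCard \<mu>" "Cinfinite \<mu>"
    "wf (\<mu> - Id)" "refl_on (Field \<mu>) \<mu>" "trans \<mu>" "antisym \<mu>" "total_on (Field \<mu>) \<mu>"
proof -
  show 1: "Card_order \<mu>" "\<not> finite (Field \<mu>)" "regularCard \<mu>" "Cinfinite \<mu>"
    using assms unfolding regular_cardinal_def cinfinite_def by auto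
  then show 2: "Well_order \<mu>" unfolding card_order_on_def by auto
  then show "wf (\<mu> - Id)" "refl_on (Field \<mu>) \<mu>" "trans \<mu>" "antisym \<mu>" "total_on (Field \<mu>) \<mu>"
    unfolding well_order_on_def linear_order_on_def partial_order_on_def preorder_on_def by auto
qed

text \<open>By regularity \<open>S\<close> is too small to be cofinal, so some element is strictly
  below no member of \<open>S\<close>; since the order is total, it is an upper bound.\<close>

lemma regular_cardinal_bounded:
  assumes \<mu>: "regular_cardinal \<mu>" and S: "S \<subseteq> Field \<mu>" "|S| <o \<mu>"
  shows "\<exists>u\<in>Field \<mu>. \<forall>s\<in>S. (s, u) \<in> \<mu>"
proof -
  note D = regular_cardinalD[OF \<mu>]
  have "\<not> cofinal S \<mu>"
    using D(4) S unfolding regularCard_def using not_ordLess_ordIso by blast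
  then obtain a where a: "a \<in> Field \<mu>" "\<And>b. b \<in> S \<Longrightarrow> \<not> (a \<noteq> b \<and> (a, b) \<in> \<mu>)"
    unfolding cofinal_def by blast
  have "(s, a) \<in> \<mu>" if "s \<in> S" for s
    using a(1) a(2)[OF that] subsetD[OF S(1) that] D(7,10)
    unfolding refl_on_def total_on_def by (cases "a = s") auto
  then show ?thesis using a(1) by blast
qed

lemma regular_cardinal_limit:
  assumes "regular_cardinal \<mu>" "a \<in> Field \<mu>"
  obtains b where "b \<in> Field \<mu>" "(a, b) \<in> \<mu> - Id"
  using infinite_Card_order_limit[OF regular_cardinalD(1,3)[OF assms(1)] assms(2)] by auto

text \<open>The successor of the cardinality of \<open>Field l \<union> S\<close> is regular, and it
  stays below \<open>\<kappa>\<close> because it is at most the cardinality of the power set. As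
  \<open>cardSuc\<close> yields a relation over sets of elements, it is carried back to
  \<open>'v\<close> along an injection.\<close>

lemma (in universe) regular_cardinal_above:
  fixes l :: "'v rel"
  assumes l: "small_regular_cardinal \<kappa> l" and S: "small \<kappa> (S :: 'v set)"
  obtains \<mu> :: "'v rel" where "regular_cardinal \<mu>" "\<mu> <o \<kappa>" "l \<le>o \<mu>" "|S| <o \<mu>"
proof -
  let ?S = "Field l \<union> S"
  have l': "Card_order l" "cinfinite l" "l <o \<kappa>" using l unfolding small_regular_cardinal_def by auto
  have "small \<kappa> (Field l)" unfolding small_def
    using card_of_Field_ordIso[OF l'(1)] l'(3) ordIso_ordLess_trans by blast
  then have sm: "small \<kappa> ?S" using S small_Un by blast
  have inf: "Cinfinite |?S|" using l'(2) unfolding cinfinite_def by (simp add: Field_card_of card_of_card_order_on)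
  let ?c = "cardSuc |?S|"
  have c: "?c <o \<kappa>"
    using cardSuc_least[OF card_of_Card_order card_of_Card_order card_of_Pow[of ?S]] strong_limit sm
    unfolding small_def using ordLeq_ordLess_trans by blast
  have "|Field ?c| <o \<kappa>"
    using c card_of_Field_ordIso[OF cardSuc_Card_order[OF card_of_Card_order]] ordIso_ordLess_trans
    by blast
  then obtain g :: "_ \<Rightarrow> 'v" where g: "inj_on g (Field ?c)"
    using small_embed unfolding small_def by blast
  let ?\<mu> = "|g ` Field ?c|"
  have "?\<mu> =o |Field ?c|"
    using g by (meson card_of_ordIsoI inj_on_imp_bij_betw ordIso_symmetric)
  also have "|Field ?c| =o ?c"
    using card_of_Field_ordIso[OF cardSuc_Card_order[OF card_of_Card_order]] .
  finally have iso: "?c =o ?\<mu>" by (rule ordIso_symmetric)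
  have "regularCard ?\<mu>"
    by (rule regularCard_ordIso[OF iso Cinfinite_cardSuc[OF inf] regularCard_cardSuc[OF inf]])
  moreover have "Cinfinite ?\<mu>" by (rule Cinfinite_cong[OF iso Cinfinite_cardSuc[OF inf]])
  ultimately have "regular_cardinal ?\<mu>" unfolding regular_cardinal_def by blast
  moreover have "?\<mu> <o \<kappa>" using c iso ordIso_ordLess_trans ordIso_symmetric by blast
  moreover have less: "|?S| <o ?\<mu>"
    using cardSuc_greater[OF card_of_Card_order] iso ordLess_ordIso_trans by blast
  moreover have "l \<le>o ?\<mu>"
  proof -
    have "l =o |Field l|" using card_of_Field_ordIso[OF l'(1)] ordIso_symmetric by blast
    also have "|Field l| \<le>o |?S|" by (rule card_of_mono1) auto
    finally show ?thesis using less ordLeq_ordLess_trans ordLess_imp_ordLeq by blast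
  qed
  moreover have "|S| <o ?\<mu>"
    using less card_of_mono1[of S ?S] ordLeq_ordLess_trans by blast
  ultimately show thesis using that by blast
qed

section \<open>Colimits\<close>

lemma categoryI:
  assumes "\<And>f. f \<in> Arr C \<Longrightarrow> Dom C f \<in> Obj C" "\<And>f. f \<in> Arr C \<Longrightarrow> Cod C f \<in> Obj C"
    and "\<And>X. X \<in> Obj C \<Longrightarrow> Ident C X \<in> hom C X X"
    and "\<And>f g. f \<in> Arr C \<Longrightarrow> g \<in> Arr C \<Longrightarrow> Dom C g = Cod C f \<Longrightarrow>
      g \<cdot>\<^bsub>C\<^esub> f \<in> hom C (Dom C f) (Cod C g)"
    and "\<And>f. f \<in> Arr C \<Longrightarrow> Ident C (Cod C f) \<cdot>\<^bsub>C\<^esub> f = f"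
    and "\<And>f. f \<in> Arr C \<Longrightarrow> f \<cdot>\<^bsub>C\<^esub> Ident C (Dom C f) = f"
    and "\<And>f g h. f \<in> Arr C \<Longrightarrow> g \<in> Arr C \<Longrightarrow> h \<in> Arr C \<Longrightarrow> Dom C g = Cod C f \<Longrightarrow>
      Dom C h = Cod C g \<Longrightarrow> (h \<cdot>\<^bsub>C\<^esub> g) \<cdot>\<^bsub>C\<^esub> f = h \<cdot>\<^bsub>C\<^esub> (g \<cdot>\<^bsub>C\<^esub> f)"
  shows "category C"
  using assms unfolding category_def by simp

lemma categoryD:
  assumes "category C"
  shows "f \<in> Arr C \<Longrightarrow> Dom C f \<in> Obj C" "f \<in> Arr C \<Longrightarrow> Cod C f \<in> Obj C"
    and "X \<in> Obj C \<Longrightarrow> Ident C X \<in> hom C X X"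
    and "f \<in> Arr C \<Longrightarrow> g \<in> Arr C \<Longrightarrow> Dom C g = Cod C f \<Longrightarrow>
      g \<cdot>\<^bsub>C\<^esub> f \<in> hom C (Dom C f) (Cod C g)"
    and "f \<in> Arr C \<Longrightarrow> Ident C (Cod C f) \<cdot>\<^bsub>C\<^esub> f = f"
    and "f \<in> Arr C \<Longrightarrow> f \<cdot>\<^bsub>C\<^esub> Ident C (Dom C f) = f"
    and "f \<in> Arr C \<Longrightarrow> g \<in> Arr C \<Longrightarrow> h \<in> Arr C \<Longrightarrow> Dom C g = Cod C f \<Longrightarrow>
      Dom C h = Cod C g \<Longrightarrow> (h \<cdot>\<^bsub>C\<^esub> g) \<cdot>\<^bsub>C\<^esub> f = h \<cdot>\<^bsub>C\<^esub> (g \<cdot>\<^bsub>C\<^esub> f)"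
  using assms unfolding category_def by simp_all

locale cat =
  fixes C :: "('o, 'a) cat" (structure)
  assumes category: "category C"
begin

abbreviation Hom :: "'o \<Rightarrow> 'o \<Rightarrow> 'a set" where "Hom \<equiv> hom C"

lemma Arr_Obj: "f \<in> Arr C \<Longrightarrow> Dom C f \<in> Obj C" "f \<in> Arr C \<Longrightarrow> Cod C f \<in> Obj C"
  using categoryD(1,2)[OF category] by simp_all

lemma homD: "f \<in> Hom X Y \<Longrightarrow> f \<in> Arr C" "f \<in> Hom X Y \<Longrightarrow> Dom C f = X" "f \<in> Hom X Y \<Longrightarrow> Cod C f = Y"
  "f \<in> Hom X Y \<Longrightarrow> X \<in> Obj C" "f \<in> Hom X Y \<Longrightarrow> Y \<in> Obj C"
  using Arr_Obj unfolding hom_def by auto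

lemma Arr_hom: "f \<in> Arr C \<Longrightarrow> f \<in> Hom (Dom C f) (Cod C f)"
  unfolding hom_def by simp

lemma Ident_hom [intro]: "X \<in> Obj C \<Longrightarrow> Ident C X \<in> Hom X X"
  using categoryD(3)[OF category] .

lemma comp_hom [intro]: "g \<in> Hom Y Z \<Longrightarrow> f \<in> Hom X Y \<Longrightarrow> g \<cdot> f \<in> Hom X Z"
  using categoryD(4)[OF category, of f g] homD(1-3)[of f X Y] homD(1-3)[of g Y Z] by simp

lemma comp_Ident: "f \<in> Hom X Y \<Longrightarrow> f \<cdot> Ident C X = f" "f \<in> Hom X Y \<Longrightarrow> Ident C Y \<cdot> f = f"
  using categoryD(5,6)[OF category, of f] homD(1-3)[of f X Y] by simp_all

lemma assoc: "h \<in> Hom Y Z \<Longrightarrow> g \<in> Hom X Y \<Longrightarrow> f \<in> Hom W X \<Longrightarrow> (h \<cdot> g) \<cdot> f = h \<cdot> g \<cdot> f"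
  using categoryD(7)[OF category, of f g h] homD(1-3)[of f W X] homD(1-3)[of g X Y] homD(1-3)[of h Y Z]
  by simp

end

lemma colimit_cocone: "is_colimit J C D L c \<Longrightarrow> is_cocone J C D L c"
  unfolding is_colimit_def by blast

text \<open>\<open>cocomplete\<close> quantifies only over index categories whose objects and arrows
  are elements of \<open>'v\<close>. An index category over other types is replaced by an isomorphic
  copy over \<open>'v\<close>, and cocones correspond under the renaming.\<close>

lemma (in universe) cocomplete_colimit:
  fixes J :: "('j, 'u) cat"
  assumes C: "cocomplete \<kappa> C" and J: "category J" "small \<kappa> (Obj J)" "small \<kappa> (Arr J)"
    and D: "is_functor J C D"
  shows "\<exists>L c. is_colimit J C D L c"
proof -
  obtain e :: "'j \<Rightarrow> 'v" where e: "inj_on e (Obj J)" using small_embed J(2) .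
  obtain a :: "'u \<Rightarrow> 'v" where a: "inj_on a (Arr J)" using small_embed J(3) .
  define e' where "e' = the_inv_into (Obj J) e"
  define a' where "a' = the_inv_into (Arr J) a"
  have e' [simp]: "e' (e x) = x" if "x \<in> Obj J" for x
    unfolding e'_def using the_inv_into_f_f[OF e that] .
  have a' [simp]: "a' (a x) = x" if "x \<in> Arr J" for x
    unfolding a'_def using the_inv_into_f_f[OF a that] .
  define J' where "J' = \<lparr>Obj = e ` Obj J, Arr = a ` Arr J, Dom = e \<circ> Dom J \<circ> a', Cod = e \<circ> Cod J \<circ> a',
    Ident = a \<circ> Ident J \<circ> e', Comp = (\<lambda>g f. a (a' g \<cdot>\<^bsub>J\<^esub> a' f))\<rparr>"
  define D' where "D' = \<lparr>OMap = OMap D \<circ> e', AMap = AMap D \<circ> a'\<rparr>"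
  note defs = J'_def D'_def
  interpret J: cat J by (unfold_locales) (rule J(1))
  have ob: "Dom J u \<in> Obj J" "Cod J u \<in> Obj J" if "u \<in> Arr J" for u using J.Arr_Obj[OF that] by auto
  have id: "Ident J x \<in> Arr J" "Dom J (Ident J x) = x" "Cod J (Ident J x) = x" if "x \<in> Obj J" for x
    using J.Ident_hom[OF that] unfolding hom_def by auto
  have cmp: "g \<cdot>\<^bsub>J\<^esub> f \<in> Arr J" "Dom J (g \<cdot>\<^bsub>J\<^esub> f) = Dom J f" "Cod J (g \<cdot>\<^bsub>J\<^esub> f) = Cod J g"
    if "f \<in> Arr J" "g \<in> Arr J" "Dom J g = Cod J f" for f g
    using J.comp_hom[OF J.Arr_hom[OF that(2)], of f "Dom J f"] J.Arr_hom[OF that(1)] that(3)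
    unfolding hom_def by simp_all
  have ee: "e x = e y \<longleftrightarrow> x = y" if "x \<in> Obj J" "y \<in> Obj J" for x y
    using e that by (auto dest: inj_onD)
  have "category J'"
  proof (rule categoryI)
    fix f g h assume "f \<in> Arr J'" "g \<in> Arr J'" "h \<in> Arr J'" "Dom J' g = Cod J' f" "Dom J' h = Cod J' g"
    then obtain f0 g0 h0 where "f = a f0" "g = a g0" "h = a h0" "f0 \<in> Arr J" "g0 \<in> Arr J" "h0 \<in> Arr J"
      "Dom J g0 = Cod J f0" "Dom J h0 = Cod J g0"
      unfolding defs by (auto simp: ob ee)
    then show "(h \<cdot>\<^bsub>J'\<^esub> g) \<cdot>\<^bsub>J'\<^esub> f = h \<cdot>\<^bsub>J'\<^esub> g \<cdot>\<^bsub>J'\<^esub> f"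
      by (simp add: defs cmp categoryD(7)[OF J(1)])
  qed (auto simp: defs hom_def ob id cmp ee categoryD(5,6)[OF J(1)])
  moreover have "is_functor J' C D'"
    using D unfolding is_functor_def defs
    by (auto simp: ob id cmp ee)
  moreover have "small \<kappa> (Obj J')" "small \<kappa> (Arr J')"
    unfolding defs using J small_image by auto
  ultimately obtain L c where c: "is_colimit J' C D' L c"
    using C unfolding cocomplete_def by blast
  have cocone: "is_cocone J' C D' M d \<longleftrightarrow> is_cocone J C D M (d \<circ> e)" for M d
    unfolding is_cocone_def defs by (auto simp: ob)
  have "is_colimit J C D L (c \<circ> e)"
    unfolding is_colimit_def
  proof (intro conjI allI impI)
    show "is_cocone J C D L (c \<circ> e)" using cocone colimit_cocone[OF c] by blast
    fix M d assume d: "is_cocone J C D M d"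
    then have "is_cocone J C D M ((d \<circ> e') \<circ> e)"
      unfolding is_cocone_def by (auto simp: ob)
    then have "is_cocone J' C D' M (d \<circ> e')" using cocone by blast
    then have "\<exists>!h. h \<in> hom C L M \<and> (\<forall>j\<in>Obj J'. h \<cdot>\<^bsub>C\<^esub> c j = (d \<circ> e') j)"
      using c unfolding is_colimit_def by blast
    moreover have "(\<forall>j\<in>Obj J'. h \<cdot>\<^bsub>C\<^esub> c j = (d \<circ> e') j) \<longleftrightarrow> (\<forall>j\<in>Obj J. h \<cdot>\<^bsub>C\<^esub> (c \<circ> e) j = d j)" for h
      unfolding defs by auto
    ultimately show "\<exists>!h. h \<in> hom C L M \<and> (\<forall>j\<in>Obj J. h \<cdot>\<^bsub>C\<^esub> (c \<circ> e) j = d j)" by simp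
  qed
  then show ?thesis by blast
qed

text \<open>Colimits given by generators and relations: \<open>(j, a, k, b) \<in> R\<close> stands for the equation
  \<open>c j \<cdot> a = c k \<cdot> b\<close> between the coprojections.\<close>

definition rel_data ::
  "('o, 'a) cat \<Rightarrow> 'n set \<Rightarrow> ('n \<Rightarrow> 'o) \<Rightarrow> ('n \<times> 'a \<times> 'n \<times> 'a) set \<Rightarrow> bool" where
  "rel_data C N X R \<longleftrightarrow> (\<forall>j\<in>N. X j \<in> Obj C) \<and>
     (\<forall>(j, a, k, b) \<in> R. j \<in> N \<and> k \<in> N \<and> (\<exists>W. a \<in> hom C W (X j) \<and> b \<in> hom C W (X k)))"

definition rel_cocone :: "('o, 'a) cat \<Rightarrow> 'n set \<Rightarrow> ('n \<Rightarrow> 'o) \<Rightarrow> ('n \<times> 'a \<times> 'n \<times> 'a) set \<Rightarrow>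
    'o \<Rightarrow> ('n \<Rightarrow> 'a) \<Rightarrow> bool" where
  "rel_cocone C N X R P c \<longleftrightarrow> P \<in> Obj C \<and> (\<forall>j\<in>N. c j \<in> hom C (X j) P) \<and>
     (\<forall>(j, a, k, b) \<in> R. c j \<cdot>\<^bsub>C\<^esub> a = c k \<cdot>\<^bsub>C\<^esub> b)"

definition rel_colimit :: "('o, 'a) cat \<Rightarrow> 'n set \<Rightarrow> ('n \<Rightarrow> 'o) \<Rightarrow> ('n \<times> 'a \<times> 'n \<times> 'a) set \<Rightarrow>
    'o \<Rightarrow> ('n \<Rightarrow> 'a) \<Rightarrow> bool" where
  "rel_colimit C N X R P c \<longleftrightarrow> rel_cocone C N X R P c \<and>
     (\<forall>M d. rel_cocone C N X R M d \<longrightarrow> (\<exists>!h. h \<in> hom C P M \<and> (\<forall>j\<in>N. h \<cdot>\<^bsub>C\<^esub> c j = d j)))"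

lemma rel_dataI:
  assumes "\<And>j. j \<in> N \<Longrightarrow> X j \<in> Obj C"
    and "\<And>j a k b. (j, a, k, b) \<in> R \<Longrightarrow>
      j \<in> N \<and> k \<in> N \<and> (\<exists>W. a \<in> hom C W (X j) \<and> b \<in> hom C W (X k))"
  shows "rel_data C N X R"
  unfolding rel_data_def using assms by clarsimp

lemma rel_coconeI:
  assumes "P \<in> Obj C" "\<And>j. j \<in> N \<Longrightarrow> c j \<in> hom C (X j) P"
    and "\<And>j a k b. (j, a, k, b) \<in> R \<Longrightarrow> c j \<cdot>\<^bsub>C\<^esub> a = c k \<cdot>\<^bsub>C\<^esub> b"
  shows "rel_cocone C N X R P c"
  unfolding rel_cocone_def using assms by clarsimp

lemma rel_coconeD:
  assumes "rel_cocone C N X R P c"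
  shows "P \<in> Obj C" "j \<in> N \<Longrightarrow> c j \<in> hom C (X j) P"
    "(j, a, k, b) \<in> R \<Longrightarrow> c j \<cdot>\<^bsub>C\<^esub> a = c k \<cdot>\<^bsub>C\<^esub> b"
  using assms unfolding rel_cocone_def by auto

lemma rel_colimitD:
  assumes "rel_colimit C N X R P c"
  shows "rel_cocone C N X R P c"
    "rel_cocone C N X R M d \<Longrightarrow> \<exists>h \<in> hom C P M. \<forall>j\<in>N. h \<cdot>\<^bsub>C\<^esub> c j = d j"
proof -
  show "rel_cocone C N X R P c" using assms unfolding rel_colimit_def by (rule conjunct1)
  assume "rel_cocone C N X R M d"
  then have "\<exists>!h. h \<in> hom C P M \<and> (\<forall>j\<in>N. h \<cdot>\<^bsub>C\<^esub> c j = d j)"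
    using assms unfolding rel_colimit_def by simp
  then show "\<exists>h \<in> hom C P M. \<forall>j\<in>N. h \<cdot>\<^bsub>C\<^esub> c j = d j" by (elim ex1E conjE) (rule bexI)
qed

lemma (in cat) rel_colimit_unique:
  assumes c: "rel_colimit C N X R P c" and h: "h \<in> Hom P M" "h' \<in> Hom P M"
    and R: "rel_data C N X R" and eq: "\<And>j. j \<in> N \<Longrightarrow> h \<cdot> c j = h' \<cdot> c j"
  shows "h = h'"
proof -
  note D = rel_coconeD[OF rel_colimitD(1)[OF c]]
  have "rel_cocone C N X R M (\<lambda>j. h \<cdot> c j)"
  proof (rule rel_coconeI)
    show "M \<in> Obj C" by (rule homD(5)[OF h(1)])
    show "h \<cdot> c j \<in> Hom (X j) M" if "j \<in> N" for j using comp_hom[OF h(1) D(2)[OF that]] .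
    fix j a k b assume r: "(j, a, k, b) \<in> R"
    then obtain W where W: "j \<in> N" "k \<in> N" "a \<in> Hom W (X j)" "b \<in> Hom W (X k)"
      using R unfolding rel_data_def by blast
    show "(h \<cdot> c j) \<cdot> a = (h \<cdot> c k) \<cdot> b"
      using assoc[OF h(1) D(2)[OF W(1)] W(3)] assoc[OF h(1) D(2)[OF W(2)] W(4)] D(3)[OF r] by simp
  qed
  then have "\<exists>!g. g \<in> Hom P M \<and> (\<forall>j\<in>N. g \<cdot> c j = h \<cdot> c j)"
    using c unfolding rel_colimit_def by blast
  then show ?thesis using h eq by metis
qed

text \<open>The index category has an object for every generator and every relation, and two non-identity
  maps, from the relation to the two generators it involves, for every relation.\<close>

lemma (in universe) rel_colimit_ex:
  fixes C :: "('o, 'a) cat" (structure) and N :: "'n set"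
  assumes C: "category C" "cocomplete \<kappa> C" and N: "small \<kappa> N" and R: "small \<kappa> R"
    and data: "rel_data C N X R"
  shows "\<exists>P c. rel_colimit C N X R P c"
proof -
  interpret cat C using C(1) by unfold_locales
  let ?O = "N <+> R"
  \<comment> \<open>All non-identity maps lead from a relation \<open>Inr r\<close> to a generator
    \<open>Inl j\<close>, so of two composable maps at least one is an identity and
    \<open>Comp\<close> just returns the other. The boolean selects the first or the second side of
    the relation. The diagram puts the common domain of the two sides at a relation.\<close>
  define J :: "('n + 'n \<times> 'a \<times> 'n \<times> 'a, ('n + 'n \<times> 'a \<times> 'n \<times> 'a) + ('n \<times> 'a \<times> 'n \<times> 'a) \<times> bool) cat"
    where "J = \<lparr>Obj = ?O, Arr = ?O <+> R \<times> UNIV, Dom = case_sum id (\<lambda>(r, t). Inr r),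
      Cod = case_sum id (\<lambda>((j, a, k, b), t). Inl (if t then j else k)), Ident = Inl,
      Comp = (\<lambda>g f. case f of Inl _ \<Rightarrow> g | Inr _ \<Rightarrow> f)\<rparr>"
  define DO :: "'n + 'n \<times> 'a \<times> 'n \<times> 'a \<Rightarrow> 'o"
    where "DO = case_sum X (\<lambda>(j, a, k, b). Dom C a)"
  define D :: "('n + 'n \<times> 'a \<times> 'n \<times> 'a, ('n + 'n \<times> 'a \<times> 'n \<times> 'a) + ('n \<times> 'a \<times> 'n \<times> 'a) \<times> bool,
      'o, 'a) cfunctor" where "D = \<lparr>OMap = DO,
    AMap = case_sum (\<lambda>x. Ident C (DO x)) (\<lambda>((j, a, k, b), t). if t then a else b)\<rparr>"
  have X: "X j \<in> Obj C" if "j \<in> N" for j using data that unfolding rel_data_def by blast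
  have rel: "j \<in> N" "k \<in> N" "a \<in> Hom (Dom C a) (X j)" "b \<in> Hom (Dom C a) (X k)"
    if "(j, a, k, b) \<in> R" for j a k b
    using data that homD(2) unfolding rel_data_def by fastforce+
  have J: "category J"
  proof (rule categoryI)
    show "Dom J f \<in> Obj J" "Cod J f \<in> Obj J" if "f \<in> Arr J" for f
      using that rel(1,2) unfolding J_def by fastforce+
    show "(h \<cdot>\<^bsub>J\<^esub> g) \<cdot>\<^bsub>J\<^esub> f = h \<cdot>\<^bsub>J\<^esub> g \<cdot>\<^bsub>J\<^esub> f" for f g h
      unfolding J_def by (cases f; cases g) auto
    show "g \<cdot>\<^bsub>J\<^esub> f \<in> hom J (Dom J f) (Cod J g)"
      if "f \<in> Arr J" "g \<in> Arr J" "Dom J g = Cod J f" for f g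
      using that unfolding J_def hom_def by (cases f; cases g) auto
    show "Ident J (Cod J f) \<cdot>\<^bsub>J\<^esub> f = f" "f \<cdot>\<^bsub>J\<^esub> Ident J (Dom J f) = f" for f
      unfolding J_def by (cases f; auto)+
  qed (auto simp: J_def hom_def)
  have DO: "DO x \<in> Obj C" if "x \<in> Obj J" for x
    using that X rel(3) homD(4) unfolding DO_def J_def by fastforce
  have DA: "AMap D u \<in> Hom (DO (Dom J u)) (DO (Cod J u))" if "u \<in> Arr J" for u
  proof (cases u)
    case (Inl x)
    then show ?thesis using that Ident_hom[OF DO[of x]] unfolding J_def D_def by auto
  next
    case (Inr x)
    then show ?thesis using that rel(3,4) unfolding J_def D_def DO_def by auto
  qed
  have "is_functor J C D"
    unfolding is_functor_def
  proof (intro conjI ballI impI)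
    show "OMap D x \<in> Obj C" if "x \<in> Obj J" for x using DO[OF that] unfolding D_def by simp
    show "AMap D u \<in> Hom (OMap D (Dom J u)) (OMap D (Cod J u))" if "u \<in> Arr J" for u
      using DA[OF that] unfolding D_def by simp
    show "AMap D (Ident J x) = Ident C (OMap D x)" for x unfolding D_def J_def by simp
    fix f g assume fg: "f \<in> Arr J" "g \<in> Arr J" "Dom J g = Cod J f"
    show "AMap D (g \<cdot>\<^bsub>J\<^esub> f) = AMap D g \<cdot> AMap D f"
    proof (cases f)
      case (Inl x)
      then have "AMap D f = Ident C (DO (Dom J g))" using fg unfolding D_def J_def by simp
      then show ?thesis using comp_Ident(1)[OF DA[OF fg(2)]] Inl unfolding J_def by simp
    next
      case (Inr x)
      then have "g = Inl (Cod J f)" using fg unfolding J_def by auto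
      then have "AMap D g = Ident C (DO (Cod J f))" unfolding D_def by simp
      then show ?thesis using comp_Ident(2)[OF DA[OF fg(1)]] Inr unfolding J_def by simp
    qed
  qed
  moreover have "small \<kappa> (Obj J)" "small \<kappa> (Arr J)"
    unfolding J_def by (auto intro!: small_Plus small_Sigma N R simp: small_finite)
  ultimately obtain P c where c: "is_colimit J C D P c" using cocomplete_colimit C(2) J by blast
  \<comment> \<open>The leg at a relation is forced by compatibility with its first side.
    Compatibility with the second side is then precisely the relation.\<close>
  define ext :: "('n \<Rightarrow> 'a) \<Rightarrow> 'n + 'n \<times> 'a \<times> 'n \<times> 'a \<Rightarrow> 'a"
    where "ext d = case_sum d (\<lambda>(j, a, k, b). d j \<cdot> a)" for d
  have ext: "is_cocone J C D M (ext d)" if d: "rel_cocone C N X R M d" for M d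
    unfolding is_cocone_def
  proof (intro conjI ballI)
    note d = rel_coconeD[OF d]
    show "M \<in> Obj C" by (rule d)
    show e: "ext d x \<in> Hom (OMap D x) M" if "x \<in> Obj J" for x
      using that d(2) comp_hom[OF d(2)[OF rel(1)] rel(3)] unfolding J_def D_def ext_def DO_def by auto
    fix u assume u: "u \<in> Arr J"
    show "ext d (Cod J u) \<cdot> AMap D u = ext d (Dom J u)"
    proof (cases u)
      case (Inl x)
      then have "AMap D u = Ident C (OMap D x)" "Cod J u = x" "Dom J u = x" "x \<in> Obj J"
        using u unfolding D_def J_def by auto
      then show ?thesis using comp_Ident(1)[OF e] by simp
    next
      case (Inr x)
      obtain j a k b t where "x = ((j, a, k, b), t)" by (metis surj_pair)
      then show ?thesis using u Inr d(3)[of j a k b] unfolding J_def D_def ext_def by auto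
    qed
  qed
  have res: "rel_cocone C N X R M (d \<circ> Inl)" "\<And>x. x \<in> Obj J \<Longrightarrow> ext (d \<circ> Inl) x = d x"
    if d: "is_cocone J C D M d" for M d
  proof -
    have d': "M \<in> Obj C" "\<And>x. x \<in> Obj J \<Longrightarrow> d x \<in> Hom (OMap D x) M"
      "\<And>u. u \<in> Arr J \<Longrightarrow> d (Cod J u) \<cdot> AMap D u = d (Dom J u)"
      using d unfolding is_cocone_def by auto
    have r: "d (Inl j) \<cdot> a = d (Inr (j, a, k, b))" "d (Inl k) \<cdot> b = d (Inr (j, a, k, b))"
      if "(j, a, k, b) \<in> R" for j a k b
      using d'(3)[of "Inr ((j, a, k, b), True)"] d'(3)[of "Inr ((j, a, k, b), False)"] that
      unfolding J_def D_def by auto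
    show "rel_cocone C N X R M (d \<circ> Inl)"
    proof (rule rel_coconeI)
      show "(d \<circ> Inl) j \<in> Hom (X j) M" if "j \<in> N" for j
        using d'(2)[of "Inl j"] that unfolding J_def D_def DO_def by auto
    qed (use d' r in auto)
    show "ext (d \<circ> Inl) x = d x" if "x \<in> Obj J" for x
      using that r unfolding ext_def J_def by auto
  qed
  have "rel_colimit C N X R P (c \<circ> Inl)"
    unfolding rel_colimit_def
  proof (intro conjI allI impI)
    note cc = colimit_cocone[OF c]
    show rc: "rel_cocone C N X R P (c \<circ> Inl)" using res cc by blast
    fix M d assume d: "rel_cocone C N X R M d"
    have 1: "\<exists>!h. h \<in> Hom P M \<and> (\<forall>j\<in>Obj J. h \<cdot> c j = ext d j)"
      using c ext[OF d] unfolding is_colimit_def by blast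
    \<comment> \<open>The objects coming from relations impose no further condition on
      \<open>h\<close>, because the legs there arise from those at generators by composition with
      \<open>a\<close>.\<close>
    have 2: "(\<forall>j\<in>Obj J. h \<cdot> c j = ext d j) \<longleftrightarrow> (\<forall>j\<in>N. h \<cdot> (c \<circ> Inl) j = d j)" if h: "h \<in> Hom P M" for h
    proof
      assume "\<forall>j\<in>Obj J. h \<cdot> c j = ext d j"
      then show "\<forall>j\<in>N. h \<cdot> (c \<circ> Inl) j = d j" unfolding J_def ext_def by (auto dest!: bspec[OF _ InlI])
    next
      assume *: "\<forall>j\<in>N. h \<cdot> (c \<circ> Inl) j = d j"
      show "\<forall>j\<in>Obj J. h \<cdot> c j = ext d j"
      proof
        fix x assume x: "x \<in> Obj J"
        show "h \<cdot> c x = ext d x"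
        proof (cases x)
          case (Inl j) then show ?thesis using * x unfolding ext_def J_def by auto
        next
          case (Inr r)
          obtain j a k b where r: "r = (j, a, k, b)" by (metis surj_pair)
          then have R: "(j, a, k, b) \<in> R" using x Inr unfolding J_def by auto
          have "c x = c (Inl j) \<cdot> a" using res(2)[OF cc x] Inr r unfolding ext_def by simp
          moreover have "(h \<cdot> c (Inl j)) \<cdot> a = h \<cdot> c (Inl j) \<cdot> a"
            by (rule assoc[OF h _ rel(3)[OF R]]) (use rel_coconeD(2)[OF rc rel(1)[OF R]] in simp)
          ultimately show ?thesis using * rel(1)[OF R] Inr r unfolding ext_def by auto
        qed
      qed
    qed
    show "\<exists>!h. h \<in> Hom P M \<and> (\<forall>j\<in>N. h \<cdot> (c \<circ> Inl) j = d j)"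
      using 1 2 by metis
  qed
  then show ?thesis by blast
qed

section \<open>Presentable objects\<close>

lemma (in cat) colimit_unique:
  assumes c: "is_colimit J C D L c" and J: "category J" and D: "is_functor J C D"
    and h: "h \<in> Hom L M" "h' \<in> Hom L M"
    and eq: "\<And>j. j \<in> Obj J \<Longrightarrow> h \<cdot> c j = h' \<cdot> c j"
  shows "h = h'"
proof -
  have cc: "\<And>j. j \<in> Obj J \<Longrightarrow> c j \<in> Hom (OMap D j) L"
      "\<And>u. u \<in> Arr J \<Longrightarrow> c (Cod J u) \<cdot> AMap D u = c (Dom J u)"
    using colimit_cocone[OF c] unfolding is_cocone_def by simp_all
  have "is_cocone J C D M (\<lambda>j. h \<cdot> c j)"
    unfolding is_cocone_def
  proof (intro conjI ballI)
    show "M \<in> Obj C" by (rule homD(5)[OF h(1)])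
    show "h \<cdot> c j \<in> Hom (OMap D j) M" if "j \<in> Obj J" for j
      by (rule comp_hom[OF h(1) cc(1)[OF that]])
    fix u assume u: "u \<in> Arr J"
    then have "AMap D u \<in> Hom (OMap D (Dom J u)) (OMap D (Cod J u))"
      using D unfolding is_functor_def by simp
    from assoc[OF h(1) cc(1) this] show "(h \<cdot> c (Cod J u)) \<cdot> AMap D u = h \<cdot> c (Dom J u)"
      using cc(2)[OF u] categoryD(2)[OF J u] by simp
  qed
  then have "\<exists>!g. g \<in> Hom L M \<and> (\<forall>j\<in>Obj J. g \<cdot> c j = h \<cdot> c j)"
    using c unfolding is_colimit_def by simp
  then show ?thesis using h eq by metis
qed

locale poset_diagram = cat +
  fixes P :: "'v set" and r :: "'v rel" and D :: "('v, 'v \<times> 'v, 'a, 'b) cfunctor"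
  assumes po: "partial_order_on P r" and D_functor: "is_functor (poset_cat P r) C D"
begin

lemma r_props: "(p, q) \<in> r \<Longrightarrow> p \<in> P" "(p, q) \<in> r \<Longrightarrow> q \<in> P" "p \<in> P \<Longrightarrow> (p, p) \<in> r"
    "(p, q) \<in> r \<Longrightarrow> (q, s) \<in> r \<Longrightarrow> (p, s) \<in> r"
  using po unfolding partial_order_on_def preorder_on_def refl_on_def trans_def by blast+

lemma category_poset: "category (poset_cat P r)"
  by (rule categoryI) (auto simp: poset_cat_def hom_def r_props intro: r_props)

lemma D_Obj: "p \<in> P \<Longrightarrow> OMap D p \<in> Obj C"
  using D_functor unfolding is_functor_def poset_cat_def by simp

lemma D_hom: "(p, q) \<in> r \<Longrightarrow> AMap D (p, q) \<in> Hom (OMap D p) (OMap D q)"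
  using D_functor unfolding is_functor_def poset_cat_def by fastforce

lemma D_comp: "(p, q) \<in> r \<Longrightarrow> (q, s) \<in> r \<Longrightarrow> AMap D (q, s) \<cdot> AMap D (p, q) = AMap D (p, s)"
proof -
  assume *: "(p, q) \<in> r" "(q, s) \<in> r"
  have "\<forall>f\<in>r. \<forall>g\<in>r. fst g = snd f \<longrightarrow> AMap D (fst f, snd g) = AMap D g \<cdot> AMap D f"
    using D_functor unfolding is_functor_def poset_cat_def by simp
  from this[rule_format, OF *] show ?thesis by simp
qed

lemma cocone_iff: "is_cocone (poset_cat P r) C D L c \<longleftrightarrow> L \<in> Obj C \<and>
   (\<forall>p\<in>P. c p \<in> Hom (OMap D p) L) \<and> (\<forall>p q. (p, q) \<in> r \<longrightarrow> c q \<cdot> AMap D (p, q) = c p)"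
  unfolding is_cocone_def poset_cat_def by auto

lemma colimitD:
  assumes "is_colimit (poset_cat P r) C D L c"
  shows "L \<in> Obj C" "p \<in> P \<Longrightarrow> c p \<in> Hom (OMap D p) L" "(p, q) \<in> r \<Longrightarrow> c q \<cdot> AMap D (p, q) = c p"
  using colimit_cocone[OF assms] unfolding cocone_iff by auto

end

text \<open>Maps of \<open>set_cat \<kappa>\<close> to a fixed two-element set, seen as predicates. Testing the colimit of
  hom-sets against them yields both halves of its explicit description.\<close>

definition two :: "('a + 'v) set" where "two = {Inl undefined, Inr undefined}"

definition pred_arrow ::
  "'a set \<Rightarrow> ('a \<Rightarrow> bool) \<Rightarrow> ('a + 'v) set \<times> ('a + 'v) set \<times> ('a + 'v \<Rightarrow> 'a + 'v)" where
  "pred_arrow S h = (Inl ` S, two,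
     \<lambda>z \<in> Inl ` S. if h (projl z) then Inl undefined else Inr undefined)"

lemma pred_arrow_eq:
  "(pred_arrow S h :: ('a + 'v) set \<times> _) = pred_arrow S h' \<longleftrightarrow> (\<forall>x\<in>S. h x = h' x)"
proof
  assume "pred_arrow S h = (pred_arrow S h' :: ('a + 'v) set \<times> _)"
  then have "(\<lambda>z :: 'a + 'v \<in> Inl ` S. if h (projl z) then Inl undefined else Inr undefined) =
    (\<lambda>z \<in> Inl ` S. if h' (projl z) then Inl undefined else (Inr undefined :: 'a + 'v))" (is "?f = ?g")
    unfolding pred_arrow_def by simp
  then have fg: "?f (Inl x) = ?g (Inl x)" for x by metis
  show "\<forall>x\<in>S. h x = h' x"
  proof
    fix x assume "x \<in> S"
    then show "h x = h' x" using fg[of x] by (simp add: imageI split: if_splits)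
  qed
next
  assume "\<forall>x\<in>S. h x = h' x"
  then show "pred_arrow S h = (pred_arrow S h' :: ('a + 'v) set \<times> _)"
    unfolding pred_arrow_def by (auto simp: restrict_def fun_eq_iff)
qed

context universe begin

lemma pred_arrow_hom:
  assumes "small \<kappa> S"
  shows "pred_arrow S h \<in> hom (set_cat \<kappa>) (Inl ` S) (two :: ('a + 'v) set)"
  using small_image[OF assms] small_finite[of "two :: ('a + 'v) set"]
  unfolding hom_def set_cat_def pred_arrow_def by (auto simp: two_def)

lemma pred_arrow_surj:
  assumes g: "g \<in> hom (set_cat \<kappa>) (Inl ` S) (two :: ('a + 'v) set)"
  shows "\<exists>h. g = pred_arrow S h"
proof -
  obtain f where f: "g = (Inl ` S, two, f)" "f \<in> Inl ` S \<rightarrow>\<^sub>E two"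
    using g unfolding hom_def set_cat_def by auto
  have "f = (\<lambda>z \<in> Inl ` S. if f (Inl (projl z)) = Inl undefined then Inl undefined else Inr undefined)"
  proof
    fix z show "f z = (\<lambda>z \<in> Inl ` S.
        if f (Inl (projl z)) = Inl undefined then Inl undefined else Inr undefined) z"
      using PiE_mem[OF f(2), of z] PiE_arb[OF f(2), of z] unfolding two_def by auto
  qed
  then have "g = pred_arrow S (\<lambda>x. f (Inl x) = Inl undefined)"
    unfolding f(1) pred_arrow_def by simp
  then show ?thesis by blast
qed

lemma pred_arrow_comp:
  fixes C :: "('o, 'a) cat" (structure)
  assumes C: "category C" and f: "f \<in> hom C Y L"
  shows "pred_arrow (hom C X L) h \<cdot>\<^bsub>set_cat \<kappa>\<^esub> AMap (hom_functor C X) f =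
    (pred_arrow (hom C X Y) (\<lambda>x. h (f \<cdot>\<^bsub>C\<^esub> x)) :: ('a + 'v) set \<times> _)"
proof -
  interpret cat C using C by unfold_locales
  show ?thesis
    using comp_hom[OF f, of _ X] homD(2,3)[OF f]
    unfolding set_cat_def hom_functor_def pred_arrow_def
    by (auto simp: fun_eq_iff compose_def)
qed

text \<open>A compatible family of predicates on the sets Hom(X, D p) is a cocone from the diagram
  of hom-sets to a two-element set. Presentability makes Hom(X, L) a colimit of this diagram, so the
  family descends to a predicate on Hom(X, L), and to only one.\<close>

lemma presentable_predicates:
  fixes C :: "('o, 'a) cat" (structure) and d :: "'v \<Rightarrow> 'a \<Rightarrow> bool"
  assumes C: "category C" "locally_small \<kappa> C" and X: "presentable_object \<kappa> l C X"
    and P: "directed_poset \<kappa> l P r" and D: "is_functor (poset_cat P r) C D"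
    and c: "is_colimit (poset_cat P r) C D L c"
    and d: "\<And>p q x. (p, q) \<in> r \<Longrightarrow> x \<in> hom C X (OMap D p) \<Longrightarrow> d q (AMap D (p, q) \<cdot>\<^bsub>C\<^esub> x) = d p x"
  obtains h where "\<And>p x. p \<in> P \<Longrightarrow> x \<in> hom C X (OMap D p) \<Longrightarrow> h (c p \<cdot>\<^bsub>C\<^esub> x) = d p x"
    "\<And>h'. (\<And>p x. p \<in> P \<Longrightarrow> x \<in> hom C X (OMap D p) \<Longrightarrow> h' (c p \<cdot>\<^bsub>C\<^esub> x) = d p x) \<Longrightarrow>
      (\<forall>x\<in>hom C X L. h' x = h x)"
proof -
  interpret poset_diagram C P r D
    using C P D unfolding directed_poset_def by unfold_locales auto
  let ?H = "hom_functor C X :: (_, _, ('a + 'v) set, _) cfunctor"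
  let ?d = "\<lambda>p. pred_arrow (Hom X (OMap D p)) (d p) :: ('a + 'v) set \<times> _"
  have col: "is_colimit (poset_cat P r) (set_cat \<kappa>) (comp_functor ?H D) (OMap ?H L) (AMap ?H \<circ> c)"
    and XO: "X \<in> Obj C"
    using X P D c unfolding presentable_object_def Let_def by simp_all
  have sm: "small \<kappa> (Hom X Y)" if "Y \<in> Obj C" for Y using C(2) XO that unfolding locally_small_def by simp
  have two: "two \<in> Obj (set_cat \<kappa> :: (('a + 'v) set, _) cat)"
    unfolding set_cat_def by (simp add: two_def small_finite)
  have "is_cocone (poset_cat P r) (set_cat \<kappa>) (comp_functor ?H D) two ?d"
    unfolding is_cocone_def
  proof (intro conjI ballI two)
    show "?d p \<in> hom (set_cat \<kappa>) (OMap (comp_functor ?H D) p) two" if "p \<in> Obj (poset_cat P r)" for p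
      using pred_arrow_hom[OF sm[OF D_Obj]] that unfolding comp_functor_def poset_cat_def
      by (simp add: hom_functor_def)
    fix u assume u: "u \<in> Arr (poset_cat P r)"
    obtain p q where pq: "u = (p, q)" "(p, q) \<in> r" using u unfolding poset_cat_def by (cases u) simp
    have "?d q \<cdot>\<^bsub>set_cat \<kappa>\<^esub> AMap ?H (AMap D (p, q)) =
        pred_arrow (Hom X (OMap D p)) (\<lambda>x. d q (AMap D (p, q) \<cdot> x))"
      by (rule pred_arrow_comp[OF C(1) D_hom[OF pq(2)]])
    also have "\<dots> = ?d p" unfolding pred_arrow_eq using d[OF pq(2)] by simp
    finally show "?d (Cod (poset_cat P r) u) \<cdot>\<^bsub>set_cat \<kappa>\<^esub> AMap (comp_functor ?H D) u =
        ?d (Dom (poset_cat P r) u)"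
      unfolding comp_functor_def pq(1) poset_cat_def by simp
  qed
  then have ex1: "\<exists>!h. h \<in> hom (set_cat \<kappa>) (OMap ?H L) two \<and>
      (\<forall>p\<in>Obj (poset_cat P r). h \<cdot>\<^bsub>set_cat \<kappa>\<^esub> (AMap ?H \<circ> c) p = ?d p)"
    using col unfolding is_colimit_def by blast
  have HL: "OMap ?H L = Inl ` Hom X L" unfolding hom_functor_def by simp
  have cmp: "pred_arrow (Hom X L) h \<cdot>\<^bsub>set_cat \<kappa>\<^esub> AMap ?H (c p) =
      (pred_arrow (Hom X (OMap D p)) (\<lambda>x. h (c p \<cdot> x)) :: ('a + 'v) set \<times> _)" if "p \<in> P" for p h
    by (rule pred_arrow_comp[OF C(1) colimitD(2)[OF c that]])
  have iff: "(\<forall>p\<in>Obj (poset_cat P r). pred_arrow (Hom X L) h \<cdot>\<^bsub>set_cat \<kappa>\<^esub> (AMap ?H \<circ> c) p = ?d p) \<longleftrightarrow>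
      (\<forall>p\<in>P. \<forall>x\<in>Hom X (OMap D p). h (c p \<cdot> x) = d p x)" for h
    by (simp add: poset_cat_def cmp pred_arrow_eq)
  obtain a where a: "a \<in> hom (set_cat \<kappa>) (Inl ` Hom X L) two"
    "\<forall>p\<in>Obj (poset_cat P r). a \<cdot>\<^bsub>set_cat \<kappa>\<^esub> (AMap ?H \<circ> c) p = ?d p"
    using ex1_implies_ex[OF ex1] unfolding HL by blast
  obtain h where "a = pred_arrow (Hom X L) h" using pred_arrow_surj[OF a(1)] by blast
  then have h: "\<forall>p\<in>P. \<forall>x\<in>Hom X (OMap D p). h (c p \<cdot> x) = d p x" using a(2) iff by blast
  moreover have "\<forall>x\<in>Hom X L. h' x = h x"
    if h': "\<And>p x. p \<in> P \<Longrightarrow> x \<in> Hom X (OMap D p) \<Longrightarrow> h' (c p \<cdot> x) = d p x" for h'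
  proof -
    let ?a = "\<lambda>h. pred_arrow (Hom X L) h :: ('a + 'v) set \<times> _"
    note hom = pred_arrow_hom[OF sm[OF colimitD(1)[OF c]]]
    have "\<forall>p\<in>P. \<forall>x\<in>Hom X (OMap D p). h' (c p \<cdot> x) = d p x" using h' by simp
    then have "?a h' = ?a h"
      using iff[THEN iffD2, OF h] iff[of h', THEN iffD2] hom
      by (intro trans[OF the1_equality[OF ex1, symmetric] the1_equality[OF ex1]] conjI)
        (simp_all add: HL)
    then show ?thesis unfolding pred_arrow_eq .
  qed
  ultimately show thesis using that[of h] by simp
qed

text \<open>Both the constant predicate \<open>True\<close> and the predicate "factors through some
  \<open>c p\<close>" restrict to \<open>True\<close> on every stage. By uniqueness they agree on
  Hom(X, L).\<close>

lemma presentable_factor: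
  assumes C: "category C" "locally_small \<kappa> C" and X: "presentable_object \<kappa> l C X"
    and P: "directed_poset \<kappa> l P r" and D: "is_functor (poset_cat P r) C D"
    and c: "is_colimit (poset_cat P r) C D L c"
    and g: "g \<in> hom C X L"
  shows "\<exists>p\<in>P. \<exists>x\<in>hom C X (OMap D p). c p \<cdot>\<^bsub>C\<^esub> x = g"
proof -
  let ?im = "\<lambda>g. \<exists>p\<in>P. \<exists>x\<in>hom C X (OMap D p). c p \<cdot>\<^bsub>C\<^esub> x = g"
  obtain h where h: "\<And>h'. (\<And>p x. p \<in> P \<Longrightarrow> x \<in> hom C X (OMap D p) \<Longrightarrow> h' (c p \<cdot>\<^bsub>C\<^esub> x) = True) \<Longrightarrow>
      (\<forall>x\<in>hom C X L. h' x = h x)"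
    by (rule presentable_predicates[OF C X P D c, of "\<lambda>p x. True"]) auto
  have "\<forall>x\<in>hom C X L. True = h x" by (rule h) simp
  moreover have "\<forall>x\<in>hom C X L. ?im x = h x" by (rule h) auto
  ultimately show ?thesis using g by blast
qed

text \<open>The predicate "\<open>z\<close> becomes equal to \<open>x\<close> at some later stage"
  is compatible with the transition maps, by directedness, so its value at \<open>y\<close> depends
  only on \<open>c p \<cdot> y\<close>. It holds for \<open>x\<close>, hence for
  \<open>y\<close>.\<close>

lemma presentable_equal:
  fixes C :: "('o, 'a) cat" (structure)
  assumes C: "category C" "locally_small \<kappa> C" and X: "presentable_object \<kappa> l C X"
    and l: "cinfinite l" "Card_order l"
    and P: "directed_poset \<kappa> l P r" and D: "is_functor (poset_cat P r) C D"
    and c: "is_colimit (poset_cat P r) C D L c"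
    and p: "p \<in> P" and x: "x \<in> hom C X (OMap D p)" and y: "y \<in> hom C X (OMap D p)"
    and eq: "c p \<cdot>\<^bsub>C\<^esub> x = c p \<cdot>\<^bsub>C\<^esub> y"
  shows "\<exists>q. (p, q) \<in> r \<and> AMap D (p, q) \<cdot>\<^bsub>C\<^esub> x = AMap D (p, q) \<cdot>\<^bsub>C\<^esub> y"
proof -
  interpret poset_diagram C P r D
    using C P D unfolding directed_poset_def by unfold_locales auto
  have dir: "\<exists>t. (s, t) \<in> r \<and> (q, t) \<in> r" if "s \<in> P" "q \<in> P" for s q
  proof -
    have "|{s, q}| <o l" 
      using l by (intro Cfinite_ordLess_Cinfinite)
        (simp_all add: cfinite_def Field_card_of card_of_card_order_on)
    moreover have "{s, q} \<subseteq> P" using that by simp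
    ultimately have "\<exists>t\<in>P. \<forall>s\<in>{s, q}. (s, t) \<in> r" using P unfolding directed_poset_def by blast
    then show ?thesis by blast
  qed
  define d where "d q z \<longleftrightarrow> (\<exists>s. (p, s) \<in> r \<and> (q, s) \<in> r \<and> AMap D (q, s) \<cdot> z = AMap D (p, s) \<cdot> x)" for q z
  have compat: "d q' (AMap D (q, q') \<cdot> z) = d q z" if q: "(q, q') \<in> r" and z: "z \<in> Hom X (OMap D q)" for q q' z
  proof
    assume "d q' (AMap D (q, q') \<cdot> z)"
    then obtain s where s: "(p, s) \<in> r" "(q', s) \<in> r"
      "AMap D (q', s) \<cdot> AMap D (q, q') \<cdot> z = AMap D (p, s) \<cdot> x" unfolding d_def by blast
    then have "AMap D (q, s) \<cdot> z = AMap D (p, s) \<cdot> x"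
      using assoc[OF D_hom[OF s(2)] D_hom[OF q] z] D_comp[OF q s(2)] by simp
    then show "d q z" using s q r_props(4) unfolding d_def by blast
  next
    assume "d q z"
    then obtain s where s: "(p, s) \<in> r" "(q, s) \<in> r" "AMap D (q, s) \<cdot> z = AMap D (p, s) \<cdot> x"
      unfolding d_def by blast
    obtain t where t: "(s, t) \<in> r" "(q', t) \<in> r" using dir r_props(2) s(1) q by blast
    have "AMap D (q', t) \<cdot> AMap D (q, q') \<cdot> z = AMap D (q, t) \<cdot> z"
      using assoc[OF D_hom[OF t(2)] D_hom[OF q] z] D_comp[OF q t(2)] by simp
    also have "\<dots> = AMap D (s, t) \<cdot> AMap D (q, s) \<cdot> z"
      using assoc[OF D_hom[OF t(1)] D_hom[OF s(2)] z] D_comp[OF s(2) t(1)] by simp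
    also have "\<dots> = AMap D (p, t) \<cdot> x"
      using assoc[OF D_hom[OF t(1)] D_hom[OF s(1)] x] D_comp[OF s(1) t(1)] s(3) by simp
    finally show "d q' (AMap D (q, q') \<cdot> z)" using s t r_props(4) unfolding d_def by blast
  qed
  obtain h where h: "\<And>p x. p \<in> P \<Longrightarrow> x \<in> hom C X (OMap D p) \<Longrightarrow> h (c p \<cdot> x) = d p x"
    by (rule presentable_predicates[OF C X P D c compat], assumption, assumption, rule that)
  have "d p x" using r_props(3)[OF p] unfolding d_def by blast
  then have "d p y" using h[OF p x] h[OF p y] eq by simp
  then obtain s where "(p, s) \<in> r" "AMap D (p, s) \<cdot> y = AMap D (p, s) \<cdot> x" unfolding d_def by blast
  then show ?thesis by (intro exI[of _ s]) simp
qed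

end

text \<open>This is only the factorization half of presentability, and only for chains indexed by
  \<open>\<mu>\<close>. It is what is required of the domain of an attached map in order to find
  each of its maps to the colimit of a sequence already at some stage.\<close>

definition chain_small :: "'v rel \<Rightarrow> ('o, 'a) cat \<Rightarrow> 'o \<Rightarrow> bool" where
  "chain_small \<mu> C B \<longleftrightarrow> B \<in> Obj C \<and>
     (\<forall>D L c. is_functor (poset_cat (Field \<mu>) \<mu>) C D \<longrightarrow> is_colimit (poset_cat (Field \<mu>) \<mu>) C D L c \<longrightarrow>
        (\<forall>g\<in>hom C B L. \<exists>p\<in>Field \<mu>. \<exists>x\<in>hom C B (OMap D p). c p \<cdot>\<^bsub>C\<^esub> x = g))"

text \<open>The restrictions of \<open>g\<close> to the fewer than \<open>\<mu>\<close> objects of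
  the diagram factor through stages of the chain, and so do the fewer than \<open>\<mu>\<close>
  equations that make these factors a cocone. Regularity of \<open>\<mu>\<close> gives a single
  stage \<open>\<beta>\<close> at which everything holds, and the colimit property of
  \<open>B\<close> yields a factor of \<open>g\<close> through that stage.\<close>

lemma (in universe) chain_small_colimit:
  fixes C :: "('o, 'a) cat" (structure) and P :: "'v set" and l \<mu> :: "'v rel"
  assumes C: "category C" "locally_small \<kappa> C"
    and l: "cinfinite l" "Card_order l" and \<mu>: "regular_cardinal \<mu>" "\<mu> <o \<kappa>" "l \<le>o \<mu>"
    and P: "directed_poset \<kappa> l P r" "|P| <o \<mu>"
    and E: "is_functor (poset_cat P r) C E" "\<And>p. p \<in> P \<Longrightarrow> presentable_object \<kappa> l C (OMap E p)"
    and e: "is_colimit (poset_cat P r) C E B e"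
  shows "chain_small \<mu> C B"
  unfolding chain_small_def
proof (intro conjI allI impI ballI)
  note \<mu>D = regular_cardinalD[OF \<mu>(1)]
  interpret E: poset_diagram C P r E
    using C P E unfolding directed_poset_def by unfold_locales auto
  show "B \<in> Obj C" using E.colimitD[OF e] by blast
  \<comment> \<open>The chain is \<open>l\<close>-directed because \<open>l\<close> is at most the
    regular cardinal \<open>\<mu>\<close>; thus presentability of the objects
    \<open>OMap E p\<close> applies to it.\<close>
  have \<mu>P: "directed_poset \<kappa> l (Field \<mu>) \<mu>"
    unfolding directed_poset_def
  proof (intro conjI allI impI)
    show "small \<kappa> (Field \<mu>)" unfolding small_def
      using card_of_Field_ordIso[OF \<mu>D(1)] \<mu>(2) ordIso_ordLess_trans by blast
    show "partial_order_on (Field \<mu>) \<mu>"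
      using \<mu>D(2) unfolding well_order_on_def linear_order_on_def by blast
    fix S assume S: "S \<subseteq> Field \<mu>" "|S| <o l"
    then show "\<exists>u\<in>Field \<mu>. \<forall>s\<in>S. (s, u) \<in> \<mu>"
      using regular_cardinal_bounded[OF \<mu>(1) S(1) ordLess_ordLeq_trans[OF S(2) \<mu>(3)]] by blast
  qed
  fix D L c g
  assume D: "is_functor (poset_cat (Field \<mu>) \<mu>) C D"
    and c: "is_colimit (poset_cat (Field \<mu>) \<mu>) C D L c" and g: "g \<in> hom C B L"
  interpret D: poset_diagram C "Field \<mu>" \<mu> D
    using C \<mu>P D unfolding directed_poset_def by unfold_locales auto
  note assoc = E.assoc
  have "\<exists>\<alpha> x. \<alpha> \<in> Field \<mu> \<and> x \<in> hom C (OMap E p) (OMap D \<alpha>) \<and> c \<alpha> \<cdot> x = g \<cdot> e p" if p: "p \<in> P" for p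
    using presentable_factor[OF C E(2)[OF p] \<mu>P D c E.comp_hom[OF g E.colimitD(2)[OF e p]]] by blast
  then obtain al x where x: "\<And>p. p \<in> P \<Longrightarrow> al p \<in> Field \<mu>"
    "\<And>p. p \<in> P \<Longrightarrow> x p \<in> hom C (OMap E p) (OMap D (al p))" "\<And>p. p \<in> P \<Longrightarrow> c (al p) \<cdot> x p = g \<cdot> e p"
    by metis
  have "|al ` P| <o \<mu>" using P(2) card_of_image ordLeq_ordLess_trans by blast
  moreover have "al ` P \<subseteq> Field \<mu>" using x(1) by blast
  ultimately obtain \<alpha> where "\<alpha> \<in> Field \<mu>" "\<forall>s\<in>al ` P. (s, \<alpha>) \<in> \<mu>"
    using regular_cardinal_bounded[OF \<mu>(1)] by blast
  then have \<alpha>: "\<alpha> \<in> Field \<mu>" "\<And>p. p \<in> P \<Longrightarrow> (al p, \<alpha>) \<in> \<mu>" by simp_all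
  define k where "k p = AMap D (al p, \<alpha>) \<cdot> x p" for p
  have k: "k p \<in> hom C (OMap E p) (OMap D \<alpha>)" "c \<alpha> \<cdot> k p = g \<cdot> e p" if p: "p \<in> P" for p
  proof -
    note Dp = D.D_hom[OF \<alpha>(2)[OF p]]
    show "k p \<in> hom C (OMap E p) (OMap D \<alpha>)" unfolding k_def using E.comp_hom[OF Dp x(2)[OF p]] .
    show "c \<alpha> \<cdot> k p = g \<cdot> e p" unfolding k_def
      using assoc[OF D.colimitD(2)[OF c \<alpha>(1)] Dp x(2)[OF p]] D.colimitD(3)[OF c \<alpha>(2)[OF p]] x(3)[OF p] by simp
  qed
  \<comment> \<open>The maps \<open>k p\<close> need not be compatible with the transition maps of
    \<open>E\<close>; the two sides agree only after composition with \<open>c \<alpha>\<close>. By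
    presentability each of these equations already holds at some later stage
    \<open>be u\<close>.\<close>
  have "\<exists>\<beta>. (\<alpha>, \<beta>) \<in> \<mu> \<and> AMap D (\<alpha>, \<beta>) \<cdot> (k (snd u) \<cdot> AMap E u) = AMap D (\<alpha>, \<beta>) \<cdot> k (fst u)" if u: "u \<in> r" for u
  proof -
    obtain p q where pq: "u = (p, q)" "(p, q) \<in> r" using u by (cases u) auto
    note P' = E.r_props(1,2)[OF pq(2)]
    note Eu = E.D_hom[OF pq(2)]
    have "c \<alpha> \<cdot> k q \<cdot> AMap E (p, q) = (g \<cdot> e q) \<cdot> AMap E (p, q)"
      using assoc[OF D.colimitD(2)[OF c \<alpha>(1)] k(1)[OF P'(2)] Eu] k(2)[OF P'(2)] by simp
    also have "\<dots> = c \<alpha> \<cdot> k p"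
      using assoc[OF g E.colimitD(2)[OF e P'(2)] Eu] E.colimitD(3)[OF e pq(2)] k(2)[OF P'(1)] by simp
    finally show ?thesis
      using presentable_equal[OF C E(2)[OF P'(1)] l \<mu>P D c \<alpha>(1) E.comp_hom[OF k(1)[OF P'(2)] Eu] k(1)[OF P'(1)]]
      unfolding pq by simp
  qed
  then obtain be where be: "\<And>u. u \<in> r \<Longrightarrow> (\<alpha>, be u) \<in> \<mu>"
    "\<And>u. u \<in> r \<Longrightarrow> AMap D (\<alpha>, be u) \<cdot> (k (snd u) \<cdot> AMap E u) = AMap D (\<alpha>, be u) \<cdot> k (fst u)"
    by metis
  have "|\<Union>p\<in>P. \<Union>q\<in>P. {(p, q)}| <o \<mu>"
    using \<mu>D(5)
    by (intro card_of_UNION_ordLess_infinite_Field_regularCard[OF \<mu>D(4,5)] ballI P(2)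
        Cfinite_ordLess_Cinfinite) (simp_all add: cfinite_def Field_card_of card_of_card_order_on)
  moreover have "r \<subseteq> (\<Union>p\<in>P. \<Union>q\<in>P. {(p, q)})" using E.r_props(1,2) by auto
  ultimately have "|r| <o \<mu>" using card_of_mono1 ordLeq_ordLess_trans by blast
  then have "|be ` r| <o \<mu>" using card_of_image ordLeq_ordLess_trans by blast
  moreover have "|{\<alpha>}| <o \<mu>"
    using \<mu>D(5) by (intro Cfinite_ordLess_Cinfinite)
      (simp_all add: cfinite_def Field_card_of card_of_card_order_on)
  ultimately have "|be ` r \<union> {\<alpha>}| <o \<mu>"
    using card_of_Un_ordLess_infinite_Field[OF \<mu>D(3,1)] by blast
  moreover have "be ` r \<union> {\<alpha>} \<subseteq> Field \<mu>" using be(1) \<alpha>(1) D.r_props(2) by blast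
  ultimately obtain \<beta> where "\<beta> \<in> Field \<mu>" "\<forall>s \<in> be ` r \<union> {\<alpha>}. (s, \<beta>) \<in> \<mu>"
    using regular_cardinal_bounded[OF \<mu>(1)] by blast
  then have \<beta>: "\<beta> \<in> Field \<mu>" "\<And>u. u \<in> r \<Longrightarrow> (be u, \<beta>) \<in> \<mu>" "(\<alpha>, \<beta>) \<in> \<mu>" by simp_all
  note D\<beta> = D.D_hom[OF \<beta>(3)]
  have "is_cocone (poset_cat P r) C E (OMap D \<beta>) (\<lambda>p. AMap D (\<alpha>, \<beta>) \<cdot> k p)"
    unfolding E.cocone_iff
  proof (intro conjI allI impI ballI)
    show "OMap D \<beta> \<in> Obj C" using D.D_Obj \<beta>(1) .
    show "AMap D (\<alpha>, \<beta>) \<cdot> k p \<in> hom C (OMap E p) (OMap D \<beta>)" if "p \<in> P" for p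
      using E.comp_hom[OF D\<beta> k(1)[OF that]] .
    fix p q assume pq: "(p, q) \<in> r"
    note P' = E.r_props(1,2)[OF pq]
    note Eu = E.D_hom[OF pq]
    note b = be(1)[OF pq] \<beta>(2)[OF pq]
    note Db = D.D_comp[OF b] D.D_hom[OF b(1)] D.D_hom[OF b(2)]
    have "(AMap D (\<alpha>, \<beta>) \<cdot> k q) \<cdot> AMap E (p, q) = AMap D (\<alpha>, \<beta>) \<cdot> k q \<cdot> AMap E (p, q)"
      using assoc[OF D\<beta> k(1)[OF P'(2)] Eu] .
    also have "\<dots> = AMap D (be (p, q), \<beta>) \<cdot> AMap D (\<alpha>, be (p, q)) \<cdot> k q \<cdot> AMap E (p, q)"
      using assoc[OF Db(3,2) E.comp_hom[OF k(1)[OF P'(2)] Eu]] Db(1) by simp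
    also have "\<dots> = AMap D (be (p, q), \<beta>) \<cdot> AMap D (\<alpha>, be (p, q)) \<cdot> k p"
      using be(2)[OF pq] by simp
    also have "\<dots> = AMap D (\<alpha>, \<beta>) \<cdot> k p"
      using assoc[OF Db(3,2) k(1)[OF P'(1)]] Db(1) by simp
    finally show "(AMap D (\<alpha>, \<beta>) \<cdot> k q) \<cdot> AMap E (p, q) = AMap D (\<alpha>, \<beta>) \<cdot> k p" .
  qed
  then have "\<exists>!h. h \<in> hom C B (OMap D \<beta>) \<and>
      (\<forall>p\<in>Obj (poset_cat P r). h \<cdot> e p = AMap D (\<alpha>, \<beta>) \<cdot> k p)"
    using e unfolding is_colimit_def by blast
  then obtain h where h: "h \<in> hom C B (OMap D \<beta>)" "\<And>p. p \<in> P \<Longrightarrow> h \<cdot> e p = AMap D (\<alpha>, \<beta>) \<cdot> k p"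
    unfolding poset_cat_def by auto
  have "c \<beta> \<cdot> h = g"
  proof (rule E.colimit_unique[OF e E.category_poset E(1) _ g])
    note c\<beta> = D.colimitD(2)[OF c \<beta>(1)]
    show "c \<beta> \<cdot> h \<in> hom C B L" using E.comp_hom[OF c\<beta> h(1)] .
    fix p assume "p \<in> Obj (poset_cat P r)"
    then have p: "p \<in> P" unfolding poset_cat_def by simp
    have "(c \<beta> \<cdot> h) \<cdot> e p = c \<beta> \<cdot> AMap D (\<alpha>, \<beta>) \<cdot> k p"
      using assoc[OF c\<beta> h(1) E.colimitD(2)[OF e p]] h(2)[OF p] by simp
    also have "\<dots> = g \<cdot> e p"
      using assoc[OF c\<beta> D\<beta> k(1)[OF p]] D.colimitD(3)[OF c \<beta>(3)] k(2)[OF p] by simp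
    finally show "(c \<beta> \<cdot> h) \<cdot> e p = g \<cdot> e p" .
  qed
  then show "\<exists>p\<in>Field \<mu>. \<exists>x\<in>hom C B (OMap D p). c p \<cdot> x = g" using \<beta>(1) h(1) by blast
qed

text \<open>Each object of \<open>Bs\<close> is a colimit of presentable objects over some small
  directed poset. A single \<open>\<mu>\<close> above the size of the union of all these posets
  serves the whole set.\<close>

lemma (in universe) chain_small_ex:
  fixes Bs :: "'o set"
  assumes C: "locally_presentable \<kappa> C" and Bs: "Bs \<subseteq> Obj C" "small \<kappa> Bs"
  obtains \<mu> :: "'v rel" where "regular_cardinal \<mu>" "\<mu> <o \<kappa>" "\<And>B. B \<in> Bs \<Longrightarrow> chain_small \<mu> C B"
proof -
  obtain l where l: "small_regular_cardinal \<kappa> l" "locally_l_presentable \<kappa> l C"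
    using C unfolding locally_presentable_def by blast
  then have l': "cinfinite l" "Card_order l" unfolding small_regular_cardinal_def by auto
  obtain G where C': "category C" "locally_small \<kappa> C" and G: "\<And>X. X \<in> G \<Longrightarrow> presentable_object \<kappa> l C X"
    "\<And>Y. Y \<in> Obj C \<Longrightarrow> \<exists>P r D c. directed_poset \<kappa> l P r \<and> is_functor (poset_cat P r) C D \<and>
           (\<forall>p \<in> P. OMap D p \<in> G) \<and> is_colimit (poset_cat P r) C D Y c"
    using l(2) unfolding locally_l_presentable_def by metis
  obtain P r D c where P: "\<And>Y. Y \<in> Obj C \<Longrightarrow> directed_poset \<kappa> l (P Y) (r Y)"
    "\<And>Y. Y \<in> Obj C \<Longrightarrow> is_functor (poset_cat (P Y) (r Y)) C (D Y)"
    "\<And>Y p. Y \<in> Obj C \<Longrightarrow> p \<in> P Y \<Longrightarrow> OMap (D Y) p \<in> G"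
    "\<And>Y. Y \<in> Obj C \<Longrightarrow> is_colimit (poset_cat (P Y) (r Y)) C (D Y) Y (c Y)"
    using G(2) by metis
  have sm: "small \<kappa> (\<Union>Y\<in>Bs. P Y)"
    using small_UN[OF Bs(2)] P(1) Bs(1) unfolding directed_poset_def by blast
  obtain \<mu> :: "'v rel" where \<mu>: "regular_cardinal \<mu>" "\<mu> <o \<kappa>" "l \<le>o \<mu>" "|\<Union>Y\<in>Bs. P Y| <o \<mu>"
    by (rule regular_cardinal_above[OF l(1) sm])
  have "chain_small \<mu> C B" if B: "B \<in> Bs" for B
  proof -
    have BO: "B \<in> Obj C" using B Bs(1) by blast
    have "|P B| <o \<mu>" using \<mu>(4) card_of_mono1[of "P B" "\<Union>Y\<in>Bs. P Y"] B ordLeq_ordLess_trans by blast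
    then show ?thesis
      using chain_small_colimit[OF C' l' \<mu>(1-3) P(1)[OF BO] _ P(2)[OF BO] G(1)[OF P(3)[OF BO]] P(4)[OF BO]] by blast
  qed
  then show thesis using that \<mu> by blast
qed

section \<open>Transfinite cell attachment\<close>

text \<open>The colimit of a stage will be chosen by \<open>SOME\<close> from restricted data. In
  this way equal data on the generators give literally the same chosen object and
  coprojections.\<close>

lemma rel_cocone_restrict: "rel_cocone C N (restrict X N) R P c \<longleftrightarrow> rel_cocone C N X R P c"
  unfolding rel_cocone_def by simp

lemma rel_colimit_restrict: "rel_colimit C N (restrict X N) R P c \<longleftrightarrow> rel_colimit C N X R P c"
  unfolding rel_colimit_def rel_cocone_restrict ..

text \<open>The generators from which a stage is built: \<open>Inl None\<close> is the starting
  object, \<open>Inl (Some \<beta>)\<close> the object of stage \<open>\<beta>\<close>, and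
  \<open>Inr (\<beta>, u, m, w)\<close> the codomain of \<open>m\<close> for a cell of stage
  \<open>\<beta>\<close>.\<close>

type_synonym ('a, 'v) node = "'v option + 'v \<times> 'a \<times> 'a \<times> 'a"
type_synonym ('o, 'a, 'v) stage = "'o \<times> (('a, 'v) node \<Rightarrow> 'a) \<times> ('a \<times> 'a \<times> 'a) set"

text \<open>A transfinite sequence of cell attachments starting from \<open>X0\<close>. Stage \<open>\<alpha>\<close> consists of an object
  \<open>Z\<^sub>\<alpha>\<close>, of coprojections into it, and of a set of cells \<open>(u, m, w)\<close>, each of which attaches the map \<open>m\<close>
  along \<open>u : Dom m \<rightarrow> Z\<^sub>\<alpha>\<close> (several times if there are several labels \<open>w\<close>) at all later stages.
  The object \<open>Z\<^sub>\<alpha>\<close> is the colimit of \<open>X0\<close>, of all earlier \<open>Z\<^sub>\<beta>\<close> and of all their cells. So limit stages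
  need no separate treatment.\<close>

locale cell_sequence = universe \<kappa> + cat K for \<kappa> :: "'v rel" and K :: "('o, 'a) cat" (structure) +
  fixes \<mu> :: "'v rel" and M W :: "'a set" and X0 :: 'o
  assumes locally_small: "locally_small \<kappa> K" and cocomplete: "cocomplete \<kappa> K"
    and \<mu>: "regular_cardinal \<mu>" and \<mu>_less: "\<mu> <o \<kappa>"
    and M: "M \<subseteq> Arr K" and small_M: "small \<kappa> M" and small_W: "small \<kappa> W"
    and X0: "X0 \<in> Obj K"
begin

lemmas \<mu>D = regular_cardinalD[OF \<mu>]

definition below :: "'v \<Rightarrow> 'v set" where "below \<alpha> = {\<beta>. (\<beta>, \<alpha>) \<in> \<mu> - Id}"

abbreviation obj :: "('v \<Rightarrow> ('o, 'a, 'v) stage) \<Rightarrow> 'v \<Rightarrow> 'o" where "obj f \<alpha> \<equiv> fst (f \<alpha>)"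
abbreviation inj :: "('v \<Rightarrow> ('o, 'a, 'v) stage) \<Rightarrow> 'v \<Rightarrow> ('a, 'v) node \<Rightarrow> 'a"
  where "inj f \<alpha> \<equiv> fst (snd (f \<alpha>))"
abbreviation cells :: "('v \<Rightarrow> ('o, 'a, 'v) stage) \<Rightarrow> 'v \<Rightarrow> ('a \<times> 'a \<times> 'a) set"
  where "cells f \<alpha> \<equiv> snd (snd (f \<alpha>))"

definition stages :: "'v \<Rightarrow> ('a, 'v) node set" where
  "stages \<alpha> = Inl ` insert None (Some ` below \<alpha>)"

definition nodes :: "('v \<Rightarrow> ('o, 'a, 'v) stage) \<Rightarrow> 'v \<Rightarrow> ('a, 'v) node set" where
  "nodes f \<alpha> = stages \<alpha> \<union> Inr ` Sigma (below \<alpha>) (cells f)"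

definition node_obj :: "('v \<Rightarrow> ('o, 'a, 'v) stage) \<Rightarrow> ('a, 'v) node \<Rightarrow> 'o" where
  "node_obj f = case_sum (case_option X0 (obj f)) (\<lambda>(\<beta>, u, m, w). Cod K m)"

text \<open>The first family makes the maps from \<open>X0\<close> and from earlier stages
  compatible with passing through stage \<open>\<beta>\<close>; the second consists of the attaching
  squares. As \<open>stages \<beta>\<close> contains no cells, nothing identifies the copies of one
  cell in different later stages: it is attached anew in each of them. Hence extensions over a cell
  may be chosen independently at every stage.\<close>

definition rels :: "('v \<Rightarrow> ('o, 'a, 'v) stage) \<Rightarrow> 'v \<Rightarrow>
    (('a, 'v) node \<times> 'a \<times> ('a, 'v) node \<times> 'a) set" where
  "rels f \<alpha> = (\<Union>\<beta>\<in>below \<alpha>.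
     (\<lambda>j. (Inl (Some \<beta>), inj f \<beta> j, j, Ident K (node_obj f j))) ` stages \<beta> \<union>
     (\<lambda>(u, m, w). (Inr (\<beta>, u, m, w), m, Inl (Some \<beta>), u)) ` cells f \<beta>)"

abbreviation stage_colimit :: "('v \<Rightarrow> ('o, 'a, 'v) stage) \<Rightarrow> 'v \<Rightarrow> 'o \<Rightarrow> (('a, 'v) node \<Rightarrow> 'a) \<Rightarrow> bool"
  where "stage_colimit f \<alpha> \<equiv> rel_colimit K (nodes f \<alpha>) (node_obj f) (rels f \<alpha>)"

definition all_cells :: "'o \<Rightarrow> ('a \<times> 'a \<times> 'a) set" where
  "all_cells Z = {(u, m, w). m \<in> M \<and> u \<in> Hom (Dom K m) Z \<and> w \<in> W}"

text \<open>The choice of the colimit is fixed, so that only the set of cells varies.\<close>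

definition next_stage :: "('v \<Rightarrow> ('o, 'a, 'v) stage) \<Rightarrow> 'v \<Rightarrow> 'o \<times> (('a, 'v) node \<Rightarrow> 'a)" where
  "next_stage f \<alpha> = (SOME p.
     rel_colimit K (nodes f \<alpha>) (restrict (node_obj f) (nodes f \<alpha>)) (rels f \<alpha>) (fst p) (snd p))"

definition choices :: "'v \<Rightarrow> ('v \<Rightarrow> ('o, 'a, 'v) stage) \<Rightarrow> ('o, 'a, 'v) stage set" where
  "choices \<alpha> f = (\<lambda>T. (fst (next_stage f \<alpha>), snd (next_stage f \<alpha>), T)) ` Pow (all_cells (fst (next_stage f \<alpha>)))"

definition seq :: "('v \<Rightarrow> ('o, 'a, 'v) stage) \<Rightarrow> bool" where
  "seq f \<longleftrightarrow> (\<forall>\<alpha>\<in>Field \<mu>. f \<alpha> \<in> choices \<alpha> f)"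

lemma below_Field: "\<beta> \<in> below \<alpha> \<Longrightarrow> \<beta> \<in> Field \<mu>"
  unfolding below_def Field_def by auto

lemma below_trans: "\<gamma> \<in> below \<beta> \<Longrightarrow> \<beta> \<in> below \<alpha> \<Longrightarrow> \<gamma> \<in> below \<alpha>"
  using transD[OF \<mu>D(8), of \<gamma> \<beta> \<alpha>] antisymD[OF \<mu>D(9), of \<gamma> \<beta>] unfolding below_def by auto

lemma small_Field: "small \<kappa> (Field \<mu>)"
  unfolding small_def using card_of_Field_ordIso[OF \<mu>D(1)] \<mu>_less ordIso_ordLess_trans by blast

lemma small_below: "small \<kappa> (below \<alpha>)"
  using small_subset[OF small_Field] below_Field by blast

text \<open>The possible stages at \<open>\<alpha>\<close> depend on the earlier stages only,
  because the chosen colimit is a function of the generators, their objects and the relations. Both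
  recursion along \<open>\<mu>\<close> and the counting of sequences rest on this.\<close>

lemma choices_cong:
  assumes "\<And>\<beta>. \<beta> \<in> below \<alpha> \<Longrightarrow> f \<beta> = g \<beta>"
  shows "choices \<alpha> f = choices \<alpha> g"
proof -
  have N: "nodes f \<alpha> = nodes g \<alpha>" unfolding nodes_def using assms by (auto intro!: Sigma_cong)
  have X: "node_obj f j = node_obj g j" if "j \<in> nodes f \<alpha>" for j
    using that assms unfolding nodes_def stages_def node_obj_def by auto
  have S: "stages \<beta> \<subseteq> nodes f \<alpha>" if "\<beta> \<in> below \<alpha>" for \<beta>
    unfolding nodes_def stages_def using that below_trans by auto
  have "rels f \<alpha> = rels g \<alpha>"
    unfolding rels_def using assms X S by (intro SUP_cong arg_cong2[where f = "(\<union>)"] image_cong refl)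
      (auto simp: X[OF subsetD[OF S]])
  moreover have "restrict (node_obj f) (nodes f \<alpha>) = restrict (node_obj g) (nodes f \<alpha>)"
    using X by (intro restrict_ext) simp
  ultimately have "next_stage f \<alpha> = next_stage g \<alpha>" unfolding next_stage_def N by simp
  then show ?thesis unfolding choices_def by simp
qed

lemma small_all_cells: "small \<kappa> (all_cells Z)"
proof -
  have hom: "small \<kappa> (Hom Y Z)" if "Y \<in> Obj K" for Y
  proof (cases "Z \<in> Obj K")
    case True then show ?thesis using locally_small that unfolding locally_small_def by simp
  next
    case False then have "Hom Y Z = {}" using homD(5) by blast
    then show ?thesis by (simp add: small_finite)
  qed
  have "small \<kappa> ((\<lambda>(m, u, w). (u, m, w)) ` (SIGMA m:M. Hom (Dom K m) Z \<times> W))"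
    using M Arr_Obj(1) by (intro small_image small_Sigma small_M small_W hom) auto
  then show ?thesis by (rule small_subset) (force simp: all_cells_def)
qed

lemma small_choices: "small \<kappa> (choices \<alpha> f)"
  unfolding choices_def by (intro small_image small_Pow small_all_cells)

lemma choicesD:
  assumes "s \<in> choices \<alpha> f"
  shows "fst s = fst (next_stage f \<alpha>)" "fst (snd s) = snd (next_stage f \<alpha>)"
    "snd (snd s) \<subseteq> all_cells (fst s)"
  using assms unfolding choices_def by auto

lemma next_stage_colimit_if:
  assumes "\<exists>Z c. stage_colimit f \<alpha> Z c"
  shows "stage_colimit f \<alpha> (fst (next_stage f \<alpha>)) (snd (next_stage f \<alpha>))"
proof -
  have "\<exists>p. rel_colimit K (nodes f \<alpha>) (restrict (node_obj f) (nodes f \<alpha>)) (rels f \<alpha>) (fst p) (snd p)"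
    using assms unfolding rel_colimit_restrict by simp
  from someI_ex[OF this] show ?thesis unfolding next_stage_def rel_colimit_restrict .
qed

text \<open>The relations at \<open>\<alpha>\<close> mention the coprojections of earlier stages and
  make sense only once those stages are known to be colimits, whence the induction. The hypothesis
  concerns only stages below \<open>\<alpha>\<close>, so that the result is available while a
  sequence is still being built.\<close>

lemma stage_colimit_ex:
  assumes f: "\<And>\<beta>. \<beta> \<in> below \<alpha> \<Longrightarrow> f \<beta> \<in> choices \<beta> f"
  shows "rel_data K (nodes f \<alpha>) (node_obj f) (rels f \<alpha>) \<and>
    stage_colimit f \<alpha> (fst (next_stage f \<alpha>)) (snd (next_stage f \<alpha>))"
  using \<mu>D(6) f
proof (induction \<alpha> rule: wf_induct_rule)
  case (less \<alpha>)
  have col: "stage_colimit f \<beta> (obj f \<beta>) (inj f \<beta>)" if \<beta>: "\<beta> \<in> below \<alpha>" for \<beta>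
  proof -
    have "stage_colimit f \<beta> (fst (next_stage f \<beta>)) (snd (next_stage f \<beta>))"
      by (rule conjunct2[OF less.IH]) (use \<beta> less.prems below_trans[OF _ \<beta>] in \<open>simp_all add: below_def\<close>)
    then show ?thesis unfolding choicesD(1,2)[OF less.prems[OF \<beta>]] .
  qed
  have cells: "m \<in> M" "u \<in> Hom (Dom K m) (obj f \<beta>)" "m \<in> Hom (Dom K m) (Cod K m)"
    if "\<beta> \<in> below \<alpha>" "(u, m, w) \<in> cells f \<beta>" for \<beta> u m w
  proof -
    have "(u, m, w) \<in> all_cells (obj f \<beta>)" using choicesD(3)[OF less.prems[OF that(1)]] that(2) by (rule subsetD)
    then show "m \<in> M" "u \<in> Hom (Dom K m) (obj f \<beta>)" "m \<in> Hom (Dom K m) (Cod K m)"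
      using M Arr_hom[of m] unfolding all_cells_def by auto
  qed
  note colD = rel_coconeD[OF rel_colimitD(1)[OF col]]
  have X: "node_obj f j \<in> Obj K" if "j \<in> nodes f \<alpha>" for j
  proof -
    consider "j = Inl None" | \<beta> where "\<beta> \<in> below \<alpha>" "j = Inl (Some \<beta>)"
      | \<beta> u m w where "\<beta> \<in> below \<alpha>" "(u, m, w) \<in> cells f \<beta>" "j = Inr (\<beta>, u, m, w)"
      using \<open>j \<in> nodes f \<alpha>\<close> unfolding nodes_def stages_def by auto
    then show ?thesis
    proof cases
      case 1 then show ?thesis using X0 unfolding node_obj_def by simp
    next
      case 2 then show ?thesis using colD(1) unfolding node_obj_def by simp
    next
      case 3 then show ?thesis using homD(5)[OF cells(3)[OF 3(1,2)]] unfolding node_obj_def by simp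
    qed
  qed
  have S: "stages \<beta> \<subseteq> nodes f \<alpha>" "stages \<beta> \<subseteq> nodes f \<beta>" if "\<beta> \<in> below \<alpha>" for \<beta>
    unfolding nodes_def stages_def using that below_trans by auto
  have data: "rel_data K (nodes f \<alpha>) (node_obj f) (rels f \<alpha>)"
  proof (rule rel_dataI)
    fix j a k b assume "(j, a, k, b) \<in> rels f \<alpha>"
    then consider (stage) \<beta> where "\<beta> \<in> below \<alpha>" "j = Inl (Some \<beta>)" "a = inj f \<beta> k" "k \<in> stages \<beta>"
        "b = Ident K (node_obj f k)"
      | (cell) \<beta> w where "\<beta> \<in> below \<alpha>" "(b, a, w) \<in> cells f \<beta>" "j = Inr (\<beta>, b, a, w)" "k = Inl (Some \<beta>)"
      unfolding rels_def by auto
    then show "j \<in> nodes f \<alpha> \<and> k \<in> nodes f \<alpha> \<and> (\<exists>W. a \<in> Hom W (node_obj f j) \<and> b \<in> Hom W (node_obj f k))"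
    proof cases
      case stage
      have "inj f \<beta> k \<in> Hom (node_obj f k) (obj f \<beta>)" using colD(2)[OF stage(1)] S(2) stage by blast
      moreover have "Ident K (node_obj f k) \<in> Hom (node_obj f k) (node_obj f k)"
        using Ident_hom[OF X] S(1) stage by blast
      moreover have "j \<in> nodes f \<alpha>" "k \<in> nodes f \<alpha>"
        using S(1) stage unfolding nodes_def stages_def by auto
      ultimately show ?thesis using stage unfolding node_obj_def by auto
    next
      case cell
      then show ?thesis using cells[OF cell(1,2)] unfolding nodes_def stages_def node_obj_def by auto
    qed
  qed (rule X)
  have sc: "small \<kappa> (cells f \<beta>)" if "\<beta> \<in> below \<alpha>" for \<beta>
    using small_subset[OF small_all_cells choicesD(3)[OF less.prems[OF that]]] .
  have st: "small \<kappa> (stages \<beta>)" for \<beta>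
    unfolding stages_def
    by (intro small_image small_subset[OF small_Un[OF small_finite[of "{None}"] small_image[OF small_below]]]) auto
  have "small \<kappa> (nodes f \<alpha>)"
    unfolding nodes_def by (intro small_image small_Un st small_below small_Sigma sc)
  moreover have "small \<kappa> (rels f \<alpha>)"
    unfolding rels_def by (intro small_UN small_image small_Un st small_below sc)
  ultimately have "\<exists>Z c. stage_colimit f \<alpha> Z c" using rel_colimit_ex[OF category cocomplete _ _ data] by simp
  then show ?case using data next_stage_colimit_if by simp
qed

lemma seq_choices: "seq f \<Longrightarrow> \<alpha> \<in> Field \<mu> \<Longrightarrow> f \<alpha> \<in> choices \<alpha> f"
  unfolding seq_def by simp

lemma seqD:
  assumes f: "seq f" and \<alpha>: "\<alpha> \<in> Field \<mu>"
  shows "rel_data K (nodes f \<alpha>) (node_obj f) (rels f \<alpha>)"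
    and "stage_colimit f \<alpha> (obj f \<alpha>) (inj f \<alpha>)"
    and "obj f \<alpha> \<in> Obj K"
    and "inj f \<alpha> (Inl None) \<in> Hom X0 (obj f \<alpha>)"
    and "\<beta> \<in> below \<alpha> \<Longrightarrow> inj f \<alpha> (Inl (Some \<beta>)) \<in> Hom (obj f \<beta>) (obj f \<alpha>)"
    and "\<beta> \<in> below \<alpha> \<Longrightarrow> (u, m, w) \<in> cells f \<beta> \<Longrightarrow> inj f \<alpha> (Inr (\<beta>, u, m, w)) \<in> Hom (Cod K m) (obj f \<alpha>)"
    and "\<beta> \<in> below \<alpha> \<Longrightarrow> inj f \<alpha> (Inl (Some \<beta>)) \<cdot> inj f \<beta> (Inl None) = inj f \<alpha> (Inl None)"
    and "\<beta> \<in> below \<alpha> \<Longrightarrow> \<gamma> \<in> below \<beta> \<Longrightarrow>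
      inj f \<alpha> (Inl (Some \<beta>)) \<cdot> inj f \<beta> (Inl (Some \<gamma>)) = inj f \<alpha> (Inl (Some \<gamma>))"
    and "\<beta> \<in> below \<alpha> \<Longrightarrow> (u, m, w) \<in> cells f \<beta> \<Longrightarrow>
      inj f \<alpha> (Inr (\<beta>, u, m, w)) \<cdot> m = inj f \<alpha> (Inl (Some \<beta>)) \<cdot> u"
    and "(u, m, w) \<in> cells f \<alpha> \<Longrightarrow> m \<in> M \<and> u \<in> Hom (Dom K m) (obj f \<alpha>) \<and> w \<in> W"
proof -
  note opt = seq_choices[OF f \<alpha>]
  note * = stage_colimit_ex[of \<alpha> f, OF seq_choices[OF f below_Field]]
  show "rel_data K (nodes f \<alpha>) (node_obj f) (rels f \<alpha>)" using * by simp
  show col: "stage_colimit f \<alpha> (obj f \<alpha>) (inj f \<alpha>)" unfolding choicesD[OF opt] using * by simp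
  note D = rel_coconeD[OF rel_colimitD(1)[OF col]]
  show "obj f \<alpha> \<in> Obj K" by (rule D)
  show 1: "inj f \<alpha> (Inl None) \<in> Hom X0 (obj f \<alpha>)"
    using D(2)[of "Inl None"] unfolding nodes_def stages_def node_obj_def by auto
  show 2: "inj f \<alpha> (Inl (Some \<beta>)) \<in> Hom (obj f \<beta>) (obj f \<alpha>)" if "\<beta> \<in> below \<alpha>" for \<beta>
    using D(2)[of "Inl (Some \<beta>)"] that unfolding nodes_def stages_def node_obj_def by auto
  show "inj f \<alpha> (Inr (\<beta>, u, m, w)) \<in> Hom (Cod K m) (obj f \<alpha>)"
    if "\<beta> \<in> below \<alpha>" "(u, m, w) \<in> cells f \<beta>"
    using D(2)[of "Inr (\<beta>, u, m, w)"] that unfolding nodes_def stages_def node_obj_def by force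
  have rel: "inj f \<alpha> (Inl (Some \<beta>)) \<cdot> inj f \<beta> j = inj f \<alpha> j \<cdot> Ident K (node_obj f j)"
    if "\<beta> \<in> below \<alpha>" "j \<in> stages \<beta>" for j
    by (rule D(3)) (use that in \<open>auto simp: rels_def\<close>)
  show "inj f \<alpha> (Inl (Some \<beta>)) \<cdot> inj f \<beta> (Inl None) = inj f \<alpha> (Inl None)" if "\<beta> \<in> below \<alpha>"
    using rel[OF that, of "Inl None"] comp_Ident(1)[OF 1] unfolding stages_def node_obj_def by auto
  show "inj f \<alpha> (Inl (Some \<beta>)) \<cdot> inj f \<beta> (Inl (Some \<gamma>)) = inj f \<alpha> (Inl (Some \<gamma>))"
    if "\<beta> \<in> below \<alpha>" "\<gamma> \<in> below \<beta>"
    using rel[OF that(1), of "Inl (Some \<gamma>)"] that(2) comp_Ident(1)[OF 2[OF below_trans[OF that(2,1)]]]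
    unfolding stages_def node_obj_def by auto
  show "inj f \<alpha> (Inr (\<beta>, u, m, w)) \<cdot> m = inj f \<alpha> (Inl (Some \<beta>)) \<cdot> u"
    if "\<beta> \<in> below \<alpha>" "(u, m, w) \<in> cells f \<beta>"
    by (rule D(3)) (use that in \<open>force simp: rels_def\<close>)
  show "(u, m, w) \<in> cells f \<alpha> \<Longrightarrow> m \<in> M \<and> u \<in> Hom (Dom K m) (obj f \<alpha>) \<and> w \<in> W"
    using choicesD(3)[OF opt] unfolding all_cells_def by blast
qed

text \<open>A map out of a stage amounts to compatible maps \<open>q \<beta>\<close> out of the
  earlier stages together with, for each of their cells, an extension of
  \<open>q \<beta> \<cdot> u\<close> along \<open>m\<close>. The extensions are chosen here, and
  \<open>ok\<close> transports whatever else is known about them to the induced map.\<close>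

lemma stage_induced:
  assumes f: "\<And>\<beta>. \<beta> \<in> below \<alpha> \<Longrightarrow> f \<beta> \<in> choices \<beta> f" and col: "stage_colimit f \<alpha> Z c"
    and Y: "y \<in> Hom X0 Y" "\<And>\<beta>. \<beta> \<in> below \<alpha> \<Longrightarrow> q \<beta> \<in> Hom (obj f \<beta>) Y"
    and q: "\<And>\<beta>. \<beta> \<in> below \<alpha> \<Longrightarrow> q \<beta> \<cdot> inj f \<beta> (Inl None) = y"
      "\<And>\<beta> \<gamma>. \<beta> \<in> below \<alpha> \<Longrightarrow> \<gamma> \<in> below \<beta> \<Longrightarrow> q \<beta> \<cdot> inj f \<beta> (Inl (Some \<gamma>)) = q \<gamma>"
    and v: "\<And>\<beta> u m w. \<beta> \<in> below \<alpha> \<Longrightarrow> (u, m, w) \<in> cells f \<beta> \<Longrightarrow>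
      \<exists>v. v \<in> Hom (Cod K m) Y \<and> v \<cdot> m = q \<beta> \<cdot> u \<and> ok \<beta> u m w v"
  obtains h where "h \<in> Hom Z Y" "h \<cdot> c (Inl None) = y"
    "\<And>\<beta>. \<beta> \<in> below \<alpha> \<Longrightarrow> h \<cdot> c (Inl (Some \<beta>)) = q \<beta>"
    "\<And>\<beta> u m w. \<beta> \<in> below \<alpha> \<Longrightarrow> (u, m, w) \<in> cells f \<beta> \<Longrightarrow> ok \<beta> u m w (h \<cdot> c (Inr (\<beta>, u, m, w)))"
proof -
  define V where "V = (\<lambda>(\<beta>, u, m, w). SOME v. v \<in> Hom (Cod K m) Y \<and> v \<cdot> m = q \<beta> \<cdot> u \<and> ok \<beta> u m w v)"
  have V: "V (\<beta>, u, m, w) \<in> Hom (Cod K m) Y" "V (\<beta>, u, m, w) \<cdot> m = q \<beta> \<cdot> u" "ok \<beta> u m w (V (\<beta>, u, m, w))"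
    if "\<beta> \<in> below \<alpha>" "(u, m, w) \<in> cells f \<beta>" for \<beta> u m w
    using someI_ex[OF v[OF that]] unfolding V_def by auto
  define d where "d = case_sum (case_option y q) V"
  have "rel_cocone K (nodes f \<alpha>) (node_obj f) (rels f \<alpha>) Y d"
  proof (rule rel_coconeI)
    show "Y \<in> Obj K" by (rule homD(5)[OF Y(1)])
    show d: "d j \<in> Hom (node_obj f j) Y" if "j \<in> nodes f \<alpha>" for j
      using that Y V(1) unfolding nodes_def stages_def node_obj_def d_def by auto
    fix j a k b assume "(j, a, k, b) \<in> rels f \<alpha>"
    then consider (stage) \<beta> where "\<beta> \<in> below \<alpha>" "j = Inl (Some \<beta>)" "a = inj f \<beta> k" "k \<in> stages \<beta>"
        "b = Ident K (node_obj f k)"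
      | (cell) \<beta> w where "\<beta> \<in> below \<alpha>" "(b, a, w) \<in> cells f \<beta>" "j = Inr (\<beta>, b, a, w)" "k = Inl (Some \<beta>)"
      unfolding rels_def by auto
    then show "d j \<cdot> a = d k \<cdot> b"
    proof cases
      case stage
      have "k \<in> nodes f \<alpha>"
        using stage below_trans unfolding nodes_def stages_def by auto
      then have "d k \<cdot> b = d k" unfolding stage(5) using comp_Ident(1)[OF d] by simp
      moreover have "q \<beta> \<cdot> inj f \<beta> k = d k"
        using stage(4) q[OF stage(1)] unfolding stages_def d_def by auto
      ultimately show ?thesis using stage unfolding d_def by simp
    next
      case cell
      then show ?thesis using V(2)[OF cell(1,2)] unfolding d_def by simp
    qed
  qed
  then obtain h where h: "h \<in> Hom Z Y" "\<And>j. j \<in> nodes f \<alpha> \<Longrightarrow> h \<cdot> c j = d j"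
    using rel_colimitD(2)[OF col] by blast
  show thesis
  proof (rule that[OF h(1)])
    show "h \<cdot> c (Inl None) = y" using h(2)[of "Inl None"] unfolding nodes_def stages_def d_def by auto
    show "h \<cdot> c (Inl (Some \<beta>)) = q \<beta>" if "\<beta> \<in> below \<alpha>" for \<beta>
      using h(2)[of "Inl (Some \<beta>)"] that unfolding nodes_def stages_def d_def by auto
    show "ok \<beta> u m w (h \<cdot> c (Inr (\<beta>, u, m, w)))" if "\<beta> \<in> below \<alpha>" "(u, m, w) \<in> cells f \<beta>" for \<beta> u m w
      using h(2)[of "Inr (\<beta>, u, m, w)"] V(3)[OF that] that unfolding nodes_def d_def by force
  qed
qed


section \<open>The colimit of a sequence and the map from its starting object\<close>

definition seq_functor :: "('v \<Rightarrow> ('o, 'a, 'v) stage) \<Rightarrow> ('v, 'v \<times> 'v, 'o, 'a) cfunctor" where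
  "seq_functor f = \<lparr>OMap = obj f,
     AMap = (\<lambda>(\<beta>, \<alpha>). if \<beta> = \<alpha> then Ident K (obj f \<alpha>) else inj f \<alpha> (Inl (Some \<beta>)))\<rparr>"

definition seq_colimit :: "('v \<Rightarrow> ('o, 'a, 'v) stage) \<Rightarrow> 'o \<times> ('v \<Rightarrow> 'a)" where
  "seq_colimit f = (SOME p. is_colimit (poset_cat (Field \<mu>) \<mu>) K (seq_functor f) (fst p) (snd p))"

abbreviation top :: "('v \<Rightarrow> ('o, 'a, 'v) stage) \<Rightarrow> 'o" where "top f \<equiv> fst (seq_colimit f)"
abbreviation into :: "('v \<Rightarrow> ('o, 'a, 'v) stage) \<Rightarrow> 'v \<Rightarrow> 'a" where "into f \<equiv> snd (seq_colimit f)"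

text \<open>Every stage receives a map from \<open>X0\<close>, so any stage can be used to define
  the composite; \<open>composite_eq\<close> shows independence of it.\<close>

definition start :: 'v where "start = (SOME \<alpha>. \<alpha> \<in> Field \<mu>)"

definition composite :: "('v \<Rightarrow> ('o, 'a, 'v) stage) \<Rightarrow> 'a" where
  "composite f = into f start \<cdot> inj f start (Inl None)"

lemma start: "start \<in> Field \<mu>"
proof -
  have "Field \<mu> \<noteq> {}" using \<mu>D(3) by auto
  then show ?thesis unfolding start_def by (simp add: some_in_eq)
qed

lemma below_iff: "\<beta> \<in> below \<alpha> \<longleftrightarrow> (\<beta>, \<alpha>) \<in> \<mu> \<and> \<beta> \<noteq> \<alpha>"
  unfolding below_def by auto

lemma partial_order: "partial_order_on (Field \<mu>) \<mu>"
  using \<mu>D(2) unfolding well_order_on_def linear_order_on_def by simp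

lemma seq_functor:
  assumes f: "seq f"
  shows "is_functor (poset_cat (Field \<mu>) \<mu>) K (seq_functor f)"
proof -
  note S = seqD[OF f]
  let ?A = "AMap (seq_functor f)"
  have id: "?A (\<alpha>, \<alpha>) = Ident K (obj f \<alpha>)" for \<alpha> unfolding seq_functor_def by simp
  have lt: "?A (\<beta>, \<alpha>) = inj f \<alpha> (Inl (Some \<beta>))" if "\<beta> \<in> below \<alpha>" for \<alpha> \<beta>
    using that unfolding seq_functor_def below_iff by auto
  have F: "\<beta> \<in> Field \<mu>" "\<alpha> \<in> Field \<mu>" if "(\<beta>, \<alpha>) \<in> \<mu>" for \<alpha> \<beta>
    using that unfolding Field_def by auto
  have hom: "?A (\<beta>, \<alpha>) \<in> Hom (obj f \<beta>) (obj f \<alpha>)" if "(\<beta>, \<alpha>) \<in> \<mu>" for \<alpha> \<beta>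
  proof (cases "\<beta> = \<alpha>")
    case True then show ?thesis using id Ident_hom[OF S(3)[OF F(2)[OF that]]] by simp
  next
    case False
    then have "\<beta> \<in> below \<alpha>" using that unfolding below_iff by simp
    then show ?thesis using lt S(5)[OF F(2)[OF that]] by simp
  qed
  have comp: "?A (\<gamma>, \<alpha>) = ?A (\<beta>, \<alpha>) \<cdot> ?A (\<gamma>, \<beta>)" if *: "(\<gamma>, \<beta>) \<in> \<mu>" "(\<beta>, \<alpha>) \<in> \<mu>" for \<alpha> \<beta> \<gamma>
  proof -
    consider "\<gamma> = \<beta>" | "\<beta> = \<alpha>" | "\<gamma> \<in> below \<beta>" "\<beta> \<in> below \<alpha>" using * unfolding below_iff by auto
    then show ?thesis
    proof cases
      case 1 then show ?thesis using comp_Ident(1)[OF hom[OF *(2)]] id by simp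
    next
      case 2 then show ?thesis using comp_Ident(2)[OF hom[OF *(1)]] id by simp
    next
      case 3
      then show ?thesis
        using S(8)[OF F(2)[OF *(2)] 3(2,1)] lt[OF 3(1)] lt[OF 3(2)] lt[OF below_trans[OF 3]] by simp
    qed
  qed
  show ?thesis
    unfolding is_functor_def
  proof (intro conjI ballI impI)
    show "OMap (seq_functor f) \<alpha> \<in> Obj K" if "\<alpha> \<in> Obj (poset_cat (Field \<mu>) \<mu>)" for \<alpha>
      using S(3)[of \<alpha>] that unfolding seq_functor_def poset_cat_def by simp
    show "?A (Ident (poset_cat (Field \<mu>) \<mu>) \<alpha>) = Ident K (OMap (seq_functor f) \<alpha>)" for \<alpha>
      using id unfolding poset_cat_def by (simp add: seq_functor_def)
  next
    fix u assume "u \<in> Arr (poset_cat (Field \<mu>) \<mu>)"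
    then show "?A u \<in> Hom (OMap (seq_functor f) (Dom (poset_cat (Field \<mu>) \<mu>) u))
        (OMap (seq_functor f) (Cod (poset_cat (Field \<mu>) \<mu>) u))"
      using hom[of "fst u" "snd u"] unfolding poset_cat_def by (simp add: seq_functor_def)
  next
    fix u v assume "u \<in> Arr (poset_cat (Field \<mu>) \<mu>)" "v \<in> Arr (poset_cat (Field \<mu>) \<mu>)"
      "Dom (poset_cat (Field \<mu>) \<mu>) v = Cod (poset_cat (Field \<mu>) \<mu>) u"
    then show "?A (v \<cdot>\<^bsub>poset_cat (Field \<mu>) \<mu>\<^esub> u) = ?A v \<cdot> ?A u"
      using comp[of "fst u" "snd u" "snd v"] unfolding poset_cat_def by (cases v) simp
  qed
qed

lemma seq_diagram: "seq f \<Longrightarrow> poset_diagram K (Field \<mu>) \<mu> (seq_functor f)"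
  by unfold_locales (simp_all add: partial_order seq_functor)

lemma seq_colimit:
  assumes f: "seq f"
  shows "is_colimit (poset_cat (Field \<mu>) \<mu>) K (seq_functor f) (top f) (into f)"
proof -
  interpret poset_diagram K "Field \<mu>" \<mu> "seq_functor f" by (rule seq_diagram[OF f])
  have "\<mu> \<subseteq> Field \<mu> \<times> Field \<mu>" unfolding Field_def by auto
  then have "small \<kappa> (Obj (poset_cat (Field \<mu>) \<mu>))" "small \<kappa> (Arr (poset_cat (Field \<mu>) \<mu>))"
    using small_Field small_subset[OF small_Sigma] unfolding poset_cat_def by auto
  then have "\<exists>p. is_colimit (poset_cat (Field \<mu>) \<mu>) K (seq_functor f) (fst p) (snd p)"
    using cocomplete_colimit[OF cocomplete category_poset] seq_functor[OF f] by simp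
  then show ?thesis unfolding seq_colimit_def by (rule someI_ex)
qed

lemma into:
  assumes f: "seq f" and \<alpha>: "\<alpha> \<in> Field \<mu>"
  shows "into f \<alpha> \<in> Hom (obj f \<alpha>) (top f)"
    and "\<beta> \<in> below \<alpha> \<Longrightarrow> into f \<alpha> \<cdot> inj f \<alpha> (Inl (Some \<beta>)) = into f \<beta>"
proof -
  interpret poset_diagram K "Field \<mu>" \<mu> "seq_functor f" by (rule seq_diagram[OF f])
  note D = colimitD[OF seq_colimit[OF f]]
  show "into f \<alpha> \<in> Hom (obj f \<alpha>) (top f)" using D(2)[OF \<alpha>] unfolding seq_functor_def by simp
  show "into f \<alpha> \<cdot> inj f \<alpha> (Inl (Some \<beta>)) = into f \<beta>" if "\<beta> \<in> below \<alpha>"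
    using D(3)[of \<beta> \<alpha>] that unfolding seq_functor_def below_iff by simp
qed

lemma composite_eq:
  assumes f: "seq f" and \<alpha>: "\<alpha> \<in> Field \<mu>"
  shows "into f \<alpha> \<cdot> inj f \<alpha> (Inl None) = composite f"
proof -
  note S = seqD[OF f]
  have *: "into f \<alpha> \<cdot> inj f \<alpha> (Inl None) = into f \<beta> \<cdot> inj f \<beta> (Inl None)"
    if "\<alpha> \<in> Field \<mu>" "\<beta> \<in> below \<alpha>" for \<alpha> \<beta>
    using assoc[OF into(1)[OF f that(1)] S(5)[OF that(1) that(2)] S(4)[OF below_Field[OF that(2)]]]
      S(7)[OF that(1) that(2)] into(2)[OF f that] by simp
  consider "\<alpha> = start" | "\<alpha> \<in> below start" | "start \<in> below \<alpha>"
    using \<alpha> start \<mu>D(10) unfolding below_iff total_on_def by blast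
  then show ?thesis using *[OF start] *[OF \<alpha>] unfolding composite_def by cases simp_all
qed

lemma composite_hom: "seq f \<Longrightarrow> composite f \<in> Hom X0 (top f)"
  unfolding composite_def using comp_hom[OF into(1)[OF _ start] seqD(4)[OF _ start]] .

lemma seq_induced:
  assumes f: "seq f" and q: "\<And>\<alpha>. \<alpha> \<in> Field \<mu> \<Longrightarrow> q \<alpha> \<in> Hom (obj f \<alpha>) Y"
    "\<And>\<alpha> \<beta>. \<alpha> \<in> Field \<mu> \<Longrightarrow> \<beta> \<in> below \<alpha> \<Longrightarrow> q \<alpha> \<cdot> inj f \<alpha> (Inl (Some \<beta>)) = q \<beta>"
  obtains h where "h \<in> Hom (top f) Y" "\<And>\<alpha>. \<alpha> \<in> Field \<mu> \<Longrightarrow> h \<cdot> into f \<alpha> = q \<alpha>"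
proof -
  interpret poset_diagram K "Field \<mu>" \<mu> "seq_functor f" by (rule seq_diagram[OF f])
  have "is_cocone (poset_cat (Field \<mu>) \<mu>) K (seq_functor f) Y q"
    unfolding cocone_iff
  proof (intro conjI ballI allI impI)
    show "Y \<in> Obj K" using homD(5)[OF q(1)[OF start]] .
    show "q \<alpha> \<in> Hom (OMap (seq_functor f) \<alpha>) Y" if "\<alpha> \<in> Field \<mu>" for \<alpha>
      using q(1)[OF that] unfolding seq_functor_def by simp
    fix \<beta> \<alpha> assume *: "(\<beta>, \<alpha>) \<in> \<mu>"
    then have \<alpha>: "\<alpha> \<in> Field \<mu>" unfolding Field_def by auto
    show "q \<alpha> \<cdot> AMap (seq_functor f) (\<beta>, \<alpha>) = q \<beta>"
      using q(2)[OF \<alpha>, of \<beta>] comp_Ident(1)[OF q(1)[OF \<alpha>]] * unfolding seq_functor_def below_iff by auto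
  qed
  then have "\<exists>!h. h \<in> Hom (top f) Y \<and> (\<forall>\<alpha>\<in>Obj (poset_cat (Field \<mu>) \<mu>). h \<cdot> into f \<alpha> = q \<alpha>)"
    using seq_colimit[OF f] unfolding is_colimit_def by blast
  then obtain h where "h \<in> Hom (top f) Y" "\<forall>\<alpha>\<in>Obj (poset_cat (Field \<mu>) \<mu>). h \<cdot> into f \<alpha> = q \<alpha>" by blast
  then show thesis using that unfolding poset_cat_def by simp
qed

lemma seq_unique:
  assumes f: "seq f" and h: "h \<in> Hom (top f) Y" "h' \<in> Hom (top f) Y"
    and eq: "\<And>\<alpha>. \<alpha> \<in> Field \<mu> \<Longrightarrow> h \<cdot> into f \<alpha> = h' \<cdot> into f \<alpha>"
  shows "h = h'"
proof -
  interpret poset_diagram K "Field \<mu>" \<mu> "seq_functor f" by (rule seq_diagram[OF f])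
  show ?thesis
    by (rule colimit_unique[OF seq_colimit[OF f] category_poset seq_functor[OF f] h])
      (simp add: poset_cat_def eq)
qed

text \<open>The lift is built stage by stage: lifts on the earlier stages and lifts of the attached
  maps \<open>m\<close> against \<open>p\<close> induce a lift on the next one. These lifts form a
  cocone on the sequence, which gives the diagonal on its colimit.\<close>

lemma composite_lifts:
  assumes f: "seq f" and p: "p \<in> inj_maps K M"
  shows "lifts K (composite f) p"
  unfolding lifts_def
proof (intro ballI impI)
  note S = seqD[OF f]
  note I = into[OF f]
  fix x y
  assume "x \<in> Hom (Dom K (composite f)) (Dom K p)" "y \<in> Hom (Cod K (composite f)) (Cod K p)"
  then have x: "x \<in> Hom X0 (Dom K p)" and y: "y \<in> Hom (top f) (Cod K p)"
    using homD(2,3)[OF composite_hom[OF f]] by simp_all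
  assume xy: "p \<cdot> x = y \<cdot> composite f"
  have p': "p \<in> Hom (Dom K p) (Cod K p)" "\<And>m. m \<in> M \<Longrightarrow> lifts K m p"
    using p Arr_hom unfolding inj_maps_def by simp_all
  define P where "P = (\<lambda>h \<alpha> r. \<alpha> \<in> Field \<mu> \<longrightarrow> r \<in> Hom (obj f \<alpha>) (Dom K p) \<and>
    p \<cdot> r = y \<cdot> into f \<alpha> \<and> r \<cdot> inj f \<alpha> (Inl None) = x \<and>
    (\<forall>\<beta>\<in>below \<alpha>. r \<cdot> inj f \<alpha> (Inl (Some \<beta>)) = h \<beta>))"
  have "\<exists>h. \<forall>\<alpha>. P h \<alpha> (h \<alpha>)"
  proof (rule dependent_wf_choice[OF \<mu>D(6)])
    show "P h \<alpha> r = P h' \<alpha> r" if "\<And>\<beta>. (\<beta>, \<alpha>) \<in> \<mu> - Id \<Longrightarrow> h \<beta> = h' \<beta>" for h h' \<alpha> r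
      using that unfolding P_def below_def by simp
    fix \<alpha> and h :: "'v \<Rightarrow> 'a" assume IH: "\<And>\<beta>. (\<beta>, \<alpha>) \<in> \<mu> - Id \<Longrightarrow> P h \<beta> (h \<beta>)"
    show "\<exists>r. P h \<alpha> r"
    proof (cases "\<alpha> \<in> Field \<mu>")
      case False then show ?thesis unfolding P_def by simp
    next
      case \<alpha>: True
      have h: "h \<beta> \<in> Hom (obj f \<beta>) (Dom K p)" "p \<cdot> h \<beta> = y \<cdot> into f \<beta>"
        "h \<beta> \<cdot> inj f \<beta> (Inl None) = x" "\<And>\<gamma>. \<gamma> \<in> below \<beta> \<Longrightarrow> h \<beta> \<cdot> inj f \<beta> (Inl (Some \<gamma>)) = h \<gamma>"
        if "\<beta> \<in> below \<alpha>" for \<beta>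
        using IH[of \<beta>] that below_Field[OF that] unfolding P_def below_def by auto
      \<comment> \<open>The lifting problem for a cell has as lower edge the restriction of
        \<open>y\<close> to the copy of that cell in stage \<open>\<alpha>\<close>; the solution may
        therefore vary with \<open>\<alpha>\<close>.\<close>
      have v: "\<exists>v. v \<in> Hom (Cod K m) (Dom K p) \<and> v \<cdot> m = h \<beta> \<cdot> u \<and>
          p \<cdot> v = y \<cdot> into f \<alpha> \<cdot> inj f \<alpha> (Inr (\<beta>, u, m, w))"
        if \<beta>: "\<beta> \<in> below \<alpha>" and c: "(u, m, w) \<in> cells f \<beta>" for \<beta> u m w
      proof -
        let ?i = "inj f \<alpha> (Inr (\<beta>, u, m, w))"
        have m: "m \<in> M" "u \<in> Hom (Dom K m) (obj f \<beta>)" "m \<in> Hom (Dom K m) (Cod K m)"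
          using S(10)[OF below_Field[OF \<beta>] c] M Arr_hom by auto
        have i: "?i \<in> Hom (Cod K m) (obj f \<alpha>)" using S(6)[OF \<alpha> \<beta> c] by simp
        have yi: "y \<cdot> into f \<alpha> \<cdot> ?i \<in> Hom (Cod K m) (Cod K p)"
          by (rule comp_hom[OF y comp_hom[OF I(1)[OF \<alpha>] i]])
        have hu: "h \<beta> \<cdot> u \<in> Hom (Dom K m) (Dom K p)" by (rule comp_hom[OF h(1)[OF \<beta>] m(2)])
        have "(y \<cdot> into f \<alpha> \<cdot> ?i) \<cdot> m = y \<cdot> into f \<alpha> \<cdot> ?i \<cdot> m"
          using assoc[OF y comp_hom[OF I(1)[OF \<alpha>] i] m(3)] assoc[OF I(1)[OF \<alpha>] i m(3)] by simp
        also have "\<dots> = y \<cdot> into f \<alpha> \<cdot> inj f \<alpha> (Inl (Some \<beta>)) \<cdot> u" using S(9)[OF \<alpha> \<beta> c] by simp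
        also have "\<dots> = y \<cdot> into f \<beta> \<cdot> u"
          using assoc[OF I(1)[OF \<alpha>] S(5)[OF \<alpha> \<beta>] m(2)] I(2)[OF \<alpha> \<beta>] by simp
        also have "\<dots> = p \<cdot> h \<beta> \<cdot> u"
          using assoc[OF y I(1)[OF below_Field[OF \<beta>]] m(2)] assoc[OF p'(1) h(1)[OF \<beta>] m(2)] h(2)[OF \<beta>] by simp
        finally have "p \<cdot> h \<beta> \<cdot> u = (y \<cdot> into f \<alpha> \<cdot> ?i) \<cdot> m" by (rule sym)
        from p'(2)[OF m(1), unfolded lifts_def, rule_format, OF hu yi this] show ?thesis by blast
      qed
      have opt: "f \<beta> \<in> choices \<beta> f" if "\<beta> \<in> below \<alpha>" for \<beta> using seq_choices[OF f below_Field[OF that]] .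
      note col = S(2)[OF \<alpha>]
      obtain r where r: "r \<in> Hom (obj f \<alpha>) (Dom K p)" "r \<cdot> inj f \<alpha> (Inl None) = x"
        "\<And>\<beta>. \<beta> \<in> below \<alpha> \<Longrightarrow> r \<cdot> inj f \<alpha> (Inl (Some \<beta>)) = h \<beta>"
        "\<And>\<beta> u m w. \<beta> \<in> below \<alpha> \<Longrightarrow> (u, m, w) \<in> cells f \<beta> \<Longrightarrow>
          p \<cdot> r \<cdot> inj f \<alpha> (Inr (\<beta>, u, m, w)) = y \<cdot> into f \<alpha> \<cdot> inj f \<alpha> (Inr (\<beta>, u, m, w))"
        by (rule stage_induced[OF opt col x h(1,3,4) v]) (assumption+, rule that)
      \<comment> \<open>The two maps are compared on all generators of the stage. On the cells they
        agree because each extension was taken to be a lift over \<open>y\<close>.\<close>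
      have "p \<cdot> r = y \<cdot> into f \<alpha>"
      proof (rule rel_colimit_unique[OF col comp_hom[OF p'(1) r(1)] comp_hom[OF y I(1)[OF \<alpha>]] S(1)[OF \<alpha>]])
        fix j assume "j \<in> nodes f \<alpha>"
        then consider "j = Inl None" | \<beta> where "\<beta> \<in> below \<alpha>" "j = Inl (Some \<beta>)"
          | \<beta> u m w where "\<beta> \<in> below \<alpha>" "(u, m, w) \<in> cells f \<beta>" "j = Inr (\<beta>, u, m, w)"
          unfolding nodes_def stages_def by auto
        then have "p \<cdot> r \<cdot> inj f \<alpha> j = y \<cdot> into f \<alpha> \<cdot> inj f \<alpha> j"
        proof cases
          case 1 then show ?thesis using r(2) xy composite_eq[OF f \<alpha>] by simp
        next
          case 2 then show ?thesis using r(3) h(2) I(2)[OF \<alpha>] by simp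
        next
          case 3 then show ?thesis using r(4) by simp
        qed
        moreover have j: "inj f \<alpha> j \<in> Hom (node_obj f j) (obj f \<alpha>)"
          using rel_coconeD(2)[OF rel_colimitD(1)[OF col]] \<open>j \<in> nodes f \<alpha>\<close> by simp
        ultimately show "(p \<cdot> r) \<cdot> inj f \<alpha> j = (y \<cdot> into f \<alpha>) \<cdot> inj f \<alpha> j"
          using assoc[OF p'(1) r(1) j] assoc[OF y I(1)[OF \<alpha>] j] by simp
      qed
      then show ?thesis using r(1-3) unfolding P_def by blast
    qed
  qed
  then obtain h where P: "\<And>\<alpha>. P h \<alpha> (h \<alpha>)" by blast
  have h: "h \<alpha> \<in> Hom (obj f \<alpha>) (Dom K p)" "p \<cdot> h \<alpha> = y \<cdot> into f \<alpha>" "h \<alpha> \<cdot> inj f \<alpha> (Inl None) = x"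
    "\<And>\<beta>. \<beta> \<in> below \<alpha> \<Longrightarrow> h \<alpha> \<cdot> inj f \<alpha> (Inl (Some \<beta>)) = h \<beta>" if "\<alpha> \<in> Field \<mu>" for \<alpha>
    using P[of \<alpha>] that unfolding P_def by simp_all
  obtain k where k: "k \<in> Hom (top f) (Dom K p)" "\<And>\<alpha>. \<alpha> \<in> Field \<mu> \<Longrightarrow> k \<cdot> into f \<alpha> = h \<alpha>"
    by (rule seq_induced[OF f h(1,4)]) (assumption+, rule that)
  have "k \<cdot> composite f = x"
    using assoc[OF k(1) I(1)[OF start] S(4)[OF start]] k(2)[OF start] h(3)[OF start]
    unfolding composite_def by simp
  moreover have "p \<cdot> k = y"
  proof (rule seq_unique[OF f comp_hom[OF p'(1) k(1)] y])
    fix \<alpha> assume \<alpha>: "\<alpha> \<in> Field \<mu>"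
    show "(p \<cdot> k) \<cdot> into f \<alpha> = y \<cdot> into f \<alpha>"
      using assoc[OF p'(1) k(1) I(1)[OF \<alpha>]] k(2)[OF \<alpha>] h(2)[OF \<alpha>] by simp
  qed
  ultimately show "\<exists>h\<in>Hom (Cod K (composite f)) (Dom K p). h \<cdot> composite f = x \<and> p \<cdot> h = y"
    using k(1) unfolding homD(3)[OF composite_hom[OF f]] by (intro bexI conjI)
qed

lemma composite_cof: "seq f \<Longrightarrow> composite f \<in> cof_maps K M"
  using composite_lifts homD(1)[OF composite_hom] unfolding cof_maps_def by blast

text \<open>Sequences are the branches of a tree whose successor sets
  \<open>choices \<alpha> f\<close> are small, since only the set of cells is free. The condition
  \<open>f = restrict f (Field \<mu>)\<close> discards the arbitrary values outside the index
  set.\<close>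

lemma small_composites: "small \<kappa> {composite f | f. seq f \<and> f = restrict f (Field \<mu>)}"
proof -
  have "small \<kappa> {restrict f (Field \<mu>) | f. \<forall>\<alpha>\<in>Field \<mu>. f \<alpha> \<in> choices \<alpha> f}"
    by (rule small_paths[OF small_Field \<mu>D(6)])
      (auto simp: below_iff Field_def intro!: choices_cong small_choices)
  from small_image[OF this, of composite] show ?thesis
    by (rule small_subset) (auto simp: seq_def)
qed

text \<open>The sequence and its maps to \<open>Y\<close> are constructed by a simultaneous
  recursion, in which a cell is attached exactly if an extension to \<open>Y\<close> acceptable for
  its label exists. By chain-smallness a map \<open>u\<close> to the colimit comes from some stage,
  and the cell attached there provides the required extension of \<open>u\<close>.\<close>

lemma seq_over_ex:
  assumes f0: "f0 \<in> Hom X0 Y"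
  obtains f q where "seq f" "f = restrict f (Field \<mu>)" "q \<in> Hom (top f) Y" "q \<cdot> composite f = f0"
    "\<forall>m\<in>M. \<forall>w\<in>W. \<forall>u\<in>Hom (Dom K m) (top f). \<forall>v\<in>Hom (Cod K m) Y.
      chain_small \<mu> K (Dom K m) \<longrightarrow> v \<cdot> m = q \<cdot> u \<longrightarrow> ok w v \<longrightarrow>
      (\<exists>h\<in>Hom (Cod K m) (top f). h \<cdot> m = u \<and> ok w (q \<cdot> h))"
proof -
  \<comment> \<open>The cells over \<open>Y\<close>: besides \<open>(u, m, w)\<close> itself only
    the existence of \<open>v\<close> is recorded, so \<open>Y\<close> merely selects a subset of
    \<open>all_cells Z\<close>.\<close>
  define sel where "sel Z q = {(u, m, w) \<in> all_cells Z. \<exists>v\<in>Hom (Cod K m) Y. v \<cdot> m = q \<cdot> u \<and> ok w v}" for Z q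
  \<comment> \<open>A value of the recursion is a stage together with its map to \<open>Y\<close>.
    The default pair outside \<open>Field \<mu>\<close> makes the resulting sequence equal to its
    restriction.\<close>
  define P where "P = (\<lambda>(g :: 'v \<Rightarrow> ('o, 'a, 'v) stage \<times> 'a) \<alpha> r.
    if \<alpha> \<in> Field \<mu> then fst r \<in> choices \<alpha> (fst \<circ> g) \<and> snd (snd (fst r)) = sel (fst (fst r)) (snd r) \<and>
      snd r \<in> Hom (fst (fst r)) Y \<and> snd r \<cdot> fst (snd (fst r)) (Inl None) = f0 \<and>
      (\<forall>\<beta>\<in>below \<alpha>. snd r \<cdot> fst (snd (fst r)) (Inl (Some \<beta>)) = snd (g \<beta>)) \<and>
      (\<forall>\<beta>\<in>below \<alpha>. \<forall>(u, m, w)\<in>cells (fst \<circ> g) \<beta>. ok w (snd r \<cdot> fst (snd (fst r)) (Inr (\<beta>, u, m, w))))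
    else r = (undefined, undefined))"
  have "\<exists>g. \<forall>\<alpha>. P g \<alpha> (g \<alpha>)"
  proof (rule dependent_wf_choice[OF \<mu>D(6)])
    show "P g \<alpha> r = P g' \<alpha> r" if *: "\<And>\<beta>. (\<beta>, \<alpha>) \<in> \<mu> - Id \<Longrightarrow> g \<beta> = g' \<beta>" for g g' \<alpha> r
    proof -
      have g: "g \<beta> = g' \<beta>" if "\<beta> \<in> below \<alpha>" for \<beta> using * that unfolding below_def by simp
      then have "choices \<alpha> (fst \<circ> g) = choices \<alpha> (fst \<circ> g')" by (intro choices_cong) simp
      then show ?thesis using g unfolding P_def by (simp cong: ball_cong)
    qed
    fix \<alpha> and g :: "'v \<Rightarrow> ('o, 'a, 'v) stage \<times> 'a"
    assume IH: "\<And>\<beta>. (\<beta>, \<alpha>) \<in> \<mu> - Id \<Longrightarrow> P g \<beta> (g \<beta>)"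
    show "\<exists>r. P g \<alpha> r"
    proof (cases "\<alpha> \<in> Field \<mu>")
      case False then show ?thesis unfolding P_def by simp
    next
      case \<alpha>: True
      let ?f = "fst \<circ> g" and ?q = "snd \<circ> g"
      have g: "?f \<beta> \<in> choices \<beta> ?f" "cells ?f \<beta> = sel (obj ?f \<beta>) (?q \<beta>)" "?q \<beta> \<in> Hom (obj ?f \<beta>) Y"
        "?q \<beta> \<cdot> inj ?f \<beta> (Inl None) = f0"
        "\<And>\<gamma>. \<gamma> \<in> below \<beta> \<Longrightarrow> ?q \<beta> \<cdot> inj ?f \<beta> (Inl (Some \<gamma>)) = ?q \<gamma>" if "\<beta> \<in> below \<alpha>" for \<beta>
      proof -
        have "P g \<beta> (g \<beta>)" "\<beta> \<in> Field \<mu>" using IH[of \<beta>] that below_Field[OF that] unfolding below_def by simp_all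
        then show "?f \<beta> \<in> choices \<beta> ?f" "cells ?f \<beta> = sel (obj ?f \<beta>) (?q \<beta>)" "?q \<beta> \<in> Hom (obj ?f \<beta>) Y"
          "?q \<beta> \<cdot> inj ?f \<beta> (Inl None) = f0"
          "\<And>\<gamma>. \<gamma> \<in> below \<beta> \<Longrightarrow> ?q \<beta> \<cdot> inj ?f \<beta> (Inl (Some \<gamma>)) = ?q \<gamma>" unfolding P_def by simp_all
      qed
      have v: "\<exists>v. v \<in> Hom (Cod K m) Y \<and> v \<cdot> m = ?q \<beta> \<cdot> u \<and> ok w v"
        if "\<beta> \<in> below \<alpha>" "(u, m, w) \<in> cells ?f \<beta>" for \<beta> u m w
        using that(2) unfolding g(2)[OF that(1)] sel_def by blast
      let ?Z = "fst (next_stage ?f \<alpha>)" and ?c = "snd (next_stage ?f \<alpha>)"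
      have col: "stage_colimit ?f \<alpha> ?Z ?c" using stage_colimit_ex[OF g(1)] by blast
      obtain q where q: "q \<in> Hom ?Z Y" "q \<cdot> ?c (Inl None) = f0"
        "\<And>\<beta>. \<beta> \<in> below \<alpha> \<Longrightarrow> q \<cdot> ?c (Inl (Some \<beta>)) = ?q \<beta>"
        "\<And>\<beta> u m w. \<beta> \<in> below \<alpha> \<Longrightarrow> (u, m, w) \<in> cells ?f \<beta> \<Longrightarrow> ok w (q \<cdot> ?c (Inr (\<beta>, u, m, w)))"
        by (rule stage_induced[OF g(1) col f0 g(3,4,5) v]) (assumption+, rule that)
      have "P g \<alpha> ((?Z, ?c, sel ?Z q), q)"
        using \<alpha> q unfolding P_def by (auto simp: choices_def sel_def)
      then show ?thesis by blast
    qed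
  qed
  then obtain g where P: "\<And>\<alpha>. P g \<alpha> (g \<alpha>)" by blast
  let ?f = "fst \<circ> g" and ?q = "snd \<circ> g"
  have g: "?f \<alpha> \<in> choices \<alpha> ?f" "cells ?f \<alpha> = sel (obj ?f \<alpha>) (?q \<alpha>)" "?q \<alpha> \<in> Hom (obj ?f \<alpha>) Y"
    "?q \<alpha> \<cdot> inj ?f \<alpha> (Inl None) = f0"
    "\<And>\<beta>. \<beta> \<in> below \<alpha> \<Longrightarrow> ?q \<alpha> \<cdot> inj ?f \<alpha> (Inl (Some \<beta>)) = ?q \<beta>"
    "\<And>\<beta> u m w. \<beta> \<in> below \<alpha> \<Longrightarrow> (u, m, w) \<in> cells ?f \<beta> \<Longrightarrow> ok w (?q \<alpha> \<cdot> inj ?f \<alpha> (Inr (\<beta>, u, m, w)))"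
    if "\<alpha> \<in> Field \<mu>" for \<alpha>
  proof -
    note * = P[of \<alpha>, unfolded P_def if_P[OF that]]
    show "?f \<alpha> \<in> choices \<alpha> ?f" "cells ?f \<alpha> = sel (obj ?f \<alpha>) (?q \<alpha>)" "?q \<alpha> \<in> Hom (obj ?f \<alpha>) Y"
      "?q \<alpha> \<cdot> inj ?f \<alpha> (Inl None) = f0"
      "\<And>\<beta>. \<beta> \<in> below \<alpha> \<Longrightarrow> ?q \<alpha> \<cdot> inj ?f \<alpha> (Inl (Some \<beta>)) = ?q \<beta>" using * by simp_all
    show "ok w (?q \<alpha> \<cdot> inj ?f \<alpha> (Inr (\<beta>, u, m, w)))" if "\<beta> \<in> below \<alpha>" "(u, m, w) \<in> cells ?f \<beta>" for \<beta> u m w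
      using * that by fastforce
  qed
  have f: "seq ?f" using g(1) unfolding seq_def by blast
  note S = seqD[OF f]
  note I = into[OF f]
  have ext: "?f = restrict ?f (Field \<mu>)"
  proof
    fix \<alpha> show "?f \<alpha> = restrict ?f (Field \<mu>) \<alpha>"
      using P[of \<alpha>] unfolding P_def by (cases "\<alpha> \<in> Field \<mu>") simp_all
  qed
  obtain q where q: "q \<in> Hom (top ?f) Y" "\<And>\<alpha>. \<alpha> \<in> Field \<mu> \<Longrightarrow> q \<cdot> into ?f \<alpha> = ?q \<alpha>"
    using seq_induced[where q = ?q, OF f g(3,5)] by blast
  have qf: "q \<cdot> composite ?f = f0"
    using assoc[OF q(1) I(1)[OF start] S(4)[OF start]] q(2)[OF start] g(4)[OF start]
    unfolding composite_def by simp
  have lift: "\<exists>h\<in>Hom (Cod K m) (top ?f). h \<cdot> m = u \<and> ok w (q \<cdot> h)"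
    if m: "m \<in> M" "w \<in> W" "chain_small \<mu> K (Dom K m)" and u: "u \<in> Hom (Dom K m) (top ?f)"
      and v: "v \<in> Hom (Cod K m) Y" "v \<cdot> m = q \<cdot> u" "ok w v" for m w u v
  proof -
    have "\<exists>\<alpha>\<in>Field \<mu>. \<exists>u'\<in>Hom (Dom K m) (OMap (seq_functor ?f) \<alpha>). into ?f \<alpha> \<cdot> u' = u"
      using m(3) u seq_functor[OF f] seq_colimit[OF f] unfolding chain_small_def by blast
    then obtain \<alpha> u' where \<alpha>: "\<alpha> \<in> Field \<mu>" and u': "u' \<in> Hom (Dom K m) (obj ?f \<alpha>)" "into ?f \<alpha> \<cdot> u' = u"
      unfolding seq_functor_def cfunctor.select_convs by blast
    \<comment> \<open>A strictly later stage is needed, as the cells of stage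
      \<open>\<alpha>\<close> are attached only after it. It exists because infinite cardinals are
      limit ordinals.\<close>
    obtain \<beta> where \<beta>: "\<beta> \<in> Field \<mu>" "\<alpha> \<in> below \<beta>"
      using regular_cardinal_limit[OF \<mu> \<alpha>] unfolding below_def by blast
    have "?q \<alpha> \<cdot> u' = q \<cdot> u" using assoc[OF q(1) I(1)[OF \<alpha>] u'(1)] q(2)[OF \<alpha>] u'(2) by simp
    then have c: "(u', m, w) \<in> cells ?f \<alpha>"
      unfolding g(2)[OF \<alpha>] sel_def all_cells_def using m u'(1) v by auto
    let ?i = "inj ?f \<beta> (Inr (\<alpha>, u', m, w))"
    have i: "?i \<in> Hom (Cod K m) (obj ?f \<beta>)" using S(6)[OF \<beta>(1) \<beta>(2) c] by simp
    have mh: "m \<in> Hom (Dom K m) (Cod K m)" using m(1) M Arr_hom by blast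
    have "(into ?f \<beta> \<cdot> ?i) \<cdot> m = into ?f \<beta> \<cdot> inj ?f \<beta> (Inl (Some \<alpha>)) \<cdot> u'"
      using assoc[OF I(1)[OF \<beta>(1)] i mh] S(9)[OF \<beta>(1) \<beta>(2) c] by simp
    also have "\<dots> = u"
      using assoc[OF I(1)[OF \<beta>(1)] S(5)[OF \<beta>(1) \<beta>(2)] u'(1)] I(2)[OF \<beta>] u'(2) by simp
    finally have "(into ?f \<beta> \<cdot> ?i) \<cdot> m = u" .
    moreover have "ok w (q \<cdot> into ?f \<beta> \<cdot> ?i)"
      using g(6)[OF \<beta> c] assoc[OF q(1) I(1)[OF \<beta>(1)] i] q(2)[OF \<beta>(1)] by simp
    ultimately show ?thesis by (intro bexI[OF _ comp_hom[OF I(1)[OF \<beta>(1)] i]] conjI)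
  qed
  show thesis by (rule that[OF f ext q(1) qf]) (intro ballI impI lift)
qed

end

section \<open>Cofibrations between objects of the class\<close>

lemma locally_presentableD:
  assumes "locally_presentable \<kappa> K"
  shows "category K" "locally_small \<kappa> K" "cocomplete \<kappa> K"
  using assms unfolding locally_presentable_def locally_l_presentable_def by blast+

lemma liftsE:
  assumes "lifts C i p" "u \<in> hom C (Dom C i) (Dom C p)" "v \<in> hom C (Cod C i) (Cod C p)"
    "p \<cdot>\<^bsub>C\<^esub> u = v \<cdot>\<^bsub>C\<^esub> i"
  obtains h where "h \<in> hom C (Cod C i) (Dom C p)" "h \<cdot>\<^bsub>C\<^esub> i = u" "p \<cdot>\<^bsub>C\<^esub> h = v"
  using assms unfolding lifts_def by blast

lemma lifts_full_subcat:
  assumes "i \<in> Arr (full_subcat K A)" "p \<in> Arr (full_subcat K A)"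
  shows "lifts (full_subcat K A) i p \<longleftrightarrow> lifts K i p"
proof -
  have "hom (full_subcat K A) X Y = hom K X Y" if "X \<in> A" "Y \<in> A" for X Y
    using that unfolding hom_def full_subcat_def by auto
  then show ?thesis using assms unfolding lifts_def by (simp add: full_subcat_def)
qed

text \<open>A square from \<open>m\<close> to the right-hand factor with lower edge \<open>v\<close>
  is turned into a cell with label \<open>v\<close>. Taking \<open>ok\<close> to be equality forces
  the attached copy of the codomain of \<open>m\<close> to lie over \<open>Y\<close> by
  \<open>v\<close> itself, so both triangles of the lifting problem commute.\<close>

lemma (in universe) small_object_argument:
  assumes K: "locally_presentable \<kappa> K" and M: "M \<subseteq> Arr K" "small \<kappa> M" and f: "f \<in> hom K X Y"
  shows "\<exists>Z c p. c \<in> hom K X Z \<and> p \<in> hom K Z Y \<and> p \<cdot>\<^bsub>K\<^esub> c = f \<and> c \<in> cof_maps K M \<and> p \<in> inj_maps K M"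
proof -
  note KD = locally_presentableD[OF K]
  interpret cat K using KD(1) by unfold_locales
  have "Dom K ` M \<subseteq> Obj K" using M(1) Arr_Obj(1) by blast
  then obtain \<mu> :: "'v rel" where reg: "regular_cardinal \<mu>" "\<mu> <o \<kappa>"
    "\<And>B. B \<in> Dom K ` M \<Longrightarrow> chain_small \<mu> K B"
    using chain_small_ex[OF K _ small_image[OF M(2)]] by metis
  define W where "W = (\<Union>m\<in>M. Hom (Cod K m) Y)"
  have "small \<kappa> W"
    unfolding W_def using KD(2) homD(5)[OF f] M(1) Arr_Obj(2)
    by (intro small_UN M(2)) (auto simp: locally_small_def)
  then interpret cell_sequence \<kappa> K \<mu> M W X
    using KD reg M homD(4)[OF f] by unfold_locales auto
  obtain g q where g: "seq g" "q \<in> Hom (top g) Y" "q \<cdot>\<^bsub>K\<^esub> composite g = f"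
    "\<forall>m\<in>M. \<forall>w\<in>W. \<forall>u\<in>Hom (Dom K m) (top g). \<forall>v\<in>Hom (Cod K m) Y.
      chain_small \<mu> K (Dom K m) \<longrightarrow> v \<cdot>\<^bsub>K\<^esub> m = q \<cdot>\<^bsub>K\<^esub> u \<longrightarrow> w = v \<longrightarrow>
      (\<exists>h\<in>Hom (Cod K m) (top g). h \<cdot>\<^bsub>K\<^esub> m = u \<and> w = q \<cdot>\<^bsub>K\<^esub> h)"
    by (rule seq_over_ex[OF f, where ok = "(=)"])
  have "lifts K m q" if m: "m \<in> M" for m
    unfolding lifts_def
  proof (intro ballI impI)
    fix u v assume "u \<in> Hom (Dom K m) (Dom K q)" "v \<in> Hom (Cod K m) (Cod K q)"
    then have u: "u \<in> Hom (Dom K m) (top g)" and v: "v \<in> Hom (Cod K m) Y" using homD(2,3)[OF g(2)] by simp_all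
    assume qu: "q \<cdot>\<^bsub>K\<^esub> u = v \<cdot>\<^bsub>K\<^esub> m"
    have "v \<in> W" using v m unfolding W_def by blast
    from g(4)[rule_format, OF m this u v reg(3)[OF imageI[OF m]] qu[symmetric] refl]
    obtain h where "h \<in> Hom (Cod K m) (top g)" "h \<cdot>\<^bsub>K\<^esub> m = u" "v = q \<cdot>\<^bsub>K\<^esub> h" by blast
    then show "\<exists>h\<in>Hom (Cod K m) (Dom K q). h \<cdot>\<^bsub>K\<^esub> m = u \<and> q \<cdot>\<^bsub>K\<^esub> h = v"
      using homD(2)[OF g(2)] by auto
  qed
  then have "q \<in> inj_maps K M" using homD(1)[OF g(2)] unfolding inj_maps_def by blast
  then show ?thesis using g(2,3) composite_hom[OF g(1)] composite_cof[OF g(1)] by blast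
qed

text \<open>A map \<open>g : U \<rightarrow> X\<close> to an object of the class factors through the cell complex obtained from \<open>U\<close>
  by attaching, at each stage \<open>Z\<close> and for each \<open>b : B \<rightarrow> Z\<close>, one copy of each map \<open>a i\<close> of a cone on
  \<open>B\<close> along which \<open>B \<rightarrow> Z \<rightarrow> X\<close> extends. As only one cell is used for each pair \<open>(b, a i)\<close>, the number
  of these complexes is bounded independently of \<open>X\<close>.\<close>

lemma (in universe) solution_set:
  fixes Q :: "('o, 'a, 'v) cone set"
  assumes K: "locally_presentable \<kappa> K" and Q: "\<forall>q\<in>Q. is_cone \<kappa> K q" "small \<kappa> Q" and U: "U \<in> Obj K"
  shows "\<exists>S. small \<kappa> S \<and> S \<subseteq> {s \<in> Arr K. Dom K s = U \<and> Cod K s \<in> cone_injectivity_class K Q} \<and>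
    (\<forall>X\<in>cone_injectivity_class K Q. \<forall>g\<in>hom K U X. \<exists>s\<in>S. \<exists>h\<in>hom K (Cod K s) X. h \<cdot>\<^bsub>K\<^esub> s = g)"
proof -
  let ?A = "cone_injectivity_class K Q"
  note KD = locally_presentableD[OF K]
  interpret cat K using KD(1) by unfold_locales
  define M where "M = (\<Union>(B, I0, a)\<in>Q. a ` I0)"
  have cone: "a i \<in> M" "a i \<in> Arr K" "Dom K (a i) = B" if "(B, I0, a) \<in> Q" "i \<in> I0" for B I0 a i
    using Q(1) that unfolding M_def is_cone_def by fastforce+
  have M: "M \<subseteq> Arr K" using cone(2) unfolding M_def by blast
  have sM: "small \<kappa> M"
    unfolding M_def using Q by (intro small_UN) (auto simp: is_cone_def intro!: small_image)
  have "Dom K ` M \<subseteq> Obj K" using M Arr_Obj(1) by blast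
  then obtain \<mu> :: "'v rel" where reg: "regular_cardinal \<mu>" "\<mu> <o \<kappa>"
    "\<And>B. B \<in> Dom K ` M \<Longrightarrow> chain_small \<mu> K B"
    using chain_small_ex[OF K _ small_image[OF sM]] by metis
  \<comment> \<open>With a single label a cell is just a pair of an attaching map and a map of a
    cone, and the choices at a stage do not involve the target.\<close>
  interpret cell_sequence \<kappa> K \<mu> M "{undefined}" U
    using KD reg M sM U by unfold_locales (auto simp: small_finite)
  let ?S = "{s \<in> {composite f | f. seq f \<and> f = restrict f (Field \<mu>)}. Cod K s \<in> ?A}"
  have "small \<kappa> ?S" by (rule small_subset[OF small_composites]) blast
  moreover have "?S \<subseteq> {s \<in> Arr K. Dom K s = U \<and> Cod K s \<in> ?A}"
    using homD(1,2)[OF composite_hom] by auto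
  moreover have "\<exists>s\<in>?S. \<exists>h\<in>Hom (Cod K s) X. h \<cdot>\<^bsub>K\<^esub> s = g" if X: "X \<in> ?A" and g: "g \<in> Hom U X" for X g
  proof -
    obtain f q where f: "seq f" "f = restrict f (Field \<mu>)" "q \<in> Hom (top f) X" "q \<cdot>\<^bsub>K\<^esub> composite f = g"
      "\<forall>m\<in>M. \<forall>w\<in>{undefined :: 'a}. \<forall>u\<in>Hom (Dom K m) (top f). \<forall>v\<in>Hom (Cod K m) X.
        chain_small \<mu> K (Dom K m) \<longrightarrow> v \<cdot>\<^bsub>K\<^esub> m = q \<cdot>\<^bsub>K\<^esub> u \<longrightarrow> True \<longrightarrow>
        (\<exists>h\<in>Hom (Cod K m) (top f). h \<cdot>\<^bsub>K\<^esub> m = u \<and> True)"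
      by (rule seq_over_ex[OF g, where ok = "\<lambda>_ _. True"])
    \<comment> \<open>For \<open>b\<close> into the colimit, injectivity of \<open>X\<close> extends
      \<open>q \<cdot> b\<close> along some \<open>a i\<close>. This makes the pair of
      \<open>b\<close> and \<open>a i\<close> eligible for attachment, so \<open>b\<close> extends
      along the same \<open>a i\<close>.\<close>
    have "cone_injective K c (top f)" if c: "c \<in> Q" for c
    proof -
      obtain B I0 a where c': "c = (B, I0, a)" by (cases c)
      have "\<exists>i\<in>I0. \<exists>h\<in>Hom (Cod K (a i)) (top f). h \<cdot>\<^bsub>K\<^esub> a i = b" if b: "b \<in> Hom B (top f)" for b
      proof -
        have "cone_injective K (B, I0, a) X" using X c c' unfolding cone_injectivity_class_def by blast
        then obtain i v where i: "i \<in> I0" "v \<in> Hom (Cod K (a i)) X" "v \<cdot>\<^bsub>K\<^esub> a i = q \<cdot>\<^bsub>K\<^esub> b"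
          using comp_hom[OF f(3) b] unfolding cone_injective_def by blast
        note ai = cone[OF c[unfolded c'] i(1)]
        have "b \<in> Hom (Dom K (a i)) (top f)" using b ai(3) by simp
        from f(5)[rule_format, OF ai(1) singletonI this i(2) reg(3)[OF imageI[OF ai(1)]] i(3) TrueI]
        show ?thesis using i(1) by blast
      qed
      then show ?thesis unfolding c' cone_injective_def by blast
    qed
    then have "top f \<in> ?A" using homD(4)[OF f(3)] unfolding cone_injectivity_class_def by blast
    then have "composite f \<in> ?S" using f(1,2) homD(3)[OF composite_hom[OF f(1)]] by auto
    moreover have "q \<in> Hom (Cod K (composite f)) X" using f(3) homD(3)[OF composite_hom[OF f(1)]] by simp
    ultimately show ?thesis using f(4) by (intro bexI[of _ "composite f"] bexI[of _ q])
  qed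
  ultimately show ?thesis by blast
qed

lemma (in cat) cone_injectivity_class_inj_maps:
  assumes Q: "\<forall>(B, I0, a)\<in>Q. \<forall>i\<in>I0. a i \<in> cof_maps C I \<and> Dom C (a i) = B"
    and p: "p \<in> inj_maps C I" "p \<in> Hom Z Y" and Y: "Y \<in> cone_injectivity_class C Q"
  shows "Z \<in> cone_injectivity_class C Q"
proof -
  have "cone_injective C c Z" if c: "c \<in> Q" for c
  proof -
    obtain B I0 a where c': "c = (B, I0, a)" by (cases c)
    have "\<exists>i\<in>I0. \<exists>h\<in>Hom (Cod C (a i)) Z. h \<cdot> a i = b" if b: "b \<in> Hom B Z" for b
    proof -
      have "cone_injective C (B, I0, a) Y" using Y c c' unfolding cone_injectivity_class_def by blast
      then obtain i v where i: "i \<in> I0" "v \<in> Hom (Cod C (a i)) Y" "v \<cdot> a i = p \<cdot> b"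
        using comp_hom[OF p(2) b] unfolding cone_injective_def by blast
      have ai: "a i \<in> cof_maps C I" "Dom C (a i) = B" using Q c i(1) unfolding c' by auto
      have "lifts C (a i) p" using ai p(1) unfolding cof_maps_def by blast
      then obtain h where "h \<in> Hom (Cod C (a i)) Z" "h \<cdot> a i = b"
        by (rule liftsE[of _ _ _ b v]) (use ai b i homD(2,3)[OF p(2)] in auto)
      then show ?thesis using i(1) by blast
    qed
    then show ?thesis unfolding c' cone_injective_def by blast
  qed
  then show ?thesis using homD(4)[OF p(2)] unfolding cone_injectivity_class_def by blast
qed

lemma (in universe) pushout_ex:
  fixes C (structure)
  assumes C: "category C" "cocomplete \<kappa> C" and i: "i \<in> hom C U V" and s: "s \<in> hom C U X"
  shows "\<exists>P j k. j \<in> hom C X P \<and> k \<in> hom C V P \<and> j \<cdot> s = k \<cdot> i \<and>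
    (\<forall>Y x y. x \<in> hom C X Y \<longrightarrow> y \<in> hom C V Y \<longrightarrow> x \<cdot> s = y \<cdot> i \<longrightarrow>
      (\<exists>h\<in>hom C P Y. h \<cdot> j = x \<and> h \<cdot> k = y))"
proof -
  interpret cat C using C(1) by unfold_locales
  \<comment> \<open>The pushout has two generators, indexed by \<open>bool\<close>, and a single
    relation.\<close>
  let ?X = "\<lambda>b. if b then X else V" and ?R = "{(True, s, False, i)}"
  have "rel_data C UNIV ?X ?R"
    by (rule rel_dataI) (use i s homD(5)[OF i] homD(5)[OF s] in auto)
  then obtain P c where c: "rel_colimit C UNIV ?X ?R P c"
    using rel_colimit_ex[OF C small_finite small_finite] by (metis finite.emptyI finite_insert finite_UNIV)
  note D = rel_coconeD[OF rel_colimitD(1)[OF c]]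
  have "\<exists>h\<in>Hom P Y. h \<cdot> c True = x \<and> h \<cdot> c False = y"
    if "x \<in> Hom X Y" "y \<in> Hom V Y" "x \<cdot> s = y \<cdot> i" for Y x y
  proof -
    have "rel_cocone C UNIV ?X ?R Y (\<lambda>b. if b then x else y)"
      by (rule rel_coconeI) (use that homD(5)[OF that(1)] in auto)
    from rel_colimitD(2)[OF c this] obtain h where "h \<in> Hom P Y" "\<forall>b. h \<cdot> c b = (if b then x else y)" by auto
    then show ?thesis by (intro bexI[of _ h]) auto
  qed
  moreover have "c True \<in> Hom X P" "c False \<in> Hom V P" using D(2)[of True] D(2)[of False] by simp_all
  moreover have "c True \<cdot> s = c False \<cdot> i" using D(3)[of True s False i] by simp
  ultimately show ?thesis by blast
qed

theorem theoremA5: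
  fixes \<kappa> :: "'v rel"
    and K :: "('o, 'a) cat"
    and I :: "'a set"
    and Q :: "('o, 'a, 'v) cone set"
    and A :: "'o set"
  assumes "inaccessible \<kappa>"
    and "locally_presentable \<kappa> K"
    and "I \<subseteq> Arr K" and "small \<kappa> I"
    and "\<forall>q \<in> Q. is_cone \<kappa> K q" and "small \<kappa> Q"
    and "A = cone_injectivity_class K Q"
    and "coreflective K A"
    and "\<forall>(B, I0, a) \<in> Q. \<forall>i \<in> I0. a i \<in> cof_maps K I"
  shows "\<exists>J. J \<subseteq> Arr (full_subcat K A) \<and> small \<kappa> J \<and>
           cof_maps K I \<inter> Arr (full_subcat K A) = cof_maps (full_subcat K A) J"
proof -
  interpret universe \<kappa> by unfold_locales (rule assms(1))
  note KD = locally_presentableD[OF assms(2)]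
  interpret cat K using KD(1) by unfold_locales
  let ?A = "full_subcat K A"
  have ArrA: "f \<in> Arr ?A \<longleftrightarrow> f \<in> Arr K \<and> Dom K f \<in> A \<and> Cod K f \<in> A" for f
    unfolding full_subcat_def by simp
  have A_inj: "Z \<in> A" if p: "p \<in> inj_maps K I" "p \<in> Hom Z Y" and Y: "Y \<in> A" for p Z Y
  proof -
    have "\<forall>(B, I0, a)\<in>Q. \<forall>i\<in>I0. a i \<in> cof_maps K I \<and> Dom K (a i) = B"
    proof clarify
      fix B I0 a i assume *: "(B, I0, a) \<in> Q" "i \<in> I0"
      then have "is_cone \<kappa> K (B, I0, a)" using assms(5) by blast
      then show "a i \<in> cof_maps K I \<and> Dom K (a i) = B" using assms(9) * unfolding is_cone_def by auto
    qed
    from cone_injectivity_class_inj_maps[OF this p Y[unfolded assms(7)]] show ?thesis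
      unfolding assms(7) .
  qed

  have "\<forall>U. \<exists>S. U \<in> Obj K \<longrightarrow> small \<kappa> S \<and> S \<subseteq> {s \<in> Arr K. Dom K s = U \<and> Cod K s \<in> A} \<and>
      (\<forall>X\<in>A. \<forall>g\<in>Hom U X. \<exists>s\<in>S. \<exists>h\<in>Hom (Cod K s) X. h \<cdot>\<^bsub>K\<^esub> s = g)"
  proof
    fix U show "\<exists>S. U \<in> Obj K \<longrightarrow> small \<kappa> S \<and> S \<subseteq> {s \<in> Arr K. Dom K s = U \<and> Cod K s \<in> A} \<and>
      (\<forall>X\<in>A. \<forall>g\<in>Hom U X. \<exists>s\<in>S. \<exists>h\<in>Hom (Cod K s) X. h \<cdot>\<^bsub>K\<^esub> s = g)"
    proof (cases "U \<in> Obj K")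
      case True
      from solution_set[OF assms(2,5,6) this, folded assms(7)] True show ?thesis by simp
    qed blast
  qed
  from choice[OF this] obtain Sol where Sol': "\<forall>U. U \<in> Obj K \<longrightarrow> small \<kappa> (Sol U) \<and>
      Sol U \<subseteq> {s \<in> Arr K. Dom K s = U \<and> Cod K s \<in> A} \<and>
      (\<forall>X\<in>A. \<forall>g\<in>Hom U X. \<exists>s\<in>Sol U. \<exists>h\<in>Hom (Cod K s) X. h \<cdot>\<^bsub>K\<^esub> s = g)"
    by (rule exE)
  have Sol: "small \<kappa> (Sol U)" "Sol U \<subseteq> {s \<in> Arr K. Dom K s = U \<and> Cod K s \<in> A}"
    "\<And>X g. X \<in> A \<Longrightarrow> g \<in> Hom U X \<Longrightarrow> \<exists>s\<in>Sol U. \<exists>h\<in>Hom (Cod K s) X. h \<cdot>\<^bsub>K\<^esub> s = g"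
    if "U \<in> Obj K" for U
    using Sol'[rule_format, of U] that by simp_all
  have Sol_hom: "s \<in> Hom U (Cod K s)" "Cod K s \<in> A" if "U \<in> Obj K" "s \<in> Sol U" for U s
    using Sol(2) that unfolding hom_def by auto
  have "\<exists>Z c p. f \<in> Arr K \<longrightarrow> c \<in> Hom (Dom K f) Z \<and> p \<in> Hom Z (Cod K f) \<and> p \<cdot>\<^bsub>K\<^esub> c = f \<and>
      c \<in> cof_maps K I \<and> p \<in> inj_maps K I" for f
    using small_object_argument[OF assms(2,3,4) Arr_hom] by blast
  then obtain Z c p where fac': "\<And>f. f \<in> Arr K \<longrightarrow> c f \<in> Hom (Dom K f) (Z f) \<and>
      p f \<in> Hom (Z f) (Cod K f) \<and> p f \<cdot>\<^bsub>K\<^esub> c f = f \<and> c f \<in> cof_maps K I \<and> p f \<in> inj_maps K I"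
    by metis
  have fac: "c f \<in> Hom (Dom K f) (Z f)" "p f \<in> Hom (Z f) (Cod K f)" "p f \<cdot>\<^bsub>K\<^esub> c f = f"
    "c f \<in> cof_maps K I" "p f \<in> inj_maps K I" if "f \<in> Arr K" for f
    using fac'[of f] that by simp_all
  have "\<exists>P j k. i \<in> I \<and> s \<in> Sol (Dom K i) \<longrightarrow>
    j \<in> Hom (Cod K s) P \<and> k \<in> Hom (Cod K i) P \<and> j \<cdot>\<^bsub>K\<^esub> s = k \<cdot>\<^bsub>K\<^esub> i \<and>
      (\<forall>Y x y. x \<in> Hom (Cod K s) Y \<longrightarrow> y \<in> Hom (Cod K i) Y \<longrightarrow> x \<cdot>\<^bsub>K\<^esub> s = y \<cdot>\<^bsub>K\<^esub> i \<longrightarrow>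
        (\<exists>h\<in>Hom P Y. h \<cdot>\<^bsub>K\<^esub> j = x \<and> h \<cdot>\<^bsub>K\<^esub> k = y))" for i s
  proof (cases "i \<in> I \<and> s \<in> Sol (Dom K i)")
    case True
    then have "i \<in> Arr K" using assms(3) by blast
    from pushout_ex[OF KD(1,3) Arr_hom[OF this] Sol_hom(1)[OF Arr_Obj(1)[OF this]]] True
    show ?thesis by simp
  qed blast
  then obtain P j k where po': "\<And>i s. i \<in> I \<and> s \<in> Sol (Dom K i) \<longrightarrow>
    j i s \<in> Hom (Cod K s) (P i s) \<and> k i s \<in> Hom (Cod K i) (P i s) \<and> j i s \<cdot>\<^bsub>K\<^esub> s = k i s \<cdot>\<^bsub>K\<^esub> i \<and>
      (\<forall>Y x y. x \<in> Hom (Cod K s) Y \<longrightarrow> y \<in> Hom (Cod K i) Y \<longrightarrow> x \<cdot>\<^bsub>K\<^esub> s = y \<cdot>\<^bsub>K\<^esub> i \<longrightarrow>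
        (\<exists>h\<in>Hom (P i s) Y. h \<cdot>\<^bsub>K\<^esub> j i s = x \<and> h \<cdot>\<^bsub>K\<^esub> k i s = y))"
    by metis
  have po: "j i s \<in> Hom (Cod K s) (P i s)" "k i s \<in> Hom (Cod K i) (P i s)" "j i s \<cdot>\<^bsub>K\<^esub> s = k i s \<cdot>\<^bsub>K\<^esub> i"
    "\<And>Y x y. x \<in> Hom (Cod K s) Y \<Longrightarrow> y \<in> Hom (Cod K i) Y \<Longrightarrow> x \<cdot>\<^bsub>K\<^esub> s = y \<cdot>\<^bsub>K\<^esub> i \<Longrightarrow>
      \<exists>h\<in>Hom (P i s) Y. h \<cdot>\<^bsub>K\<^esub> j i s = x \<and> h \<cdot>\<^bsub>K\<^esub> k i s = y"
    if "i \<in> I" "s \<in> Sol (Dom K i)" for i s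
    using po'[of i s] that by simp_all

  \<comment> \<open>A map of \<open>J\<close> is given by \<open>i\<close> in \<open>I\<close>, a
    member \<open>s\<close> of the solution set of its domain, and a member \<open>t\<close> of the
    solution set of the pushout \<open>P i s\<close>. It is the left factor \<open>c\<close> of the
    composite of \<open>j i s\<close> and \<open>t\<close>; the iterated index set is small.\<close>
  define J where "J = (\<lambda>(i, s, t). c (t \<cdot>\<^bsub>K\<^esub> j i s)) ` (SIGMA i:I. SIGMA s:Sol (Dom K i). Sol (P i s))"
  have I: "i \<in> Hom (Dom K i) (Cod K i)" "Dom K i \<in> Obj K" if "i \<in> I" for i
    using that assms(3) Arr_hom Arr_Obj(1) by blast+
  have P_Obj: "P i s \<in> Obj K" if "i \<in> I" "s \<in> Sol (Dom K i)" for i s using homD(5)[OF po(1)[OF that]] .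
  have tj: "t \<cdot>\<^bsub>K\<^esub> j i s \<in> Hom (Cod K s) (Cod K t)" "t \<cdot>\<^bsub>K\<^esub> j i s \<in> Arr K"
    "c (t \<cdot>\<^bsub>K\<^esub> j i s) \<in> Hom (Cod K s) (Z (t \<cdot>\<^bsub>K\<^esub> j i s))"
    "p (t \<cdot>\<^bsub>K\<^esub> j i s) \<in> Hom (Z (t \<cdot>\<^bsub>K\<^esub> j i s)) (Cod K t)"
    "c (t \<cdot>\<^bsub>K\<^esub> j i s) \<in> Arr ?A"
    if *: "i \<in> I" "s \<in> Sol (Dom K i)" "t \<in> Sol (P i s)" for i s t
  proof -
    note t = Sol_hom[OF P_Obj[OF *(1,2)] *(3)]
    show 1: "t \<cdot>\<^bsub>K\<^esub> j i s \<in> Hom (Cod K s) (Cod K t)" using comp_hom[OF t(1) po(1)[OF *(1,2)]] .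
    show 2: "t \<cdot>\<^bsub>K\<^esub> j i s \<in> Arr K" using homD(1)[OF 1] .
    show 3: "c (t \<cdot>\<^bsub>K\<^esub> j i s) \<in> Hom (Cod K s) (Z (t \<cdot>\<^bsub>K\<^esub> j i s))" using fac(1)[OF 2] homD(2)[OF 1] by simp
    show 4: "p (t \<cdot>\<^bsub>K\<^esub> j i s) \<in> Hom (Z (t \<cdot>\<^bsub>K\<^esub> j i s)) (Cod K t)" using fac(2)[OF 2] homD(3)[OF 1] by simp
    show "c (t \<cdot>\<^bsub>K\<^esub> j i s) \<in> Arr ?A"
      unfolding ArrA using homD(1-3)[OF 3] A_inj[OF fac(5)[OF 2] 4 t(2)] Sol_hom(2)[OF I(2)[OF *(1)] *(2)] by simp
  qed
  have J: "J \<subseteq> Arr ?A" unfolding J_def using tj(5) by auto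
  have J_cof: "J \<subseteq> cof_maps K I" unfolding J_def using fac(4)[OF tj(2)] by auto
  have sJ: "small \<kappa> J"
    unfolding J_def using I(2) P_Obj by (intro small_image small_Sigma assms(4) Sol(1)) auto

  have inj: "r \<in> inj_maps K I" if r: "r \<in> inj_maps ?A J" for r
  proof -
    have rA: "r \<in> Arr ?A" using r unfolding inj_maps_def by blast
    then have rh: "r \<in> Hom (Dom K r) (Cod K r)" "Dom K r \<in> A" "Cod K r \<in> A" unfolding ArrA using Arr_hom by auto
    have "lifts K i r" if i: "i \<in> I" for i
      unfolding lifts_def
    proof (intro ballI impI)
      note ih = I[OF i]
      fix u v assume u: "u \<in> Hom (Dom K i) (Dom K r)" and v: "v \<in> Hom (Cod K i) (Cod K r)"
        and uv: "r \<cdot>\<^bsub>K\<^esub> u = v \<cdot>\<^bsub>K\<^esub> i"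
      obtain s x where s: "s \<in> Sol (Dom K i)" and x: "x \<in> Hom (Cod K s) (Dom K r)" "x \<cdot>\<^bsub>K\<^esub> s = u"
        using Sol(3)[OF ih(2) rh(2) u] by blast
      note sh = Sol_hom(1)[OF ih(2) s] and js = po(1)[OF i s] and ks = po(2)[OF i s]
      have "(r \<cdot>\<^bsub>K\<^esub> x) \<cdot>\<^bsub>K\<^esub> s = v \<cdot>\<^bsub>K\<^esub> i" using assoc[OF rh(1) x(1) sh] x(2) uv by simp
      then obtain h where h: "h \<in> Hom (P i s) (Cod K r)" "h \<cdot>\<^bsub>K\<^esub> j i s = r \<cdot>\<^bsub>K\<^esub> x" "h \<cdot>\<^bsub>K\<^esub> k i s = v"
        using po(4)[OF i s comp_hom[OF rh(1) x(1)] v] by blast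
      obtain t y where t: "t \<in> Sol (P i s)" and y: "y \<in> Hom (Cod K t) (Cod K r)" "y \<cdot>\<^bsub>K\<^esub> t = h"
        using Sol(3)[OF P_Obj[OF i s] rh(3) h(1)] by blast
      note th = Sol_hom(1)[OF P_Obj[OF i s] t]
      \<comment> \<open>The given square is now cut into a square from \<open>i\<close> to
        \<open>g\<close> and one from \<open>g\<close> to \<open>r\<close>. The map
        \<open>c g\<close> belongs to \<open>J\<close>, so the second square, taken from
        \<open>c g\<close> with lower edge \<open>y\<close> after \<open>p g\<close>, has a diagonal
        \<open>l\<close>.\<close>
      define g where "g = t \<cdot>\<^bsub>K\<^esub> j i s"
      note g = tj[OF i s t, folded g_def] and gf = fac(3-5)[OF tj(2)[OF i s t], folded g_def]
      have "c g \<in> J" unfolding J_def g_def using i s t by force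
      then have "lifts ?A (c g) r" "c g \<in> Arr ?A" using r J unfolding inj_maps_def by blast+
      then have "lifts K (c g) r" using lifts_full_subcat[of "c g" K A r] rA by simp
      moreover have "r \<cdot>\<^bsub>K\<^esub> x = (y \<cdot>\<^bsub>K\<^esub> p g) \<cdot>\<^bsub>K\<^esub> c g"
      proof -
        have "(y \<cdot>\<^bsub>K\<^esub> p g) \<cdot>\<^bsub>K\<^esub> c g = y \<cdot>\<^bsub>K\<^esub> t \<cdot>\<^bsub>K\<^esub> j i s"
          using assoc[OF y(1) g(4,3)] gf(1) unfolding g_def by simp
        also have "\<dots> = h \<cdot>\<^bsub>K\<^esub> j i s" using assoc[OF y(1) th js] y(2) by simp
        finally show ?thesis using h(2) by simp
      qed
      ultimately obtain l where l: "l \<in> Hom (Z g) (Dom K r)" "l \<cdot>\<^bsub>K\<^esub> c g = x" "r \<cdot>\<^bsub>K\<^esub> l = y \<cdot>\<^bsub>K\<^esub> p g"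
        using liftsE[of K "c g" r x "y \<cdot>\<^bsub>K\<^esub> p g"] x(1) comp_hom[OF y(1) g(4)] homD(2,3)[OF g(3)] by metis
      have "lifts K i (p g)" using gf(3) i unfolding inj_maps_def by blast
      \<comment> \<open>The square from \<open>i\<close> to \<open>p g\<close> in
        \<open>inj_maps K I\<close>; its diagonal \<open>d\<close>, followed by \<open>l\<close>,
        solves the original lifting problem.\<close>
      moreover have "p g \<cdot>\<^bsub>K\<^esub> c g \<cdot>\<^bsub>K\<^esub> s = (t \<cdot>\<^bsub>K\<^esub> k i s) \<cdot>\<^bsub>K\<^esub> i"
        using assoc[OF g(4,3) sh] gf(1) assoc[OF th js sh] assoc[OF th ks ih(1)] po(3)[OF i s]
        unfolding g_def by simp
      ultimately obtain d where d: "d \<in> Hom (Cod K i) (Z g)" "d \<cdot>\<^bsub>K\<^esub> i = c g \<cdot>\<^bsub>K\<^esub> s"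
          "p g \<cdot>\<^bsub>K\<^esub> d = t \<cdot>\<^bsub>K\<^esub> k i s"
        using liftsE[of K i "p g" "c g \<cdot>\<^bsub>K\<^esub> s" "t \<cdot>\<^bsub>K\<^esub> k i s"] comp_hom[OF g(3) sh] comp_hom[OF th ks]
          homD(2,3)[OF g(4)] by metis
      have "(l \<cdot>\<^bsub>K\<^esub> d) \<cdot>\<^bsub>K\<^esub> i = u"
        using assoc[OF l(1) d(1) ih(1)] d(2) assoc[OF l(1) g(3) sh] l(2) x(2) by simp
      moreover have "r \<cdot>\<^bsub>K\<^esub> l \<cdot>\<^bsub>K\<^esub> d = v"
      proof -
        have "r \<cdot>\<^bsub>K\<^esub> l \<cdot>\<^bsub>K\<^esub> d = y \<cdot>\<^bsub>K\<^esub> t \<cdot>\<^bsub>K\<^esub> k i s"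
          using assoc[OF rh(1) l(1) d(1)] l(3) assoc[OF y(1) g(4) d(1)] d(3) by simp
        also have "\<dots> = v" using assoc[OF y(1) th ks] y(2) h(3) by simp
        finally show ?thesis .
      qed
      ultimately show "\<exists>h\<in>Hom (Cod K i) (Dom K r). h \<cdot>\<^bsub>K\<^esub> i = u \<and> r \<cdot>\<^bsub>K\<^esub> h = v"
        using comp_hom[OF l(1) d(1)] by blast
    qed
    then show ?thesis using homD(1)[OF rh(1)] unfolding inj_maps_def by blast
  qed

  have "cof_maps K I \<inter> Arr ?A = cof_maps ?A J"
  proof
    show "cof_maps K I \<inter> Arr ?A \<subseteq> cof_maps ?A J"
    proof
      fix f assume f: "f \<in> cof_maps K I \<inter> Arr ?A"
      have "lifts ?A f r" if r: "r \<in> inj_maps ?A J" for r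
        \<comment> \<open>A map of the subcategory with the right lifting property for
          \<open>J\<close> has it for \<open>I\<close>, so cofibrations of the whole category lift
          against it; fullness of the subcategory transfers the lift.\<close>
        using f inj[OF r] r lifts_full_subcat[of f K A r] unfolding cof_maps_def inj_maps_def by blast
      then show "f \<in> cof_maps ?A J" using f unfolding cof_maps_def by blast
    qed
    show "cof_maps ?A J \<subseteq> cof_maps K I \<inter> Arr ?A"
    proof
      fix f assume f: "f \<in> cof_maps ?A J"
      then have fA: "f \<in> Arr ?A" unfolding cof_maps_def by blast
      then have fK: "f \<in> Arr K" "Dom K f \<in> A" "Cod K f \<in> A" unfolding ArrA by auto
      note fh = Arr_hom[OF fK(1)] and c = fac(1)[OF fK(1)] and p = fac(2)[OF fK(1)] and F = fac(3-5)[OF fK(1)]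
      have "Z f \<in> A" using A_inj[OF F(3) p fK(3)] .
      then have pA: "p f \<in> Arr ?A" unfolding ArrA using homD(1-3)[OF p] fK(3) by simp
      \<comment> \<open>Maps of \<open>J\<close> are in \<open>cof_maps K I\<close> and
        \<open>p f\<close> is in \<open>inj_maps K I\<close>. As \<open>Z f\<close> lies in
        \<open>A\<close>, the map \<open>p f\<close> is also a map of the subcategory, against which
        \<open>f\<close> can be tested.\<close>
      have "lifts ?A m (p f)" if "m \<in> J" for m
        using that J J_cof F(3) lifts_full_subcat[of m K A "p f"] pA unfolding cof_maps_def by blast
      then have "lifts K f (p f)"
        using f pA fA lifts_full_subcat[OF fA pA] unfolding cof_maps_def inj_maps_def by blast
      \<comment> \<open>The diagonal of the square with upper edge \<open>c f\<close> and lower edge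
        the identity. It is a section of \<open>p f\<close> and exhibits \<open>f\<close> as a
        retract of \<open>c f\<close>, which is in \<open>cof_maps K I\<close>.\<close>
      then obtain h where h: "h \<in> Hom (Cod K f) (Z f)" "h \<cdot>\<^bsub>K\<^esub> f = c f" "p f \<cdot>\<^bsub>K\<^esub> h = Ident K (Cod K f)"
        using liftsE[of K f "p f" "c f" "Ident K (Cod K f)"] c homD(2,3)[OF p] Ident_hom[OF homD(5)[OF fh]]
          F(1) comp_Ident(2)[OF fh] by metis
      have "lifts K f r" if r: "r \<in> inj_maps K I" for r
        unfolding lifts_def
      proof (intro ballI impI)
        fix u v assume u: "u \<in> Hom (Dom K f) (Dom K r)" and v: "v \<in> Hom (Cod K f) (Cod K r)"
          and uv: "r \<cdot>\<^bsub>K\<^esub> u = v \<cdot>\<^bsub>K\<^esub> f"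
        have rh: "r \<in> Hom (Dom K r) (Cod K r)" using r Arr_hom unfolding inj_maps_def by blast
        have "lifts K (c f) r" using F(2) r unfolding cof_maps_def by blast
        moreover have "r \<cdot>\<^bsub>K\<^esub> u = (v \<cdot>\<^bsub>K\<^esub> p f) \<cdot>\<^bsub>K\<^esub> c f" using assoc[OF v p c] F(1) uv by simp
        ultimately obtain l where l: "l \<in> Hom (Z f) (Dom K r)" "l \<cdot>\<^bsub>K\<^esub> c f = u" "r \<cdot>\<^bsub>K\<^esub> l = v \<cdot>\<^bsub>K\<^esub> p f"
          using liftsE[of K "c f" r u "v \<cdot>\<^bsub>K\<^esub> p f"] u comp_hom[OF v p] homD(2,3)[OF c] by metis
        have "(l \<cdot>\<^bsub>K\<^esub> h) \<cdot>\<^bsub>K\<^esub> f = u" using assoc[OF l(1) h(1) fh] h(2) l(2) by simp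
        moreover have "r \<cdot>\<^bsub>K\<^esub> l \<cdot>\<^bsub>K\<^esub> h = v"
          using assoc[OF rh l(1) h(1)] l(3) assoc[OF v p h(1)] h(3) comp_Ident(1)[OF v] by simp
        ultimately show "\<exists>h\<in>Hom (Cod K f) (Dom K r). h \<cdot>\<^bsub>K\<^esub> f = u \<and> r \<cdot>\<^bsub>K\<^esub> h = v"
          using comp_hom[OF l(1) h(1)] by blast
      qed
      then show "f \<in> cof_maps K I \<inter> Arr ?A" using fK(1) fA unfolding cof_maps_def by blast
    qed
  qed
  then show ?thesis using J sJ by blast
qed

end
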